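(* Assume the parametric setting below, with $\sigma_\lambda<\infty$ and $(V,\rho_\lambda)$ compact. Suppose there is $a\in(2,\infty]$ with $G(p)<\infty$ for all $p\in[2,a)$, and let $\tau(p):=K_R^d(p)G(p)$ for $p\in[2,a)$, $z(y):=\ln\tau(1/y)$ for $y\in(1/a,1/2]$, $w(x):=\inf_{y\in(1/a,1/2]}(xy+z(y))$, and $$J:=\int_0^1\exp\big(w(H(V,\rho_\lambda,\epsilon))\big)\,d\epsilon .$$ If $J<\infty$, then $f$ satisfies the NCLT in $C(V,\rho_\lambda)$ (the fields $Q_L[f]$, $Q_\infty$ have continuous versions and $\mathbf EF(Q_L[f])\to\mathbf EF(Q_\infty)$ for every bounded continuous $F\colon C(V)\to\mathbb R$ as $\min_ln(l)\to\infty$ along parallelepipeds $L=[1,n(1)]\times\dots\times[1,n(d)]\cap\mathbb Z_+^d$), and $$\sup_{L}\Big\|\sup_{v\in V}Q_L[f](v)\Big\|G\tau<\infty .$$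
   Context: Let $(X_s,\mathcal B_s,\mu_s)$, $s=1,\dots,d$, be probability spaces and $\{\xi_i(s):i\ge1,1\le s\le d\}$ mutually independent random variables, $\xi_i(s)$ with law $\mu_s$. $|\zeta|_p=(\mathbf E|\zeta|^p)^{1/p}$; for a positive function $\psi$ on $[2,a)$, $\|\zeta\|G\psi:=\sup_{p\in[2,a)}|\zeta|_p/\psi(p)$. $N(\vec k)=\max_sk(s)$. Parametric setting: $V$ is a set and $f(v,\vec x)=\sum_{\vec k:N(\vec k)\le M}\lambda(v,\vec k)\prod_{s=1}^dg^{(s)}_{k(s)}(x(s))$, $M\le\infty$, where for each $s$, $g^{(s)}_1,g^{(s)}_2,\dots$ are centered and orthonormal in $L_2(\mu_s)$. $\sigma_\lambda:=\sup_v\sum_{\vec k}|\lambda(v,\vec k)|$; $\rho_\lambda(v_1,v_2):=\sum_{\vec k}|\lambda(v_1,\vec k)-\lambda(v_2,\vec k)|$; $G(p):=\prod_{s=1}^d\sup_{j\ge1}|g^{(s)}_j(\xi_1(s))|_p$. $Q_L[f](v):=|L|^{-1/2}\sum_{\vec k\in L}f(v,\xi_{k(1)}(1),\dots,\xi_{k(d)}(d))$; $Q_\infty(v):=\sum_{N(\vec k)\le M}\lambda(v,\vec k)\prod_s\beta^{(s)}(k(s))$ with $\{\beta^{(s)}(j)\}$ mutually independent standard normal. $N(V,r,\epsilon)$ is the minimal cardinality of an $\epsilon$-net of $(V,r)$ and $H(V,r,\epsilon)=\ln N(V,r,\epsilon)$. $K_R(p)$ is the smallest constant $K$ such that for all $n$,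 real $c_i$ and i.i.d. centered $\zeta_i$ with finite $p$-th moment, $|\sum c_i\zeta_i|_p\le K(\sum c_i^2)^{1/2}|\zeta_1|_p$. *)

theory Defs
  imports "HOL-Probability.Probability"
begin

text \<open>Multi-indices in Z_+^d: functions nat => nat, positive on {1..d}, zero elsewhere,
  with N(k) = max_s k(s) bounded by the cap Mc (possibly infinite).\<close>
definition Kset :: "nat \<Rightarrow> enat \<Rightarrow> (nat \<Rightarrow> nat) set" where
  "Kset d Mc = {k. (\<forall>s\<in>{1..d}. 1 \<le> k s \<and> enat (k s) \<le> Mc) \<and> (\<forall>s. s \<notin> {1..d} \<longrightarrow> k s = 0)}"

definition sigma_lam_finite :: "'v set \<Rightarrow> nat \<Rightarrow> enat \<Rightarrow> ('v \<Rightarrow> (nat \<Rightarrow> nat) \<Rightarrow> real) \<Rightarrow> bool" where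
  "sigma_lam_finite V d Mc lam \<longleftrightarrow>
     (\<forall>v\<in>V. (\<lambda>k. \<bar>lam v k\<bar>) summable_on Kset d Mc) \<and>
     bdd_above ((\<lambda>v. infsum (\<lambda>k. \<bar>lam v k\<bar>) (Kset d Mc)) ` V)"

definition rho_lam :: "nat \<Rightarrow> enat \<Rightarrow> ('v \<Rightarrow> (nat \<Rightarrow> nat) \<Rightarrow> real) \<Rightarrow> 'v \<Rightarrow> 'v \<Rightarrow> real" where
  "rho_lam d Mc lam v1 v2 = infsum (\<lambda>k. \<bar>lam v1 k - lam v2 k\<bar>) (Kset d Mc)"

text \<open>The kernel f(v,x) = sum_k lambda(v,k) prod_s g^(s)_{k(s)}(x(s)) (pointwise series;
  it converges absolutely almost everywhere under sigma_lambda < infinity).\<close>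
definition f_par :: "nat \<Rightarrow> enat \<Rightarrow> ('v \<Rightarrow> (nat \<Rightarrow> nat) \<Rightarrow> real) \<Rightarrow> (nat \<Rightarrow> nat \<Rightarrow> 'a \<Rightarrow> real)
    \<Rightarrow> 'v \<Rightarrow> (nat \<Rightarrow> 'a) \<Rightarrow> real" where
  "f_par d Mc lam g v x = infsum (\<lambda>k. lam v k * (\<Prod>s\<in>{1..d}. g s (k s) (x s))) (Kset d Mc)"

definition orthonormal_sys :: "(nat \<Rightarrow> 'a measure) \<Rightarrow> (nat \<Rightarrow> nat \<Rightarrow> 'a \<Rightarrow> real) \<Rightarrow> nat \<Rightarrow> bool" where
  "orthonormal_sys \<mu> g d \<longleftrightarrow>
     (\<forall>s\<in>{1..d}. \<forall>i\<ge>1. \<forall>j\<ge>1.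
        g s j \<in> borel_measurable (\<mu> s) \<and> integrable (\<mu> s) (g s j) \<and>
        integrable (\<mu> s) (\<lambda>x. (g s j x)^2) \<and> (\<integral>x. g s j x \<partial>\<mu> s) = 0 \<and>
        (\<integral>x. g s i x * g s j x \<partial>\<mu> s) = (if i = j then 1 else 0))"

definition lpn :: "'w measure \<Rightarrow> ('w \<Rightarrow> real) \<Rightarrow> real \<Rightarrow> real" where
  "lpn P X p = (\<integral>\<omega>. \<bar>X \<omega>\<bar> powr p \<partial>P) powr (1 / p)"

definition G_finite :: "'w measure \<Rightarrow> (nat \<Rightarrow> nat \<Rightarrow> 'w \<Rightarrow> 'a) \<Rightarrow> (nat \<Rightarrow> nat \<Rightarrow> 'a \<Rightarrow> real) \<Rightarrow> nat \<Rightarrow> real \<Rightarrow> bool" where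
  "G_finite P \<xi> g d p \<longleftrightarrow>
     (\<forall>s\<in>{1..d}. (\<forall>j\<ge>1. integrable P (\<lambda>\<omega>. \<bar>g s j (\<xi> 1 s \<omega>)\<bar> powr p)) \<and>
        bdd_above ((\<lambda>j. lpn P (\<lambda>\<omega>. g s j (\<xi> 1 s \<omega>)) p) ` {1..}))"

definition Gfun :: "'w measure \<Rightarrow> (nat \<Rightarrow> nat \<Rightarrow> 'w \<Rightarrow> 'a) \<Rightarrow> (nat \<Rightarrow> nat \<Rightarrow> 'a \<Rightarrow> real) \<Rightarrow> nat \<Rightarrow> real \<Rightarrow> real" where
  "Gfun P \<xi> g d p = (\<Prod>s\<in>{1..d}. (SUP j\<in>{1..}. lpn P (\<lambda>\<omega>. g s j (\<xi> 1 s \<omega>)) p))"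

text \<open>Rosenthal constant K_R(p): smallest K such that for all n, real c_i and i.i.d. centered
  zeta_i with finite p-th moment, |sum c_i zeta_i|_p <= K (sum c_i^2)^(1/2) |zeta_1|_p.
  i.i.d. sequences are represented canonically as coordinates of a product of a common law.\<close>
definition KR :: "real \<Rightarrow> real" where
  "KR p = Inf {K. \<forall>(n::nat) (c::nat \<Rightarrow> real) (m::real measure).
      prob_space m \<and> sets m = sets borel \<and> integrable m (\<lambda>x. x) \<and> (\<integral>x. x \<partial>m) = 0 \<and>
      integrable m (\<lambda>x. \<bar>x\<bar> powr p) \<longrightarrow>
      lpn (PiM {..<n} (\<lambda>_. m)) (\<lambda>\<omega>. \<Sum>i<n. c i * \<omega> i) p
        \<le> K * sqrt (\<Sum>i<n. (c i)^2) * lpn m (\<lambda>x. x) p}"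

definition tau :: "'w measure \<Rightarrow> (nat \<Rightarrow> nat \<Rightarrow> 'w \<Rightarrow> 'a) \<Rightarrow> (nat \<Rightarrow> nat \<Rightarrow> 'a \<Rightarrow> real) \<Rightarrow> nat \<Rightarrow> real \<Rightarrow> real" where
  "tau P \<xi> g d p = KR p ^ d * Gfun P \<xi> g d p"

definition wfun :: "ereal \<Rightarrow> (real \<Rightarrow> real) \<Rightarrow> real \<Rightarrow> real" where
  "wfun a z x = (INF y\<in>{y::real. inverse a < ereal y \<and> y \<le> 1/2}. x * y + z y)"

definition cover_num :: "'v set \<Rightarrow> ('v \<Rightarrow> 'v \<Rightarrow> real) \<Rightarrow> real \<Rightarrow> nat" where
  "cover_num V r \<epsilon> = (LEAST n. \<exists>S. S \<subseteq> V \<and> finite S \<and> card S = n \<and> (\<forall>v\<in>V. \<exists>u\<in>S. r v u \<le> \<epsilon>))"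

definition Hent :: "'v set \<Rightarrow> ('v \<Rightarrow> 'v \<Rightarrow> real) \<Rightarrow> real \<Rightarrow> real" where
  "Hent V r \<epsilon> = ln (real (cover_num V r \<epsilon>))"

definition pm_compact :: "'v set \<Rightarrow> ('v \<Rightarrow> 'v \<Rightarrow> real) \<Rightarrow> bool" where
  "pm_compact V r \<longleftrightarrow> (\<forall>x::nat \<Rightarrow> 'v. (\<forall>n. x n \<in> V) \<longrightarrow>
     (\<exists>l\<in>V. \<exists>h. strict_mono h \<and> (\<lambda>n. r (x (h n)) l) \<longlonglongrightarrow> 0))"

definition CV :: "'v set \<Rightarrow> ('v \<Rightarrow> 'v \<Rightarrow> real) \<Rightarrow> ('v \<Rightarrow> real) set" where
  "CV V r = {h. (\<forall>v\<in>V. \<forall>e>0. \<exists>\<delta>>0. \<forall>u\<in>V. r u v < \<delta> \<longrightarrow> \<bar>h u - h v\<bar> < e) \<and>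
               (\<forall>v. v \<notin> V \<longrightarrow> h v = 0)}"

definition bounded_cont_fun :: "'v set \<Rightarrow> ('v \<Rightarrow> 'v \<Rightarrow> real) \<Rightarrow> (('v \<Rightarrow> real) \<Rightarrow> real) \<Rightarrow> bool" where
  "bounded_cont_fun V r F \<longleftrightarrow> (\<exists>B. \<forall>h\<in>CV V r. \<bar>F h\<bar> \<le> B) \<and>
     (\<forall>h\<in>CV V r. \<forall>e>0. \<exists>\<delta>>0. \<forall>h'\<in>CV V r. (SUP v\<in>V. \<bar>h' v - h v\<bar>) < \<delta> \<longrightarrow> \<bar>F h' - F h\<bar> < e)"

definition cont_version :: "'w measure \<Rightarrow> 'v set \<Rightarrow> ('v \<Rightarrow> 'v \<Rightarrow> real) \<Rightarrow> ('w \<Rightarrow> 'v \<Rightarrow> real) \<Rightarrow> ('v \<Rightarrow> 'w \<Rightarrow> real) \<Rightarrow> bool" where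
  "cont_version P V r Y X \<longleftrightarrow> (\<forall>\<omega>\<in>space P. Y \<omega> \<in> CV V r) \<and>
     (\<forall>v\<in>V. (\<lambda>\<omega>. Y \<omega> v) \<in> borel_measurable P \<and> (AE \<omega> in P. Y \<omega> v = X v \<omega>))"

definition Lbox :: "nat \<Rightarrow> (nat \<Rightarrow> nat) \<Rightarrow> (nat \<Rightarrow> nat) set" where
  "Lbox d n = {k. (\<forall>s\<in>{1..d}. 1 \<le> k s \<and> k s \<le> n s) \<and> (\<forall>s. s \<notin> {1..d} \<longrightarrow> k s = 0)}"

definition QL :: "(nat \<Rightarrow> nat \<Rightarrow> 'w \<Rightarrow> 'a) \<Rightarrow> nat \<Rightarrow> enat \<Rightarrow> ('v \<Rightarrow> (nat \<Rightarrow> nat) \<Rightarrow> real)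
    \<Rightarrow> (nat \<Rightarrow> nat \<Rightarrow> 'a \<Rightarrow> real) \<Rightarrow> (nat \<Rightarrow> nat) \<Rightarrow> 'v \<Rightarrow> 'w \<Rightarrow> real" where
  "QL \<xi> d Mc lam g n v \<omega> = real (card (Lbox d n)) powr (-1/2) *
     (\<Sum>k\<in>Lbox d n. f_par d Mc lam g v (\<lambda>s. \<xi> (k s) s \<omega>))"

definition Qinf :: "(nat \<Rightarrow> nat \<Rightarrow> 'u \<Rightarrow> real) \<Rightarrow> nat \<Rightarrow> enat \<Rightarrow> ('v \<Rightarrow> (nat \<Rightarrow> nat) \<Rightarrow> real) \<Rightarrow> 'v \<Rightarrow> 'u \<Rightarrow> real" where
  "Qinf \<beta> d Mc lam v \<omega> = infsum (\<lambda>k. lam v k * (\<Prod>s\<in>{1..d}. \<beta> s (k s) \<omega>)) (Kset d Mc)"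

end

theory Submission
  imports Defs
begin

text \<open>
  Since \<open>f\<close> is a sum of products, \<open>Q\<^sub>L(v)\<close> is the sum over \<open>k\<close> of \<open>\<lambda>(v,k)\<close> times the product over \<open>s\<close>
  of the normalized sums of \<open>g\<^sub>j(\<xi>\<^sub>i(s))\<close>, \<open>i \<le> n(s)\<close>, with \<open>j = k(s)\<close>. These products have \<open>p\<close>-th norm
  at most \<open>\<tau>(p)\<close>, by independence over \<open>s\<close> and the choice of \<open>K\<^sub>R\<close>, so increments of \<open>Q\<^sub>L\<close> have norm at
  most \<open>\<tau>(p) \<rho>(u,v)\<close>. Dyadic chaining with a nearly optimal exponent at each scale bounds the supremum
  of any partial sum over finitely many \<open>k\<close>; the bound tends to \<open>0\<close> with the supremum over \<open>v\<close> of the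
  corresponding sums of \<open>|\<lambda>(v,k)|\<close>, and these are uniformly small far out because \<open>V\<close> is compact. Hence
  the finite partial sums, which are continuous in \<open>v\<close>, converge uniformly to a continuous version, at
  a rate that does not depend on \<open>L\<close>. This reduces the limit theorem to finitely many \<open>k\<close>, where it
  follows from the one-dimensional central limit theorem and independence over \<open>s\<close>. The same estimates
  apply to the Gaussian field since, by the central limit theorem and Fatou's lemma, the norm of a
  standard normal variable is at most the bound for the normalized sums.
\<close>

section \<open>Moment bounds\<close>

text \<open>The final estimate needs one constant for all exponents at once, while each chaining
  link is priced with an exponent of its own. What makes this possible is
  \<open>1 \<le> tau p\<close>: a link priced with \<open>q\<close> costs at most
  \<open>tau p\<close> times that price in the \<open>p\<close>-th norm, whether \<open>p\<close> is
  smaller or larger than \<open>q\<close>. So \<open>tau p\<close> factors out of the chain and a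
  series \<open>Phi\<close> free of \<open>p\<close> remains. The lower bound on \<open>tau\<close>
  comes from \<open>1 \<le> KR p\<close> and from the unit variance of the \<open>g s j\<close>. A
  second obstacle is measurability. No sigma-algebra on functions is used, so measurability of
  \<open>F (Y \<omega>)\<close> is produced for each functional separately: on finite partial sums
  \<open>F\<close> is a continuous function of finitely many reals, and uniform convergence does the
  rest. Finally, a bounded continuous functional on C(V) need not be uniformly continuous, so moment
  bounds for the truncation error do not control it directly. Lipschitz functionals are therefore
  treated first and then used to approximate the others from one side.\<close>

definition mom_le :: "'w measure \<Rightarrow> real \<Rightarrow> ('w \<Rightarrow> real) \<Rightarrow> real \<Rightarrow> bool" where
  "mom_le M p X c \<longleftrightarrow> X \<in> borel_measurable M \<and> 0 \<le> c \<and>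
     (\<integral>\<^sup>+x. ennreal (\<bar>X x\<bar> powr p) \<partial>M) \<le> ennreal (c powr p)"

lemma mom_leD:
  assumes "mom_le M p X c"
  shows "X \<in> borel_measurable M" "0 \<le> c" "(\<integral>\<^sup>+x. ennreal (\<bar>X x\<bar> powr p) \<partial>M) \<le> ennreal (c powr p)"
  using assms by (auto simp: mom_le_def)

lemma mom_le_mono_AE:
  assumes "mom_le M p X c" "Y \<in> borel_measurable M" "AE x in M. \<bar>Y x\<bar> \<le> \<bar>X x\<bar>" "c \<le> c'" "0 \<le> p"
  shows "mom_le M p Y c'"
proof -
  have "(\<integral>\<^sup>+x. ennreal (\<bar>Y x\<bar> powr p) \<partial>M) \<le> (\<integral>\<^sup>+x. ennreal (\<bar>X x\<bar> powr p) \<partial>M)"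
    using assms(3) by (intro nn_integral_mono_AE) (auto elim!: eventually_mono intro!: ennreal_leI powr_mono2 assms(5))
  also have "\<dots> \<le> ennreal (c powr p)" using assms(1) by (simp add: mom_le_def)
  also have "\<dots> \<le> ennreal (c' powr p)"
    using assms by (intro ennreal_leI powr_mono2) (auto simp: mom_le_def)
  finally show ?thesis using assms by (auto simp: mom_le_def)
qed

lemma mom_le_mono:
  assumes "mom_le M p X c" "Y \<in> borel_measurable M" "\<And>x. x \<in> space M \<Longrightarrow> \<bar>Y x\<bar> \<le> \<bar>X x\<bar>" "c \<le> c'" "0 \<le> p"
  shows "mom_le M p Y c'"
  using assms by (intro mom_le_mono_AE[OF assms(1)]) auto

lemma mom_le_scale:
  assumes "mom_le M p X c"
  shows "mom_le M p (\<lambda>x. a * X x) (\<bar>a\<bar> * c)"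
proof -
  note [measurable] = mom_leD(1)[OF assms]
  have "(\<integral>\<^sup>+x. ennreal (\<bar>a * X x\<bar> powr p) \<partial>M) = (\<integral>\<^sup>+x. ennreal (\<bar>a\<bar> powr p) * ennreal (\<bar>X x\<bar> powr p) \<partial>M)"
    by (intro nn_integral_cong) (simp add: abs_mult powr_mult ennreal_mult')
  also have "\<dots> = ennreal (\<bar>a\<bar> powr p) * (\<integral>\<^sup>+x. ennreal (\<bar>X x\<bar> powr p) \<partial>M)"
    by (intro nn_integral_cmult) measurable
  also have "\<dots> \<le> ennreal (\<bar>a\<bar> powr p) * ennreal (c powr p)"
    using assms by (intro mult_left_mono) (auto simp: mom_le_def)
  also have "\<dots> = ennreal ((\<bar>a\<bar> * c) powr p)"
    using mom_leD(2)[OF assms] by (simp add: powr_mult ennreal_mult')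
  finally show ?thesis using mom_leD(2)[OF assms] by (auto simp: mom_le_def)
qed

lemma mom_le_0:
  assumes "mom_le M p X 0"
  shows "AE x in M. X x = 0"
proof -
  note [measurable] = mom_leD(1)[OF assms]
  have "(\<integral>\<^sup>+x. ennreal (\<bar>X x\<bar> powr p) \<partial>M) = 0"
    using mom_leD(3)[OF assms] by simp
  then have "AE x in M. ennreal (\<bar>X x\<bar> powr p) = 0"
    by (subst (asm) nn_integral_0_iff_AE) measurable
  then show ?thesis by (auto elim!: eventually_mono)
qed

lemma ennreal_lincomb:
  assumes "0 \<le> a" "0 \<le> b" "0 \<le> u" "0 \<le> v"
  shows "ennreal a * ennreal u + ennreal b * ennreal v = ennreal (a * u + b * v)"
  using assms by (simp add: ennreal_mult')

text \<open>Interior points are covered by convexity of the power function on the positive half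
  line. If one argument is 0, the claim reduces to \<open>s powr p \<le> s\<close> for
  \<open>0 < s < 1\<close>.\<close>

lemma powr_convex_nonneg:
  fixes x y t p :: real
  assumes "1 \<le> p" "0 \<le> x" "0 \<le> y" "0 < t" "t < 1"
  shows "(t * x + (1 - t) * y) powr p \<le> t * x powr p + (1 - t) * y powr p"
proof -
  have shrink: "(s * u) powr p \<le> s * u powr p" if "0 < s" "s < 1" "0 \<le> u" for s u :: real
  proof -
    have "s powr p \<le> s powr 1" using that assms(1) by (intro powr_mono') auto
    then show ?thesis using that by (simp add: powr_mult mult_right_mono)
  qed
  consider "x = 0" | "y = 0" | "x > 0" "y > 0" using assms by linarith
  then show ?thesis
  proof cases
    case 3
    then show ?thesis
      using convex_onD[OF powr_convex[of p], of "1 - t" x y] assms by auto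
  qed (use shrink[of "1 - t" y] shrink[of t x] assms in auto)
qed

text \<open>Minkowski's inequality. |X + Y| is at most a + b times the convex combination of |X|/a
  and |Y|/b with weights a/(a+b) and b/(a+b), so convexity of the p-th power integrates to the
  claim. If one of the bounds is 0, that variable vanishes almost everywhere.\<close>

lemma mom_le_add:
  assumes X: "mom_le M p X a" and Y: "mom_le M p Y b" and p: "1 \<le> p"
  shows "mom_le M p (\<lambda>x. X x + Y x) (a + b)"
proof -
  note [measurable] = mom_leD(1)[OF X] mom_leD(1)[OF Y]
  consider "a = 0" | "b = 0" | "a > 0" "b > 0"
    using mom_leD(2)[OF X] mom_leD(2)[OF Y] by linarith
  then show ?thesis
  proof cases
    case 1
    show ?thesis using mom_le_0[of M p X] X 1 p
      by (intro mom_le_mono_AE[OF Y]) auto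
  next
    case 2
    show ?thesis using mom_le_0[of M p Y] Y 2 p
      by (intro mom_le_mono_AE[OF X]) auto
  next
    case 3
    define t where "t = a / (a + b)"
    have t: "0 < t" "t < 1" "1 - t = b / (a + b)" using 3 by (auto simp: t_def field_simps)
    define K where "K = (a + b) powr p"
    have le: "\<bar>X x + Y x\<bar> powr p \<le> K * t / a powr p * \<bar>X x\<bar> powr p + K * (1 - t) / b powr p * \<bar>Y x\<bar> powr p" for x
    proof -
      have "\<bar>X x + Y x\<bar> powr p \<le> (\<bar>X x\<bar> + \<bar>Y x\<bar>) powr p" using p by (intro powr_mono2) auto
      also have "\<bar>X x\<bar> + \<bar>Y x\<bar> = (a + b) * (t * (\<bar>X x\<bar> / a) + (1 - t) * (\<bar>Y x\<bar> / b))"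
      proof -
        have "(a + b) * t = a" "(a + b) * (1 - t) = b" unfolding t(3) unfolding t_def using 3 by simp_all
        then have "(a + b) * (t * (\<bar>X x\<bar> / a) + (1 - t) * (\<bar>Y x\<bar> / b)) = a * (\<bar>X x\<bar> / a) + b * (\<bar>Y x\<bar> / b)"
          by (metis (no_types, lifting) distrib_left mult.assoc)
        then show ?thesis using 3 by simp
      qed
      also have "\<dots> powr p = K * (t * (\<bar>X x\<bar> / a) + (1 - t) * (\<bar>Y x\<bar> / b)) powr p"
        unfolding K_def using 3 t by (intro powr_mult)
      also have "\<dots> \<le> K * (t * (\<bar>X x\<bar> / a) powr p + (1 - t) * (\<bar>Y x\<bar> / b) powr p)"
      proof (intro mult_left_mono)
        show "(t * (\<bar>X x\<bar> / a) + (1 - t) * (\<bar>Y x\<bar> / b)) powr p \<le> t * (\<bar>X x\<bar> / a) powr p + (1 - t) * (\<bar>Y x\<bar> / b) powr p"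
          using t 3 p by (intro powr_convex_nonneg) auto
      qed (simp add: K_def)
      also have "\<dots> = K * t / a powr p * \<bar>X x\<bar> powr p + K * (1 - t) / b powr p * \<bar>Y x\<bar> powr p"
        using 3 by (simp add: powr_divide field_simps)
      finally show ?thesis .
    qed
    have nn: "0 \<le> K * t / a powr p" "0 \<le> K * (1 - t) / b powr p"
      using t(1,2) 3 by (auto simp: K_def)
    have "(\<integral>\<^sup>+x. ennreal (\<bar>X x + Y x\<bar> powr p) \<partial>M) \<le> (\<integral>\<^sup>+x. ennreal (K * t / a powr p) * ennreal (\<bar>X x\<bar> powr p) + ennreal (K * (1 - t) / b powr p) * ennreal (\<bar>Y x\<bar> powr p) \<partial>M)"
      using le nn by (intro nn_integral_mono) (simp only: ennreal_lincomb powr_ge_zero ennreal_leI)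
    also have "\<dots> = ennreal (K * t / a powr p) * (\<integral>\<^sup>+x. ennreal (\<bar>X x\<bar> powr p) \<partial>M) + ennreal (K * (1 - t) / b powr p) * (\<integral>\<^sup>+x. ennreal (\<bar>Y x\<bar> powr p) \<partial>M)"
      by (subst nn_integral_add) (simp_all add: nn_integral_cmult)
    also have "\<dots> \<le> ennreal (K * t / a powr p) * ennreal (a powr p) + ennreal (K * (1 - t) / b powr p) * ennreal (b powr p)"
      using mom_leD(3)[OF X] mom_leD(3)[OF Y] by (intro add_mono mult_left_mono) auto
    also have "\<dots> = ennreal (K * t / a powr p * a powr p + K * (1 - t) / b powr p * b powr p)"
      by (intro ennreal_lincomb nn) auto
    also have "K * t / a powr p * a powr p + K * (1 - t) / b powr p * b powr p = (a + b) powr p"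
      using 3 by (simp add: K_def field_simps)
    finally show ?thesis using 3 by (auto simp: mom_le_def)
  qed
qed

lemma mom_le_sum:
  assumes "finite I" "\<And>i. i \<in> I \<Longrightarrow> mom_le M p (X i) (c i)" "1 \<le> p"
  shows "mom_le M p (\<lambda>x. \<Sum>i\<in>I. X i x) (\<Sum>i\<in>I. c i)"
  using assms
proof (induction I rule: finite_induct)
  case empty
  then show ?case by (simp add: mom_le_def)
next
  case (insert i I)
  then show ?case by (simp add: mom_le_add)
qed

lemma mom_le_weighted_sum:
  assumes "finite I" "\<And>i. i \<in> I \<Longrightarrow> mom_le M p (X i) c" "1 \<le> p" "(\<Sum>i\<in>I. \<bar>a i\<bar>) \<le> b" "0 \<le> c"
  shows "mom_le M p (\<lambda>x. \<Sum>i\<in>I. a i * X i x) (c * b)"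
proof -
  have "mom_le M p (\<lambda>x. \<Sum>i\<in>I. a i * X i x) (\<Sum>i\<in>I. \<bar>a i\<bar> * c)"
    using assms by (intro mom_le_sum mom_le_scale) auto
  then show ?thesis
    by (rule mom_le_mono) (use assms in \<open>auto simp: mom_le_def sum_distrib_right[symmetric] mult.commute[of c] mult_right_mono intro!: borel_measurable_sum borel_measurable_times\<close>)
qed

text \<open>Fatou's lemma. It carries bounds from maxima over finite nets to suprema over
  \<open>V\<close>, from finite partial sums to the limit fields, and from truncated to full
  Gaussian moments.\<close>

lemma mom_le_limit:
  assumes X: "\<And>n. mom_le M p (X n) (c n)" and Y: "Y \<in> borel_measurable M"
    and lim: "AE x in M. (\<lambda>n. X n x) \<longlonglongrightarrow> Y x" and c: "\<And>n. c n \<le> b" and p: "0 < p"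
  shows "mom_le M p Y b"
proof -
  note [measurable] = mom_leD(1)[OF X] Y
  have "(\<integral>\<^sup>+x. ennreal (\<bar>Y x\<bar> powr p) \<partial>M) = (\<integral>\<^sup>+x. liminf (\<lambda>n. ennreal (\<bar>X n x\<bar> powr p)) \<partial>M)"
  proof (intro nn_integral_cong_AE, use lim in eventually_elim)
    fix x assume "(\<lambda>n. X n x) \<longlonglongrightarrow> Y x"
    then have "(\<lambda>n. ennreal (\<bar>X n x\<bar> powr p)) \<longlonglongrightarrow> ennreal (\<bar>Y x\<bar> powr p)"
      using p by (intro tendsto_ennrealI tendsto_powr' tendsto_rabs) auto
    then show "ennreal (\<bar>Y x\<bar> powr p) = liminf (\<lambda>n. ennreal (\<bar>X n x\<bar> powr p))"
      by (intro lim_imp_Liminf[symmetric]) auto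
  qed
  also have "\<dots> \<le> liminf (\<lambda>n. \<integral>\<^sup>+x. ennreal (\<bar>X n x\<bar> powr p) \<partial>M)"
    by (intro nn_integral_liminf) measurable
  also have "\<dots> \<le> liminf (\<lambda>n::nat. ennreal (b powr p))"
    using mom_leD(2,3)[OF X] c p
    by (intro Liminf_mono always_eventually allI) (meson order_trans ennreal_leI powr_mono2 less_imp_le)
  also have "\<dots> = ennreal (b powr p)" by (simp add: Liminf_const)
  finally show ?thesis using Y mom_leD(2)[OF X] c by (auto simp: mom_le_def intro: order_trans)
qed

text \<open>Integrates the pointwise inequality u^p <= (p/q) u^q + (1 - p/q) at u = |X|/c. That
  inequality is convexity of exp between the points 0 and q ln u.\<close>

lemma (in prob_space) mom_le_Lyapunov:
  assumes X: "mom_le M q X c" and p: "0 < p" "p \<le> q"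
  shows "mom_le M p X c"
proof (cases "c = 0")
  case True
  have "AE x in M. X x = 0" using X mom_le_0 True by blast
  then have "(\<integral>\<^sup>+x. ennreal (\<bar>X x\<bar> powr p) \<partial>M) = (\<integral>\<^sup>+x. 0 \<partial>M)"
    by (intro nn_integral_cong_AE) (auto elim!: eventually_mono)
  then show ?thesis using mom_leD[OF X] by (auto simp: mom_le_def)
next
  case False
  then have c: "0 < c" using mom_leD(2)[OF X] by simp
  note [measurable] = mom_leD(1)[OF X]
  have young: "u powr p \<le> p / q * u powr q + (1 - p / q)" if "0 \<le> u" for u :: real
  proof (cases "u = 0")
    case True then show ?thesis using p by auto
  next
    case False
    then have u: "0 < u" using that by simp
    have "(1 - p/q) *\<^sub>R 0 + (p/q) *\<^sub>R (q * ln u) = p * ln u" using p by simp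
    moreover have "exp ((1 - p/q) *\<^sub>R 0 + (p/q) *\<^sub>R (q * ln u)) \<le> (1 - p/q) * exp 0 + (p/q) * exp (q * ln u)"
      using p by (intro convex_onD[OF exp_convex]) auto
    ultimately show ?thesis using u by (simp add: powr_def)
  qed
  have "(\<integral>\<^sup>+x. ennreal (\<bar>X x\<bar> powr p) \<partial>M) \<le> (\<integral>\<^sup>+x. ennreal (c powr p * (p / q) / c powr q) * ennreal (\<bar>X x\<bar> powr q) + ennreal (c powr p * (1 - p / q)) \<partial>M)"
  proof (intro nn_integral_mono)
    fix x
    have "\<bar>X x\<bar> powr p = c powr p * (\<bar>X x\<bar> / c) powr p" using c by (simp add: powr_divide)
    also have "\<dots> \<le> c powr p * (p / q * (\<bar>X x\<bar> / c) powr q + (1 - p / q))"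
      using c by (intro mult_left_mono young) auto
    also have "\<dots> = c powr p * (p / q) / c powr q * \<bar>X x\<bar> powr q + c powr p * (1 - p / q)"
      using c by (simp add: powr_divide algebra_simps)
    finally show "ennreal (\<bar>X x\<bar> powr p) \<le> ennreal (c powr p * (p / q) / c powr q) * ennreal (\<bar>X x\<bar> powr q) + ennreal (c powr p * (1 - p / q))"
      using p c by (simp add: ennreal_mult'[symmetric] ennreal_plus[symmetric] ennreal_leI del: ennreal_plus)
  qed
  also have "\<dots> = ennreal (c powr p * (p / q) / c powr q) * (\<integral>\<^sup>+x. ennreal (\<bar>X x\<bar> powr q) \<partial>M) + ennreal (c powr p * (1 - p / q))"
    by (subst nn_integral_add) (auto simp: nn_integral_cmult emeasure_space_1)
  also have "\<dots> \<le> ennreal (c powr p * (p / q) / c powr q) * ennreal (c powr q) + ennreal (c powr p * (1 - p / q))"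
    using mom_leD(3)[OF X] by (intro add_mono mult_left_mono) auto
  also have "\<dots> = ennreal (c powr p)"
  proof -
    have "c powr p * (p / q) / c powr q * c powr q + c powr p * (1 - p / q) = c powr p"
      using c by (simp add: algebra_simps)
    moreover have A: "0 \<le> c powr p * (p / q) / c powr q" "0 \<le> c powr p * (1 - p / q)" using p by auto
    ultimately show ?thesis
      using A by (metis ennreal_mult' ennreal_plus mult_nonneg_nonneg powr_ge_zero)
  qed
  finally show ?thesis using c by (auto simp: mom_le_def)
qed

text \<open>The p-th power of a maximum is at most the sum of the p-th powers. The resulting factor
  \<open>card S powr (1 / p)\<close> is where entropy enters the chaining.\<close>

lemma mom_le_Max:
  assumes S: "finite S" "S \<noteq> {}" and X: "\<And>u. u \<in> S \<Longrightarrow> mom_le M p (X u) c" and p: "0 < p" and c: "0 \<le> c"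
  shows "mom_le M p (\<lambda>x. MAX u\<in>S. \<bar>X u x\<bar>) (real (card S) powr (1 / p) * c)"
proof -
  have [measurable]: "\<And>u. u \<in> S \<Longrightarrow> X u \<in> borel_measurable M" using X mom_leD(1) by blast
  have m: "(\<lambda>x. MAX u\<in>S. \<bar>X u x\<bar>) \<in> borel_measurable M"
    using S by (intro borel_measurable_Max) auto
  have "(\<integral>\<^sup>+x. ennreal (\<bar>MAX u\<in>S. \<bar>X u x\<bar>\<bar> powr p) \<partial>M) \<le> (\<integral>\<^sup>+x. (\<Sum>u\<in>S. ennreal (\<bar>X u x\<bar> powr p)) \<partial>M)"
  proof (intro nn_integral_mono)
    fix x
    have "Max ((\<lambda>u. \<bar>X u x\<bar>) ` S) \<in> (\<lambda>u. \<bar>X u x\<bar>) ` S" using S by (intro Max_in) auto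
    then obtain u where u: "u \<in> S" "(MAX u\<in>S. \<bar>X u x\<bar>) = \<bar>X u x\<bar>" by auto
    show "ennreal (\<bar>MAX u\<in>S. \<bar>X u x\<bar>\<bar> powr p) \<le> (\<Sum>u\<in>S. ennreal (\<bar>X u x\<bar> powr p))"
      unfolding u(2) abs_abs using S u(1) by (intro member_le_sum) auto
  qed
  also have "\<dots> = (\<Sum>u\<in>S. \<integral>\<^sup>+x. ennreal (\<bar>X u x\<bar> powr p) \<partial>M)"
    by (intro nn_integral_sum) measurable
  also have "\<dots> \<le> (\<Sum>u\<in>S. ennreal (c powr p))"
    using X by (intro sum_mono mom_leD(3))
  also have "\<dots> = ennreal ((real (card S) powr (1 / p) * c) powr p)"
    using p c by (simp add: powr_mult powr_powr ennreal_mult' ennreal_of_nat_eq_real_of_nat)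
  finally show ?thesis using m c by (auto simp: mom_le_def)
qed

lemma mom_le_integrable:
  assumes X: "mom_le M p X c"
  shows "integrable M (\<lambda>x. \<bar>X x\<bar> powr p)"
proof (intro integrableI_nonneg)
  show "(\<lambda>x. \<bar>X x\<bar> powr p) \<in> borel_measurable M" using mom_leD(1)[OF X] by measurable
  show "(\<integral>\<^sup>+ x. ennreal (\<bar>X x\<bar> powr p) \<partial>M) < \<infinity>"
    using mom_leD(3)[OF X] by (rule le_less_trans) simp
qed auto

lemma mom_le_integral:
  assumes X: "mom_le M p X c"
  shows "(\<integral>x. \<bar>X x\<bar> powr p \<partial>M) \<le> c powr p"
proof -
  have "ennreal (\<integral>x. \<bar>X x\<bar> powr p \<partial>M) = (\<integral>\<^sup>+ x. ennreal (\<bar>X x\<bar> powr p) \<partial>M)"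
    by (intro nn_integral_eq_integral[symmetric] mom_le_integrable[OF X]) auto
  also have "\<dots> \<le> ennreal (c powr p)" by (rule mom_leD(3)[OF X])
  finally show ?thesis by (simp add: ennreal_le_iff)
qed

lemma mom_le_lpn:
  assumes X: "mom_le M p X c" and p: "0 < p"
  shows "lpn M X p \<le> c"
proof -
  have "lpn M X p \<le> (c powr p) powr (1 / p)"
    unfolding lpn_def using mom_le_integral[OF X] p by (intro powr_mono2) auto
  also have "\<dots> = c" using p mom_leD(2)[OF X] by (simp add: powr_powr)
  finally show ?thesis .
qed

lemma lpn_nonneg: "0 \<le> lpn M X p" by (simp add: lpn_def)

text \<open>\<open>lpn\<close> is built on the Bochner integral, which is 0 for a non-integrable
  integrand, so a bound on \<open>lpn\<close> is meaningful only together with integrability.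
  \<open>mom_le\<close> uses the nonnegative integral and contains both.\<close>

lemma mom_le_iff_lpn:
  assumes "X \<in> borel_measurable M" "integrable M (\<lambda>x. \<bar>X x\<bar> powr p)" "0 < p"
  shows "mom_le M p X c \<longleftrightarrow> lpn M X p \<le> c"
proof
  assume "lpn M X p \<le> c"
  have "(\<integral>x. \<bar>X x\<bar> powr p \<partial>M) = lpn M X p powr p"
    using assms by (simp add: lpn_def powr_powr)
  also have "\<dots> \<le> c powr p" using \<open>lpn M X p \<le> c\<close> assms by (intro powr_mono2) (auto simp: lpn_def)
  finally show "mom_le M p X c"
    using assms \<open>lpn M X p \<le> c\<close> lpn_nonneg[of M X p]
    by (auto simp: mom_le_def nn_integral_eq_integral intro!: ennreal_leI)
qed (use assms mom_le_lpn in blast)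

lemma mom_le_distr:
  assumes f: "f \<in> measurable M N" and X: "X \<in> borel_measurable N"
  shows "mom_le (distr M N f) p X c \<longleftrightarrow> mom_le M p (\<lambda>x. X (f x)) c"
  using assms by (simp add: mom_le_def nn_integral_distr)

lemma mom_le_1D:
  assumes "mom_le M 1 X c"
  shows "integrable M X" "(\<integral>x. \<bar>X x\<bar> \<partial>M) \<le> c"
proof -
  have "integrable M (\<lambda>x. \<bar>X x\<bar>)" using mom_le_integrable[OF assms] by simp
  then show "integrable M X" using mom_leD(1)[OF assms] by (simp add: integrable_abs_iff)
  show "(\<integral>x. \<bar>X x\<bar> \<partial>M) \<le> c" using mom_le_integral[OF assms] mom_leD(2)[OF assms] by simp
qed

section \<open>The Rosenthal constant\<close>

text \<open>An upper Taylor-type bound for |s + y|^p around s. The linear term is kept exactly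
  because it integrates to zero against a centered law of y; the constant is paid only for the
  quadratic term and for large y.\<close>

definition power_expansion_const :: "real \<Rightarrow> real \<Rightarrow> bool" where
  "power_expansion_const p C \<longleftrightarrow> 1 \<le> C \<and> (\<forall>s y. \<bar>s + y\<bar> powr p \<le>
     \<bar>s\<bar> powr p + p * \<bar>s\<bar> powr (p - 1) * sgn s * y + C * (\<bar>s\<bar> powr (p - 2) * y\<^sup>2 + \<bar>y\<bar> powr p))"

text \<open>The three summands of \<open>C\<close> answer two regimes. For |t| <= 1/2, (1 + t)^p <=
  exp(p t), and the Lagrange remainder of exp is at most exp(p/2) (p t)^2. For |t| > 1/2, |1 + t| <=
  3 |t| produces 3^p, and 2 p makes 1 + p t + C t^2 nonnegative, so that the term C |t|^p alone
  carries the bound.\<close>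

lemma powr_one_plus_le:
  fixes p t :: real
  assumes p: "2 \<le> p"
  defines "C \<equiv> 3 powr p + 2 * p + exp (p / 2) * p\<^sup>2"
  shows "\<bar>1 + t\<bar> powr p \<le> 1 + p * t + C * (t\<^sup>2 + \<bar>t\<bar> powr p)"
proof -
  have C: "3 powr p \<le> C" "2 * p \<le> C" "exp (p / 2) * p\<^sup>2 \<le> C" "0 \<le> C"
    using p by (auto simp: C_def intro!: add_nonneg_nonneg)
  show ?thesis
  proof (cases "\<bar>t\<bar> \<le> 1/2")
    case True
    then have t: "0 < 1 + t" by linarith
    have "\<bar>1 + t\<bar> powr p = exp (p * ln (1 + t))" using t by (simp add: powr_def)
    also have "\<dots> \<le> exp (p * t)" using p t by (simp add: ln_add_one_self_le_self2 True)
    also have "\<dots> \<le> 1 + p * t + exp (p / 2) * p\<^sup>2 * t\<^sup>2"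
    proof -
      obtain r where r: "\<bar>r\<bar> \<le> \<bar>p * t\<bar>"
        "exp (p * t) = (\<Sum>m<2. (p * t) ^ m / fact m) + exp r / fact 2 * (p * t) ^ 2"
        using Maclaurin_exp_le[of "p * t" 2] by blast
      have "\<bar>p * t\<bar> \<le> p / 2" using True p by (simp add: abs_mult)
      then have "r \<le> p / 2" using r(1) by linarith
      then have "exp r / 2 \<le> exp (p / 2)" by (smt (verit) exp_le_cancel_iff exp_gt_zero field_sum_of_halves)
      then have "exp r / 2 * (p * t)\<^sup>2 \<le> exp (p / 2) * (p * t)\<^sup>2" by (intro mult_right_mono) auto
      then show ?thesis using r(2) by (simp add: eval_nat_numeral algebra_simps)
    qed
    also have "\<dots> \<le> 1 + p * t + C * t\<^sup>2" using C(3) by (simp add: mult_right_mono)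
    also have "\<dots> \<le> 1 + p * t + C * (t\<^sup>2 + \<bar>t\<bar> powr p)" using C(4) by (simp add: mult_left_mono)
    finally show ?thesis .
  next
    case False
    then have "\<bar>1 + t\<bar> powr p \<le> (3 * \<bar>t\<bar>) powr p" using p by (intro powr_mono2) auto
    also have "\<dots> \<le> C * \<bar>t\<bar> powr p" using C by (simp add: powr_mult mult_right_mono)
    finally have "\<bar>1 + t\<bar> powr p \<le> C * \<bar>t\<bar> powr p" .
    moreover have "0 \<le> 1 + p * t + C * t\<^sup>2"
    proof -
      have "\<bar>t\<bar> \<le> 2 * \<bar>t\<bar> * \<bar>t\<bar>" using False mult_right_mono[of 1 "2 * \<bar>t\<bar>" "\<bar>t\<bar>"] by simp
      then have "p * \<bar>t\<bar> \<le> 2 * p * t\<^sup>2" using p mult_left_mono[of "\<bar>t\<bar>" "2 * \<bar>t\<bar> * \<bar>t\<bar>" p]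
        by (simp add: power2_eq_square mult.assoc abs_mult_self_eq)
      also have "\<dots> \<le> C * t\<^sup>2" using C by (intro mult_right_mono) auto
      finally have "p * \<bar>t\<bar> \<le> C * t\<^sup>2" .
      moreover have "- (p * \<bar>t\<bar>) \<le> p * t" using p by (smt (verit) mult_minus_right mult_left_mono)
      ultimately show ?thesis by linarith
    qed
    ultimately show ?thesis by (simp add: algebra_simps)
  qed
qed

text \<open>Homogeneity: for nonzero s put y = s t in the expansion around 1 and multiply by
  |s|^p.\<close>

lemma ex_power_expansion_const:
  assumes p: "2 \<le> p"
  shows "\<exists>C. power_expansion_const p C"
proof -
  define C where "C = 3 powr p + 2 * p + exp (p / 2) * p\<^sup>2"
  have C: "1 \<le> C" using p unfolding C_def by (intro add_increasing2 add_increasing) auto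
  have "\<bar>s + y\<bar> powr p \<le> \<bar>s\<bar> powr p + p * \<bar>s\<bar> powr (p - 1) * sgn s * y + C * (\<bar>s\<bar> powr (p - 2) * y\<^sup>2 + \<bar>y\<bar> powr p)" for s y
  proof (cases "s = 0")
    case True
    have "\<bar>y\<bar> powr p \<le> C * \<bar>y\<bar> powr p" using C mult_right_mono[of 1 C "\<bar>y\<bar> powr p"] by simp
    then show ?thesis using True by simp
  next
    case False
    define t where "t = y / s"
    have y: "y = s * t" using False by (simp add: t_def)
    have "\<bar>s + y\<bar> powr p = \<bar>s\<bar> powr p * \<bar>1 + t\<bar> powr p"
      by (simp add: y powr_mult[symmetric] abs_mult[symmetric] algebra_simps)
    also have "\<dots> \<le> \<bar>s\<bar> powr p * (1 + p * t + C * (t\<^sup>2 + \<bar>t\<bar> powr p))"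
      unfolding C_def using p by (intro mult_left_mono powr_one_plus_le) auto
    also have "\<dots> = \<bar>s\<bar> powr p + p * (\<bar>s\<bar> powr p * t) + C * (\<bar>s\<bar> powr p * t\<^sup>2 + \<bar>s\<bar> powr p * \<bar>t\<bar> powr p)"
      by (simp add: algebra_simps)
    also have "\<bar>s\<bar> powr p * t = \<bar>s\<bar> powr (p - 1) * sgn s * y"
    proof -
      have "\<bar>s\<bar> powr p = \<bar>s\<bar> powr (p - 1) * \<bar>s\<bar>" using False powr_add[of "\<bar>s\<bar>" "p - 1" 1] by simp
      then show ?thesis by (simp add: y) (simp add: abs_sgn)
    qed
    also have "\<bar>s\<bar> powr p * t\<^sup>2 = \<bar>s\<bar> powr (p - 2) * y\<^sup>2"
    proof -
      have "\<bar>s\<bar> powr p = \<bar>s\<bar> powr (p - 2) * \<bar>s\<bar>\<^sup>2" using False powr_add[of "\<bar>s\<bar>" "p - 2" 2] by simp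
      then show ?thesis by (simp add: y power_mult_distrib)
    qed
    also have "\<bar>s\<bar> powr p * \<bar>t\<bar> powr p = \<bar>y\<bar> powr p"
      by (simp add: y abs_mult powr_mult)
    finally show ?thesis by (simp add: mult.assoc)
  qed
  then show ?thesis using C by (auto simp: power_expansion_const_def)
qed

lemma powr_add_ge:
  fixes x y q :: real
  assumes "0 \<le> x" "0 \<le> y" "1 \<le> q"
  shows "x powr q + y powr q \<le> (x + y) powr q" "x powr q + x powr (q - 1) * y \<le> (x + y) powr q"
proof -
  have split: "z powr q = z * z powr (q - 1)" if "0 \<le> z" for z :: real
    using that assms(3) powr_add[of z 1 "q - 1"] by simp
  have 1: "x powr (q - 1) \<le> (x + y) powr (q - 1)" "y powr (q - 1) \<le> (x + y) powr (q - 1)"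
    using assms by (auto intro!: powr_mono2)
  have "(x + y) powr q = x * (x + y) powr (q - 1) + y * (x + y) powr (q - 1)"
    using assms by (simp add: split distrib_right)
  moreover have "x powr q \<le> x * (x + y) powr (q - 1)" "y powr q \<le> y * (x + y) powr (q - 1)"
      "x powr (q - 1) * y \<le> y * (x + y) powr (q - 1)"
    using assms 1 by (auto simp: split mult_left_mono mult.commute)
  ultimately show "x powr q + y powr q \<le> (x + y) powr q" "x powr q + x powr (q - 1) * y \<le> (x + y) powr q"
    by linarith+
qed

text \<open>Brings the expansion into a form in which an induction closes, namely a power p/2 of a
  sum of squares. One copy of C B^2 absorbs the mixed term, by x^q + x^(q-1) y <= (x + y)^q with q =
  p/2; the other absorbs the B^p term, by superadditivity of the same power. Hence the factor
  2.\<close>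

lemma powr_square_sum_ge:
  fixes s B C p :: real
  assumes p: "2 \<le> p" and C: "1 \<le> C" and B: "0 \<le> B"
  shows "\<bar>s\<bar> powr p + C * (\<bar>s\<bar> powr (p - 2) * B\<^sup>2 + B powr p) \<le> (s\<^sup>2 + 2 * C * B\<^sup>2) powr (p / 2)"
proof -
  have sq: "(z\<^sup>2) powr r = \<bar>z\<bar> powr (2 * r)" for z r :: real
  proof -
    have "(z\<^sup>2) powr r = (\<bar>z\<bar> powr 2) powr r" by simp
    then show ?thesis by (simp only: powr_powr)
  qed
  have "\<bar>s\<bar> powr p + C * \<bar>s\<bar> powr (p - 2) * B\<^sup>2 + C * B powr p \<le> (s\<^sup>2) powr (p/2) + (s\<^sup>2) powr (p/2 - 1) * (C * B\<^sup>2) + (C * B\<^sup>2) powr (p/2)"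
  proof -
    have "C * B powr p \<le> C powr (p/2) * B powr p" 
      using C p powr_mono[of 1 "p/2" C] by (intro mult_right_mono) auto
    moreover have "(C * B\<^sup>2) powr (p/2) = C powr (p/2) * B powr p" using C B by (simp add: powr_mult sq)
    moreover have "(s\<^sup>2) powr (p/2 - 1) = \<bar>s\<bar> powr (p - 2)" by (subst sq) (simp add: algebra_simps)
    ultimately show ?thesis by (simp add: sq)
  qed
  also have "\<dots> \<le> (s\<^sup>2 + C * B\<^sup>2) powr (p/2) + (C * B\<^sup>2) powr (p/2)"
    using p C by (intro add_right_mono powr_add_ge(2)) auto
  also have "\<dots> \<le> (s\<^sup>2 + C * B\<^sup>2 + C * B\<^sup>2) powr (p/2)"
    using p C by (intro powr_add_ge(1)) auto
  finally show ?thesis by (simp add: algebra_simps)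
qed

lemma centered_translate_moment:
  fixes m :: "real measure"
  assumes p: "2 \<le> p" and C: "power_expansion_const p C"
    and m: "prob_space m" "sets m = sets borel" "integrable m (\<lambda>x. x)" "(\<integral>x. x \<partial>m) = 0"
    and y: "mom_le m p (\<lambda>x. x) b"
  shows "(\<integral>\<^sup>+x. ennreal (\<bar>s + c * x\<bar> powr p) \<partial>m) \<le> ennreal ((s\<^sup>2 + 2 * C * (c\<^sup>2 * b\<^sup>2)) powr (p / 2))"
proof -
  interpret prob_space m by fact
  have b: "0 \<le> b" using mom_leD(2)[OF y] .
  have C1: "1 \<le> C" using C by (simp add: power_expansion_const_def)
  have y2: "mom_le m 2 (\<lambda>x. x) b" using p by (intro mom_le_Lyapunov[OF y]) auto
  have i2: "integrable m (\<lambda>x. x\<^sup>2)" and e2: "(\<integral>x. x\<^sup>2 \<partial>m) \<le> b\<^sup>2"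
    using mom_le_integrable[OF y2] mom_le_integral[OF y2] b by (simp_all add: powr_numeral)
  have ip: "integrable m (\<lambda>x. \<bar>x\<bar> powr p)" and ep: "(\<integral>x. \<bar>x\<bar> powr p \<partial>m) \<le> b powr p"
    using mom_le_integrable[OF y] mom_le_integral[OF y] by simp_all
  have sm: "mom_le m p (\<lambda>x. s + c * x) (\<bar>s\<bar> + \<bar>c\<bar> * b)"
    by (intro mom_le_add mom_le_scale y) (use p in \<open>auto simp: mom_le_def emeasure_space_1\<close>)
  have "(\<integral>x. \<bar>s + c * x\<bar> powr p \<partial>m) \<le> (\<integral>x. \<bar>s\<bar> powr p + p * \<bar>s\<bar> powr (p - 1) * sgn s * c * x + (C * \<bar>s\<bar> powr (p - 2) * c\<^sup>2 * x\<^sup>2 + C * \<bar>c\<bar> powr p * \<bar>x\<bar> powr p) \<partial>m)"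
  proof (intro integral_mono mom_le_integrable[OF sm] Bochner_Integration.integrable_add integrable_mult_right i2 ip m(3))
    fix x
    have "\<bar>s + c * x\<bar> powr p \<le> \<bar>s\<bar> powr p + p * \<bar>s\<bar> powr (p - 1) * sgn s * (c * x) + C * (\<bar>s\<bar> powr (p - 2) * (c * x)\<^sup>2 + \<bar>c * x\<bar> powr p)"
      using C unfolding power_expansion_const_def by blast
    then show "\<bar>s + c * x\<bar> powr p \<le> \<bar>s\<bar> powr p + p * \<bar>s\<bar> powr (p - 1) * sgn s * c * x + (C * \<bar>s\<bar> powr (p - 2) * c\<^sup>2 * x\<^sup>2 + C * \<bar>c\<bar> powr p * \<bar>x\<bar> powr p)"
      by (simp add: abs_mult powr_mult power_mult_distrib algebra_simps)
  qed simp
  also have "\<dots> = \<bar>s\<bar> powr p + C * (\<bar>s\<bar> powr (p - 2) * c\<^sup>2 * (\<integral>x. x\<^sup>2 \<partial>m) + \<bar>c\<bar> powr p * (\<integral>x. \<bar>x\<bar> powr p \<partial>m))"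
    using m(3,4) i2 ip by (simp add: prob_space algebra_simps)
  also have "\<dots> \<le> \<bar>s\<bar> powr p + C * (\<bar>s\<bar> powr (p - 2) * c\<^sup>2 * b\<^sup>2 + \<bar>c\<bar> powr p * b powr p)"
    using e2 ep C1 by (intro add_left_mono mult_left_mono add_mono) auto
  also have "\<dots> = \<bar>s\<bar> powr p + C * (\<bar>s\<bar> powr (p - 2) * (\<bar>c\<bar> * b)\<^sup>2 + (\<bar>c\<bar> * b) powr p)"
    using b by (simp add: powr_mult power_mult_distrib)
  also have "\<dots> \<le> (s\<^sup>2 + 2 * C * (\<bar>c\<bar> * b)\<^sup>2) powr (p / 2)"
    using b by (intro powr_square_sum_ge p C1) auto
  finally have "(\<integral>x. \<bar>s + c * x\<bar> powr p \<partial>m) \<le> (s\<^sup>2 + 2 * C * (c\<^sup>2 * b\<^sup>2)) powr (p / 2)"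
    by (simp add: power_mult_distrib)
  then show ?thesis
    using mom_le_integrable[OF sm] by (subst nn_integral_eq_integral) (auto intro: ennreal_leI)
qed

text \<open>Induction on the number of summands, integrating the last coordinate with the others
  fixed. This leaves the power p/2 of T^2 + B, and Minkowski's inequality in L^(p/2), valid since p
  >= 2, adds the squares of the bounds. So the squared coefficients accumulate linearly under the
  root.\<close>

lemma Marcinkiewicz_Zygmund:
  fixes m :: "real measure" and n :: nat
  assumes p: "2 \<le> p" and C: "power_expansion_const p C"
    and m: "prob_space m" "sets m = sets borel" "integrable m (\<lambda>x. x)" "(\<integral>x. x \<partial>m) = 0"
    and y: "mom_le m p (\<lambda>x. x) b"
  shows "mom_le (PiM {..<n} (\<lambda>_. m)) p (\<lambda>\<omega>. \<Sum>i<n. c i * \<omega> i) (sqrt (2 * C * (\<Sum>i<n. (c i)\<^sup>2)) * b)"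
proof -
  interpret m: prob_space m by fact
  interpret product_prob_space "\<lambda>_::nat. m" by standard
  note [measurable_cong] = m(2)
  have C1: "1 \<le> C" using C by (simp add: power_expansion_const_def)
  have b: "0 \<le> b" using mom_leD(2)[OF y] .
  show ?thesis
  proof (induction n)
    case 0
    then show ?case using b by (auto simp: mom_le_def)
  next
    case (Suc n)
    interpret PP: prob_space "PiM {..<n} (\<lambda>_. m)" by (intro prob_space_PiM m)
    define A where "A = sqrt (2 * C * (\<Sum>i<n. (c i)\<^sup>2)) * b"
    define B where "B = 2 * C * ((c n)\<^sup>2 * b\<^sup>2)"
    define T where "T \<omega> = (\<Sum>i<n. c i * \<omega> i)" for \<omega> :: "nat \<Rightarrow> real"
    have A0: "0 \<le> A" and B0: "0 \<le> B" using b C1 by (auto simp: A_def B_def sum_nonneg)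
    have IH: "mom_le (PiM {..<n} (\<lambda>_. m)) p T A"
      using Suc by (simp add: A_def T_def[abs_def])
    have [measurable]: "T \<in> borel_measurable (PiM {..<n} (\<lambda>_. m))" using mom_leD(1)[OF IH] .
    have T2: "mom_le (PiM {..<n} (\<lambda>_. m)) (p/2) (\<lambda>\<omega>. (T \<omega>)\<^sup>2) (A\<^sup>2)"
    proof -
      have sq: "\<bar>z\<^sup>2\<bar> powr (p/2) = \<bar>z\<bar> powr p" for z :: real
      proof -
        have "\<bar>z\<^sup>2\<bar> powr (p/2) = (\<bar>z\<bar> powr 2) powr (p/2)" by simp
        then show ?thesis by (simp only: powr_powr) simp
      qed
      have "(A\<^sup>2) powr (p/2) = A powr p" using sq[of A] A0 by simp
      then show ?thesis using IH unfolding mom_le_def sq by auto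
    qed
    have TB: "mom_le (PiM {..<n} (\<lambda>_. m)) (p/2) (\<lambda>\<omega>. (T \<omega>)\<^sup>2 + B) (A\<^sup>2 + B)"
      by (intro mom_le_add T2) (use p B0 in \<open>auto simp: mom_le_def PP.emeasure_space_1\<close>)
    have ins: "{..<Suc n} = insert n {..<n}" by auto
    have [measurable]: "(\<lambda>\<omega>. \<Sum>i<Suc n. c i * \<omega> i) \<in> borel_measurable (PiM {..<Suc n} (\<lambda>_. m))"
      by (intro borel_measurable_sum borel_measurable_times borel_measurable_const
           measurable_component_singleton[of _ _ "\<lambda>_. m", unfolded measurable_cong_sets[OF refl m(2)]]) auto
    define G where "G \<omega> = ennreal (\<bar>\<Sum>i<Suc n. c i * \<omega> i\<bar> powr p)" for \<omega>
    have "integral\<^sup>N (PiM (insert n {..<n}) (\<lambda>_. m)) G = (\<integral>\<^sup>+\<omega>. (\<integral>\<^sup>+x. G (fun_upd \<omega> n x) \<partial>m) \<partial>PiM {..<n} (\<lambda>_. m))"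
    proof (rule product_nn_integral_insert)
      show "G \<in> borel_measurable (PiM (insert n {..<n}) (\<lambda>_. m))"
        unfolding ins[symmetric] G_def by measurable
    qed auto
    then have "(\<integral>\<^sup>+\<omega>. ennreal (\<bar>\<Sum>i<Suc n. c i * \<omega> i\<bar> powr p) \<partial>PiM {..<Suc n} (\<lambda>_. m))
        = (\<integral>\<^sup>+\<omega>. (\<integral>\<^sup>+x. G (fun_upd \<omega> n x) \<partial>m) \<partial>PiM {..<n} (\<lambda>_. m))"
      unfolding ins[symmetric] by (simp only: G_def[abs_def])
    also have "\<dots> = (\<integral>\<^sup>+\<omega>. (\<integral>\<^sup>+x. ennreal (\<bar>T \<omega> + c n * x\<bar> powr p) \<partial>m) \<partial>PiM {..<n} (\<lambda>_. m))"
      by (simp add: T_def G_def)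
    also have "\<dots> \<le> (\<integral>\<^sup>+\<omega>. ennreal (\<bar>(T \<omega>)\<^sup>2 + B\<bar> powr (p/2)) \<partial>PiM {..<n} (\<lambda>_. m))"
      using centered_translate_moment[OF p C m y] B0 by (intro nn_integral_mono) (simp add: B_def)
    also have "\<dots> \<le> ennreal ((A\<^sup>2 + B) powr (p/2))" by (rule mom_leD(3)[OF TB])
    also have "A\<^sup>2 + B = (sqrt (2 * C * (\<Sum>i<Suc n. (c i)\<^sup>2)) * b)\<^sup>2"
      using C1 by (simp add: A_def B_def power_mult_distrib sum_nonneg algebra_simps)
    also have "\<dots> powr (p/2) = (sqrt (2 * C * (\<Sum>i<Suc n. (c i)\<^sup>2)) * b) powr p"
    proof -
      have "(z\<^sup>2) powr (p/2) = z powr p" if "0 \<le> z" for z :: real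
      proof -
        have "(z\<^sup>2) powr (p/2) = (z powr 2) powr (p/2)" using that by simp
        then show ?thesis by (simp only: powr_powr) simp
      qed
      then show ?thesis using b C1 by (auto simp: sum_nonneg simp del: sum.lessThan_Suc)
    qed
    finally show ?case using b C1 by (auto simp: mom_le_def sum_nonneg simp del: sum.lessThan_Suc)
  qed
qed

definition KR_bound :: "real \<Rightarrow> real \<Rightarrow> bool" where
  "KR_bound p K \<longleftrightarrow> (\<forall>(n::nat) (c::nat \<Rightarrow> real) (m::real measure).
      prob_space m \<and> sets m = sets borel \<and> integrable m (\<lambda>x. x) \<and> (\<integral>x. x \<partial>m) = 0 \<and>
      integrable m (\<lambda>x. \<bar>x\<bar> powr p) \<longrightarrow>
      lpn (PiM {..<n} (\<lambda>_. m)) (\<lambda>\<omega>. \<Sum>i<n. c i * \<omega> i) p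
        \<le> K * sqrt (\<Sum>i<n. (c i)^2) * lpn m (\<lambda>x. x) p)"

lemma KR_eq: "KR p = Inf {K. KR_bound p K}"
  by (simp add: KR_def KR_bound_def)

lemma ex_KR_bound:
  assumes p: "2 \<le> p"
  shows "\<exists>K. KR_bound p K"
proof -
  obtain C where C: "power_expansion_const p C" using ex_power_expansion_const[OF p] by blast
  have "KR_bound p (sqrt (2 * C))"
    unfolding KR_bound_def
  proof (intro allI impI, elim conjE)
    fix n :: nat and c :: "nat \<Rightarrow> real" and m :: "real measure"
    assume m: "prob_space m" "sets m = sets borel" "integrable m (\<lambda>x. x)" "(\<integral>x. x \<partial>m) = 0"
      and i: "integrable m (\<lambda>x. \<bar>x\<bar> powr p)"
    have "mom_le m p (\<lambda>x. x) (lpn m (\<lambda>x. x) p)"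
      using p i m(3) by (subst mom_le_iff_lpn) auto
    from mom_le_lpn[OF Marcinkiewicz_Zygmund[OF p C m this]]
    show "lpn (PiM {..<n} (\<lambda>_. m)) (\<lambda>\<omega>. \<Sum>i<n. c i * \<omega> i) p \<le> sqrt (2 * C) * sqrt (\<Sum>i<n. (c i)^2) * lpn m (\<lambda>x. x) p"
      using p by (simp add: real_sqrt_mult mult.assoc)
  qed
  then show ?thesis by blast
qed

text \<open>One summand with the symmetric law on -1 and 1 makes the left side 1 and the right side
  \<open>K\<close>. The bound keeps the infimum in \<open>KR\<close> away from degenerate values and
  contributes to \<open>tau\<close> being at least 1.\<close>

lemma KR_bound_ge_1:
  assumes K: "KR_bound p K" and p: "0 < p"
  shows "1 \<le> K"
proof -
  define r where "r = pmf_of_set {-1, 1 :: real}"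
  define m where "m = distr (measure_pmf r) borel (\<lambda>x. x)"
  have m: "prob_space m" "sets m = sets borel" unfolding m_def
    by (auto intro!: prob_space.prob_space_distr prob_space_measure_pmf)
  interpret prob_space m by (fact m)
  have set: "set_pmf r = {-1, 1}" by (simp add: r_def)
  have int: "integrable m f" if "f \<in> borel_measurable borel" for f :: "real \<Rightarrow> real"
    unfolding m_def using that set
    by (subst integrable_distr_eq) (auto intro!: integrable_measure_pmf_finite)
  have val: "(\<integral>x. f x \<partial>m) = (f (-1) + f 1) / 2" if "f \<in> borel_measurable borel" for f :: "real \<Rightarrow> real"
    unfolding m_def using that by (subst integral_distr) (auto simp: r_def integral_pmf_of_set)
  have l: "lpn m (\<lambda>x. x) p = 1" by (simp add: lpn_def val)
  have "(\<integral>x. \<bar>x\<bar> powr p \<partial>m) = (\<integral>x. \<bar>x\<bar> powr p \<partial>distr (PiM {..<1::nat} (\<lambda>_. m)) m (\<lambda>\<omega>. \<omega> 0))"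
    using m by (subst distr_PiM_component) auto
  also have "\<dots> = (\<integral>\<omega>. \<bar>\<omega> 0\<bar> powr p \<partial>PiM {..<1::nat} (\<lambda>_. m))"
  proof (rule integral_distr)
    show "(\<lambda>x. \<bar>x\<bar> powr p) \<in> borel_measurable m"
      unfolding measurable_cong_sets[OF m(2) refl] by measurable
  qed (auto intro: measurable_component_singleton)
  finally have "(\<integral>x. \<bar>x\<bar> powr p \<partial>m) = (\<integral>\<omega>. \<bar>\<omega> 0\<bar> powr p \<partial>PiM {..<1::nat} (\<lambda>_. m))" .
  then have "lpn (PiM {..<1::nat} (\<lambda>_. m)) (\<lambda>\<omega>. \<Sum>i<1. 1 * \<omega> i) p = lpn m (\<lambda>x. x) p"
    by (simp add: lpn_def)
  moreover have "integrable m (\<lambda>x. x)" "(\<integral>x. x \<partial>m) = 0" "integrable m (\<lambda>x. \<bar>x\<bar> powr p)"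
    by (auto intro!: int simp: val)
  then have "lpn (PiM {..<1::nat} (\<lambda>_. m)) (\<lambda>\<omega>. \<Sum>i<1. 1 * \<omega> i) p \<le> K * sqrt (\<Sum>i<1::nat. 1\<^sup>2) * lpn m (\<lambda>x. x) p"
    using m K[unfolded KR_bound_def, THEN spec[of _ "1::nat"], THEN spec[of _ "\<lambda>_. 1"], THEN spec[of _ m]] by blast
  ultimately show ?thesis by (simp only: l) simp
qed

text \<open>Every instance of the inequality has the form L <= K D with D >= 0, a closed condition
  on K, so the infimum satisfies it. If D = 0, any admissible constant already shows L <= 0.\<close>

lemma KR_attained:
  assumes p: "2 \<le> p"
  shows "KR_bound p (KR p)" "1 \<le> KR p"
proof -
  have ne: "{K. KR_bound p K} \<noteq> {}" using ex_KR_bound[OF p] by blast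
  show "1 \<le> KR p" unfolding KR_eq using p KR_bound_ge_1 ne by (intro cInf_greatest) auto
  show "KR_bound p (KR p)"
    unfolding KR_bound_def
  proof (intro allI impI)
    fix n :: nat and c :: "nat \<Rightarrow> real" and m :: "real measure"
    assume m: "prob_space m \<and> sets m = sets borel \<and> integrable m (\<lambda>x. x) \<and> (\<integral>x. x \<partial>m) = 0 \<and> integrable m (\<lambda>x. \<bar>x\<bar> powr p)"
    define D where "D = sqrt (\<Sum>i<n. (c i)^2) * lpn m (\<lambda>x. x) p"
    define L where "L = lpn (PiM {..<n} (\<lambda>_. m)) (\<lambda>\<omega>. \<Sum>i<n. c i * \<omega> i) p"
    have D: "0 \<le> D" by (simp add: D_def sum_nonneg lpn_nonneg)
    have L: "L \<le> K * D" if "KR_bound p K" for K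
      using that m unfolding KR_bound_def L_def D_def mult.assoc by blast
    have "L \<le> KR p * D"
    proof (cases "D = 0")
      case True then show ?thesis using ex_KR_bound[OF p] L by auto
    next
      case False
      then have "L / D \<le> KR p" unfolding KR_eq using D L ne
        by (intro cInf_greatest) (auto simp: divide_le_eq)
      then show ?thesis using False D by (simp add: divide_le_eq)
    qed
    then show "lpn (PiM {..<n} (\<lambda>_. m)) (\<lambda>\<omega>. \<Sum>i<n. c i * \<omega> i) p \<le> KR p * sqrt (\<Sum>i<n. (c i)^2) * lpn m (\<lambda>x. x) p"
      by (simp add: L_def D_def mult.assoc)
  qed
qed

text \<open>Two ingredients: \<open>Marcinkiewicz_Zygmund\<close> supplies integrability of the p-th
  power of the sum, and with it the \<open>lpn\<close> inequality for \<open>KR p\<close> becomes a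
  genuine moment bound with the optimal constant.\<close>

lemma mom_le_iid_sum:
  fixes m :: "real measure" and n :: nat
  assumes p: "2 \<le> p"
    and m: "prob_space m" "sets m = sets borel" "integrable m (\<lambda>x. x)" "(\<integral>x. x \<partial>m) = 0"
    and y: "mom_le m p (\<lambda>x. x) b"
  shows "mom_le (PiM {..<n} (\<lambda>_. m)) p (\<lambda>\<omega>. \<Sum>i<n. c i * \<omega> i) (KR p * sqrt (\<Sum>i<n. (c i)\<^sup>2) * b)"
proof -
  obtain C where C: "power_expansion_const p C" using ex_power_expansion_const[OF p] by blast
  note * = Marcinkiewicz_Zygmund[OF p C m y, of n c]
  have "lpn (PiM {..<n} (\<lambda>_. m)) (\<lambda>\<omega>. \<Sum>i<n. c i * \<omega> i) p \<le> KR p * sqrt (\<Sum>i<n. (c i)^2) * lpn m (\<lambda>x. x) p"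
    using KR_attained(1)[OF p] m mom_le_integrable[OF y] unfolding KR_bound_def by blast
  also have "\<dots> \<le> KR p * sqrt (\<Sum>i<n. (c i)^2) * b"
    using mom_le_lpn[OF y] KR_attained(2)[OF p] p by (intro mult_left_mono) (auto simp: sum_nonneg)
  finally show ?thesis
    using mom_leD(1)[OF *] mom_le_integrable[OF *] p by (subst mom_le_iff_lpn) auto
qed

section \<open>Chaining\<close>

lemma mom_le_weaken: "mom_le M p X c \<Longrightarrow> c \<le> c' \<Longrightarrow> 0 \<le> p \<Longrightarrow> mom_le M p X c'"
  using mom_le_mono[of M p X c X c'] mom_leD(1) by blast

lemma abs_SUP_diff_le:
  fixes a b :: "'v \<Rightarrow> real"
  assumes V: "V \<noteq> {}" and le: "\<And>v. v \<in> V \<Longrightarrow> \<bar>a v - b v\<bar> \<le> r"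
    and a: "bdd_above (a ` V)" and b: "bdd_above (b ` V)"
  shows "\<bar>(SUP v\<in>V. a v) - (SUP v\<in>V. b v)\<bar> \<le> r"
proof -
  have "(SUP v\<in>V. a v) \<le> (SUP v\<in>V. b v) + r"
  proof (intro cSUP_least V)
    fix v assume v: "v \<in> V"
    have "a v \<le> b v + r" using le[OF v] by linarith
    also have "b v \<le> (SUP v\<in>V. b v)" using v b by (intro cSUP_upper)
    finally show "a v \<le> (SUP v\<in>V. b v) + r" by simp
  qed
  moreover have "(SUP v\<in>V. b v) \<le> (SUP v\<in>V. a v) + r"
  proof (intro cSUP_least V)
    fix v assume v: "v \<in> V"
    have "b v \<le> a v + r" using le[OF v] by linarith
    also have "a v \<le> (SUP v\<in>V. a v)" using v a by (intro cSUP_upper)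
    finally show "b v \<le> (SUP v\<in>V. a v) + r" by simp
  qed
  ultimately show ?thesis by linarith
qed

lemma bounded_cont_funD:
  assumes "bounded_cont_fun V r F" "h \<in> CV V r" "0 < e"
  obtains \<delta> where "0 < \<delta>" "\<And>h'. h' \<in> CV V r \<Longrightarrow> (SUP v\<in>V. \<bar>h' v - h v\<bar>) < \<delta> \<Longrightarrow> \<bar>F h' - F h\<bar> < e"
  using assms unfolding bounded_cont_fun_def by blast

text \<open>The data of a chaining argument without their probabilistic origin. \<open>T\<close> is
  the set of exponents, \<open>S n\<close> a net of radius 2^-n, and \<open>E n\<close> the price of
  the links from \<open>S (Suc n)\<close> to \<open>S n\<close>, with an exponent chosen separately
  for each \<open>n\<close>. Such a link has length at most 2^-n, so \<open>E_summable\<close> is a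
  discrete entropy integral.\<close>

locale entropy_net =
  fixes V :: "'v set" and K :: "'k set" and lam :: "'v \<Rightarrow> 'k \<Rightarrow> real" and rho :: "'v \<Rightarrow> 'v \<Rightarrow> real"
    and sig :: real and T :: "real set" and tau :: "real \<Rightarrow> real" and S :: "nat \<Rightarrow> 'v set" and E :: "nat \<Rightarrow> real"
  assumes V_ne: "V \<noteq> {}"
    and K_countable: "countable K"
    and lam_sum: "\<lbrakk>v \<in> V; finite B; B \<subseteq> K\<rbrakk> \<Longrightarrow> (\<Sum>k\<in>B. \<bar>lam v k\<bar>) \<le> sig"
    and lam_diff: "\<lbrakk>u \<in> V; v \<in> V; finite B; B \<subseteq> K\<rbrakk> \<Longrightarrow> (\<Sum>k\<in>B. \<bar>lam u k - lam v k\<bar>) \<le> rho u v"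
    and T2: "2 \<in> T" and T_ge: "p \<in> T \<Longrightarrow> 2 \<le> p"
    and tau_ge: "p \<in> T \<Longrightarrow> 1 \<le> tau p"
    and S_fin: "finite (S n)" and S_sub: "S n \<subseteq> V"
    and S_cover: "v \<in> V \<Longrightarrow> \<exists>u\<in>S n. rho v u \<le> (1/2) ^ n"
    and E_bound: "\<exists>q\<in>T. real (card (S (Suc n))) powr (1 / q) * tau q \<le> E n"
    and E_summable: "summable (\<lambda>n. E n * (1/2) ^ n)"
    and tails: "0 < e \<Longrightarrow> \<exists>A. finite A \<and> A \<subseteq> K \<and> (\<forall>v\<in>V. \<forall>B. finite B \<longrightarrow> B \<subseteq> K - A \<longrightarrow> (\<Sum>k\<in>B. \<bar>lam v k\<bar>) \<le> e)"
begin

lemma S_ne: "S n \<noteq> {}" using V_ne S_cover by blast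

lemma card_S_ge: "1 \<le> real (card (S n))"
  using S_fin[of n] S_ne[of n] by (simp add: Suc_le_eq card_gt_0_iff)

lemma sig_nonneg: "0 \<le> sig" using V_ne lam_sum[of _ "{}"] by auto

lemma lam_le: "v \<in> V \<Longrightarrow> k \<in> K \<Longrightarrow> \<bar>lam v k\<bar> \<le> sig" using lam_sum[of v "{k}"] by simp

lemma E_nonneg: "0 \<le> E n"
proof -
  obtain q where "q \<in> T" "real (card (S (Suc n))) powr (1 / q) * tau q \<le> E n" using E_bound by blast
  moreover from this have "0 \<le> tau q" using tau_ge by force
  ultimately show ?thesis by (meson order_trans mult_nonneg_nonneg powr_ge_zero)
qed

text \<open>The chaining bound, up to the factor \<open>tau p\<close>, for a finite sum whose
  coefficients have absolute sum at most \<open>t\<close> at every point of \<open>V\<close>. A link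
  at scale \<open>n\<close> is bounded by 2^-n through the net and by 2 t through the triangle
  inequality; taking the minimum makes the whole expression vanish with \<open>t\<close>.\<close>

definition Phi :: "real \<Rightarrow> real" where
  "Phi t = real (card (S 0)) * t + (\<Sum>n. E n * min ((1/2) ^ n) (2 * t))"

lemma Phi_summable: "0 \<le> t \<Longrightarrow> summable (\<lambda>n. E n * min ((1/2) ^ n) (2 * t))"
  by (rule summable_comparison_test'[OF E_summable]) (auto simp: E_nonneg abs_mult intro!: mult_left_mono)

lemma Phi_partial:
  assumes "0 \<le> t"
  shows "real (card (S 0)) * t + (\<Sum>n<m. E n * min ((1/2) ^ n) (2 * t)) \<le> Phi t"
  unfolding Phi_def using assms
  by (intro add_left_mono sum_le_suminf Phi_summable) (auto simp: E_nonneg)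

text \<open>Dominated convergence for series (Tannery): each term tends to 0 with \<open>t\<close>,
  and E n 2^-n is a summable majorant.\<close>

lemma Phi_small:
  assumes e: "0 < e"
  shows "\<exists>t>0. Phi t \<le> e"
proof -
  have "((\<lambda>t. real (card (S 0)) * t + (\<Sum>n. E n * min ((1/2) ^ n) (2 * t))) \<longlongrightarrow> real (card (S 0)) * 0 + (\<Sum>n. E n * min ((1/2) ^ n) (2 * 0))) (at_right 0)"
  proof (intro tendsto_add tendsto_mult tendsto_const)
    show "((\<lambda>t. \<Sum>n. E n * min ((1/2) ^ n) (2 * t)) \<longlongrightarrow> (\<Sum>n. E n * min ((1/2) ^ n) (2 * 0))) (at_right 0)"
    proof (rule tannerys_theorem[THEN conjunct2, THEN conjunct2])
      show "((\<lambda>t. E n * min ((1/2) ^ n) (2 * t)) \<longlongrightarrow> E n * min ((1/2) ^ n) (2 * 0)) (at_right 0)" for n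
        by (intro tendsto_intros)
      have "eventually (\<lambda>t::real. 0 < t) (at_right 0)" by (simp add: eventually_at_right_less)
      then have "eventually (\<lambda>(k::nat, t::real). 0 < t) (at_top \<times>\<^sub>F at_right 0)"
        unfolding eventually_prod_filter
        by (intro exI[of _ "\<lambda>_. True"] exI[of _ "\<lambda>t. 0 < t"]) auto
      then show "eventually (\<lambda>(k, t). norm (E k * min ((1/2) ^ k) (2 * t)) \<le> E k * (1/2) ^ k) (at_top \<times>\<^sub>F at_right (0::real))"
        by (rule eventually_mono) (auto simp: E_nonneg abs_mult intro!: mult_left_mono)
    qed (auto simp: E_summable)
  qed (simp add: tendsto_ident_at)
  then have "(Phi \<longlongrightarrow> 0) (at_right 0)" by (simp add: Phi_def[abs_def])
  then have "eventually (\<lambda>t. Phi t < e) (at_right 0)" using e by (rule order_tendstoD)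
  moreover have "eventually (\<lambda>t::real. 0 < t) (at_right 0)" by (simp add: eventually_at_right_less)
  ultimately have "eventually (\<lambda>t. 0 < t \<and> Phi t \<le> e) (at_right 0)" by eventually_elim auto
  then show ?thesis using eventually_happens trivial_limit_at_right_real by blast
qed

text \<open>The value 0 off \<open>V\<close> is dictated by \<open>CV\<close>, whose members vanish
  there.\<close>

definition lin :: "'k set \<Rightarrow> ('k \<Rightarrow> real) \<Rightarrow> 'v \<Rightarrow> real" where
  "lin B x v = (if v \<in> V then \<Sum>k\<in>B. lam v k * x k else 0)"

definition supn :: "('v \<Rightarrow> real) \<Rightarrow> real" where
  "supn h = (SUP v\<in>V. \<bar>h v\<bar>)"

lemma lin_bound:
  assumes "finite B" "B \<subseteq> K"
  shows "\<bar>lin B x v\<bar> \<le> sig * (\<Sum>k\<in>B. \<bar>x k\<bar>)"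
proof (cases "v \<in> V")
  case True
  have "\<bar>lin B x v\<bar> \<le> (\<Sum>k\<in>B. \<bar>lam v k * x k\<bar>)" using True by (simp add: lin_def sum_abs)
  also have "\<dots> \<le> (\<Sum>k\<in>B. sig * \<bar>x k\<bar>)"
    using True assms by (intro sum_mono) (auto simp: abs_mult intro!: mult_right_mono lam_le)
  finally show ?thesis by (simp add: sum_distrib_left)
qed (auto simp: lin_def sig_nonneg sum_nonneg)

lemma lin_lipschitz:
  assumes "finite B" "B \<subseteq> K" "u \<in> V" "v \<in> V"
  shows "\<bar>lin B x u - lin B x v\<bar> \<le> (\<Sum>k\<in>B. \<bar>x k\<bar>) * rho u v"
proof -
  have "lin B x u - lin B x v = (\<Sum>k\<in>B. (lam u k - lam v k) * x k)"
    using assms by (simp add: lin_def sum_subtractf algebra_simps)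
  also have "\<bar>\<dots>\<bar> \<le> (\<Sum>k\<in>B. \<bar>lam u k - lam v k\<bar> * \<bar>x k\<bar>)"
    by (simp add: sum_abs abs_mult[symmetric])
  also have "\<dots> \<le> (\<Sum>k\<in>B. \<bar>lam u k - lam v k\<bar> * (\<Sum>k\<in>B. \<bar>x k\<bar>))"
    using assms by (intro sum_mono mult_left_mono member_le_sum) auto
  also have "\<dots> \<le> rho u v * (\<Sum>k\<in>B. \<bar>x k\<bar>)"
    using lam_diff[of u v B] assms by (simp add: sum_distrib_right[symmetric] mult_right_mono sum_nonneg)
  finally show ?thesis by (simp add: mult.commute)
qed

lemma lin_CV:
  assumes "finite B" "B \<subseteq> K"
  shows "lin B x \<in> CV V rho"
proof -
  define L where "L = (\<Sum>k\<in>B. \<bar>x k\<bar>) + 1"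
  have L: "L > 0" unfolding L_def by (intro add_nonneg_pos sum_nonneg) auto
  have "\<exists>\<delta>>0. \<forall>u\<in>V. rho u v < \<delta> \<longrightarrow> \<bar>lin B x u - lin B x v\<bar> < e" if "v \<in> V" "0 < e" for v e
  proof (intro exI[of _ "e / L"] conjI ballI impI)
    fix u assume u: "u \<in> V" "rho u v < e / L"
    have r: "0 \<le> rho u v" using lam_diff[of u v "{}"] u that by simp
    have "\<bar>lin B x u - lin B x v\<bar> \<le> (\<Sum>k\<in>B. \<bar>x k\<bar>) * rho u v" using assms u that by (intro lin_lipschitz)
    also have "\<dots> \<le> L * rho u v" using r by (intro mult_right_mono) (auto simp: L_def)
    also have "\<dots> < e" using u L by (simp add: field_simps)
    finally show "\<bar>lin B x u - lin B x v\<bar> < e" .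
  qed (use L that in simp)
  then show ?thesis by (auto simp: CV_def lin_def)
qed

lemma lin_bdd:
  assumes "finite B" "B \<subseteq> K"
  shows "bdd_above ((\<lambda>v. \<bar>lin B x v\<bar>) ` V)"
  using lin_bound[OF assms] by (intro bdd_aboveI2)

lemma lin_diff: "finite B \<Longrightarrow> A \<subseteq> B \<Longrightarrow> lin B x v - lin A x v = lin (B - A) x v"
  by (simp add: lin_def sum_diff finite_subset)

lemma lin_le_supn: "finite B \<Longrightarrow> B \<subseteq> K \<Longrightarrow> v \<in> V \<Longrightarrow> \<bar>lin B x v\<bar> \<le> supn (lin B x)"
  unfolding supn_def by (rule cSUP_upper) (auto intro: lin_bdd)

definition parent :: "nat \<Rightarrow> 'v \<Rightarrow> 'v" where
  "parent n u = (SOME w. w \<in> S n \<and> rho u w \<le> (1/2) ^ n)"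

lemma parent: "u \<in> V \<Longrightarrow> parent n u \<in> S n" "u \<in> V \<Longrightarrow> rho u (parent n u) \<le> (1/2) ^ n"
  using someI_ex[OF S_cover[of u n, unfolded Bex_def]] by (auto simp: parent_def)

text \<open>Points of \<open>S n\<close> are chained through \<open>parent\<close> down to
  \<open>S 0\<close>, each link being dominated by a maximum over a finite net. A finite sum is
  Lipschitz with respect to \<open>rho\<close>, so the supremum over \<open>V\<close> is the limit
  of the maxima over \<open>S n\<close>; this gives its measurability, and Fatou's lemma gives the
  bound.\<close>

lemma mom_le_supn_lin:
  assumes M: "prob_space M" and B: "finite B" "B \<subseteq> K"
    and t: "\<And>v. v \<in> V \<Longrightarrow> (\<Sum>k\<in>B. \<bar>lam v k\<bar>) \<le> t"
    and R: "\<And>k q. k \<in> B \<Longrightarrow> q \<in> T \<Longrightarrow> mom_le M q (R k) (tau q)"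
    and p: "p \<in> T"
  shows "mom_le M p (\<lambda>\<omega>. supn (lin B (\<lambda>k. R k \<omega>))) (tau p * Phi t)"
proof -
  interpret prob_space M by fact
  define X where "X v \<omega> = lin B (\<lambda>k. R k \<omega>) v" for v \<omega>
  have t0: "0 \<le> t" using V_ne t by (meson ex_in_conv order_trans sum_nonneg abs_ge_zero)
  have tau0: "0 < tau q" if "q \<in> T" for q using tau_ge[OF that] by simp
  have p2: "2 \<le> p" using T_ge p by simp
  have Xq: "mom_le M q (X v) (tau q * t)" if "q \<in> T" "v \<in> V" for q v
    unfolding X_def lin_def using that R t B T_ge[OF that(1)] tau0[OF that(1)]
    by (auto intro!: mom_le_weighted_sum)
  define d where "d n = min ((1/2) ^ n) (2 * t)" for n :: nat
  have d0: "0 \<le> d n" for n using t0 by (simp add: d_def)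
  have Xd: "mom_le M q (\<lambda>\<omega>. X u \<omega> - X (parent n u) \<omega>) (tau q * d n)" if "q \<in> T" "u \<in> V" for q u n
  proof -
    have pV: "parent n u \<in> V" using parent(1) S_sub that by blast
    have "(\<Sum>k\<in>B. \<bar>lam u k - lam (parent n u) k\<bar>) \<le> (\<Sum>k\<in>B. \<bar>lam u k\<bar> + \<bar>lam (parent n u) k\<bar>)"
      by (intro sum_mono) linarith
    also have "\<dots> \<le> 2 * t" using t[OF pV] t[OF that(2)] by (simp add: sum.distrib)
    finally have "(\<Sum>k\<in>B. \<bar>lam u k - lam (parent n u) k\<bar>) \<le> d n"
      using order_trans[OF lam_diff[OF that(2) pV B] parent(2)[OF that(2), of n]] by (simp add: d_def)
    then have "mom_le M q (\<lambda>\<omega>. \<Sum>k\<in>B. (lam u k - lam (parent n u) k) * R k \<omega>) (tau q * d n)"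
      using that R B T_ge[OF that(1)] tau0[OF that(1)] by (intro mom_le_weighted_sum) auto
    moreover have "(\<lambda>\<omega>. X u \<omega> - X (parent n u) \<omega>) = (\<lambda>\<omega>. \<Sum>k\<in>B. (lam u k - lam (parent n u) k) * R k \<omega>)"
      using that pV by (auto simp: X_def lin_def sum_subtractf algebra_simps)
    ultimately show ?thesis by simp
  qed
  define D0 where "D0 \<omega> = (MAX u\<in>S 0. \<bar>X u \<omega>\<bar>)" for \<omega>
  define D where "D n \<omega> = (MAX u\<in>S (Suc n). \<bar>X u \<omega> - X (parent n u) \<omega>\<bar>)" for n \<omega>
  have D0: "mom_le M p D0 (tau p * (real (card (S 0)) * t))"
  proof -
    have "mom_le M p D0 (real (card (S 0)) powr (1 / p) * (tau p * t))"
      unfolding D0_def using S_fin S_ne S_sub p p2 t0 tau0[OF p]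
      by (intro mom_le_Max Xq) (auto intro: mult_nonneg_nonneg)
    \<comment> \<open>\<open>S 0\<close> is nonempty, so replacing the exponent 1/p by 1 only
      enlarges the bound, and it removes the dependence on \<open>p\<close>.\<close>
    moreover have "real (card (S 0)) powr (1 / p) \<le> real (card (S 0)) powr 1"
      using p2 card_S_ge by (intro powr_mono) auto
    then have "real (card (S 0)) powr (1 / p) * (tau p * t) \<le> tau p * (real (card (S 0)) * t)"
      using t0 tau0[OF p] mult_right_mono[of _ _ "tau p * t"] by (fastforce simp: mult_ac)
    ultimately show ?thesis using p2 by (auto intro: mom_le_weaken)
  qed
  text \<open>For exponents \<open>q < p\<close> the bound with \<open>q\<close> is not available for the \<open>p\<close>-th moment,
    but \<open>card powr (1/p) \<le> card powr (1/q)\<close> and \<open>1 \<le> tau q\<close> make up for it.\<close>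
  have D: "mom_le M p (D n) (tau p * (E n * d n))" for n
  proof -
    obtain q where q: "q \<in> T" "real (card (S (Suc n))) powr (1 / q) * tau q \<le> E n"
      using E_bound by blast
    have Dq: "mom_le M r (D n) (real (card (S (Suc n))) powr (1 / r) * (tau r * d n))" if "r \<in> T" for r
      unfolding D_def using S_fin S_ne S_sub T_ge[OF that] d0 tau0[OF that] that
      by (intro mom_le_Max Xd) (auto intro: mult_nonneg_nonneg)
    have Ed: "0 \<le> E n * d n" using E_nonneg d0 by simp
    show ?thesis
    proof (cases "p \<le> q")
      case True
      have "real (card (S (Suc n))) powr (1 / q) * (tau q * d n) \<le> E n * d n"
        using mult_right_mono[OF q(2) d0[of n]] by (simp add: mult_ac)
      also have "\<dots> \<le> tau p * (E n * d n)" using mult_right_mono[OF tau_ge[OF p] Ed] by simp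
      finally show ?thesis
        using mom_le_weaken[OF mom_le_Lyapunov[OF Dq[OF q(1)] _ True]] p2 by auto
    next
      case False
      have "real (card (S (Suc n))) powr (1 / p) \<le> real (card (S (Suc n))) powr (1 / q)"
        using False T_ge[OF q(1)] card_S_ge by (intro powr_mono divide_left_mono) auto
      also have "\<dots> \<le> real (card (S (Suc n))) powr (1 / q) * tau q"
        using tau_ge[OF q(1)] mult_left_mono[of 1 "tau q"] by fastforce
      also have "\<dots> \<le> E n" by (rule q(2))
      finally have "real (card (S (Suc n))) powr (1 / p) * (tau p * d n) \<le> E n * (tau p * d n)"
        using tau0[OF p] d0 by (intro mult_right_mono) auto
      then show ?thesis
        using mom_le_weaken[OF Dq[OF p]] p2 by (auto simp: mult_ac)
    qed
  qed
  have chain: "\<bar>X u \<omega>\<bar> \<le> D0 \<omega> + (\<Sum>i<n. D i \<omega>)" if "u \<in> S n" for u n \<omega>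
    using that
  proof (induction n arbitrary: u)
    case 0
    then show ?case using S_fin by (auto simp: D0_def intro!: Max_ge)
  next
    case (Suc n)
    have "\<bar>X (parent n u) \<omega>\<bar> \<le> D0 \<omega> + (\<Sum>i<n. D i \<omega>)"
      using Suc S_sub by (intro Suc.IH parent) auto
    moreover have "\<bar>X u \<omega> - X (parent n u) \<omega>\<bar> \<le> D n \<omega>"
      unfolding D_def using Suc S_fin by (intro Max_ge) auto
    ultimately show ?case by simp
  qed
  define W where "W n \<omega> = (MAX u\<in>S n. \<bar>X u \<omega>\<bar>)" for n \<omega>
  have W: "mom_le M p (W n) (tau p * Phi t)" for n
  proof -
    have "mom_le M p (\<lambda>\<omega>. D0 \<omega> + (\<Sum>i<n. D i \<omega>)) (tau p * (real (card (S 0)) * t) + (\<Sum>i<n. tau p * (E i * d i)))"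
      using D0 D p2 by (intro mom_le_add mom_le_sum) auto
    then show ?thesis
    proof (rule mom_le_mono)
      show "W n \<in> borel_measurable M"
        unfolding W_def using mom_leD(1)[OF Xq[OF p]] S_sub S_fin S_ne
        by (intro borel_measurable_Max borel_measurable_abs) auto
      show "\<bar>W n \<omega>\<bar> \<le> \<bar>D0 \<omega> + (\<Sum>i<n. D i \<omega>)\<bar>" for \<omega>
      proof -
        have "W n \<omega> \<in> (\<lambda>u. \<bar>X u \<omega>\<bar>) ` S n" unfolding W_def using S_fin S_ne by (intro Max_in) auto
        then obtain u where "u \<in> S n" "W n \<omega> = \<bar>X u \<omega>\<bar>" by auto
        then show ?thesis using chain[of u n \<omega>] by simp
      qed
      have "tau p * (real (card (S 0)) * t) + (\<Sum>i<n. tau p * (E i * d i)) = tau p * (real (card (S 0)) * t + (\<Sum>i<n. E i * d i))"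
        by (simp add: sum_distrib_left distrib_left)
      also have "\<dots> \<le> tau p * Phi t"
        using Phi_partial[OF t0, of n] tau0[OF p] by (intro mult_left_mono) (auto simp: d_def)
      finally show "tau p * (real (card (S 0)) * t) + (\<Sum>i<n. tau p * (E i * d i)) \<le> tau p * Phi t" .
    qed (use p2 in auto)
  qed
  \<comment> \<open>At stage \<open>n\<close> the gap is at most 2^-n times the sum of the |R k
    \<omega>|, so the convergence holds at every sample point.\<close>
  have lim: "(\<lambda>n. W n \<omega>) \<longlonglongrightarrow> supn (lin B (\<lambda>k. R k \<omega>))" for \<omega>
  proof (rule tendsto_sandwich)
    define L where "L = (\<Sum>k\<in>B. \<bar>R k \<omega>\<bar>)"
    have L: "0 \<le> L" by (auto simp: L_def sum_nonneg)
    have "supn (lin B (\<lambda>k. R k \<omega>)) \<le> W n \<omega> + L * (1/2) ^ n" for n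
      unfolding supn_def
    proof (intro cSUP_least V_ne)
      fix v assume v: "v \<in> V"
      have "\<bar>lin B (\<lambda>k. R k \<omega>) v - lin B (\<lambda>k. R k \<omega>) (parent n v)\<bar> \<le> L * rho v (parent n v)"
        unfolding L_def using v parent(1) S_sub by (intro lin_lipschitz B) auto
      also have "\<dots> \<le> L * (1/2) ^ n" using L v by (intro mult_left_mono parent)
      finally have "\<bar>lin B (\<lambda>k. R k \<omega>) v - lin B (\<lambda>k. R k \<omega>) (parent n v)\<bar> \<le> L * (1/2) ^ n" .
      moreover have "\<bar>X (parent n v) \<omega>\<bar> \<le> W n \<omega>"
        unfolding W_def using v S_fin by (intro Max_ge) (auto intro: parent)
      ultimately show "\<bar>lin B (\<lambda>k. R k \<omega>) v\<bar> \<le> W n \<omega> + L * (1/2) ^ n" by (simp add: X_def)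
    qed
    then show "\<forall>\<^sub>F n in sequentially. supn (lin B (\<lambda>k. R k \<omega>)) - L * (1/2) ^ n \<le> W n \<omega>"
      by (intro always_eventually) (simp add: algebra_simps)
    have "W n \<omega> \<le> supn (lin B (\<lambda>k. R k \<omega>))" for n
      unfolding W_def X_def using S_fin S_ne S_sub B by (subst Max_le_iff) (auto intro!: lin_le_supn)
    then show "\<forall>\<^sub>F n in sequentially. W n \<omega> \<le> supn (lin B (\<lambda>k. R k \<omega>))" by simp
    show "(\<lambda>n. supn (lin B (\<lambda>k. R k \<omega>)) - L * (1/2) ^ n) \<longlonglongrightarrow> supn (lin B (\<lambda>k. R k \<omega>))"
      by (auto intro!: tendsto_eq_intros LIMSEQ_power_zero)
  qed simp
  show ?thesis
  proof (rule mom_le_limit[where X = W, OF W])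
    show "(\<lambda>\<omega>. supn (lin B (\<lambda>k. R k \<omega>))) \<in> borel_measurable M"
      by (rule borel_measurable_LIMSEQ_real[OF lim]) (use W mom_leD(1) in blast)
  qed (use lim p2 in auto)
qed

section \<open>Continuity and measurability of functionals of finite partial sums\<close>

lemma continuous_comp_lin:
  fixes phi :: "'k \<Rightarrow> 'x::topological_space \<Rightarrow> real"
  assumes F: "bounded_cont_fun V rho F" and B: "finite B" "B \<subseteq> K"
    and phi: "\<And>k. k \<in> B \<Longrightarrow> continuous_on UNIV (phi k)"
  shows "continuous_on UNIV (\<lambda>x. F (lin B (\<lambda>k. phi k x)))"
  unfolding continuous_on
proof
  fix x
  have "((\<lambda>y. F (lin B (\<lambda>k. phi k y))) \<longlongrightarrow> F (lin B (\<lambda>k. phi k x))) (at x)"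
  proof (rule tendstoI)
    fix e :: real assume "0 < e"
    from bounded_cont_funD[OF F lin_CV[OF B, of "\<lambda>k. phi k x"] this]
    obtain \<delta> where \<delta>: "0 < \<delta>" "\<And>h'. h' \<in> CV V rho \<Longrightarrow> (SUP v\<in>V. \<bar>h' v - lin B (\<lambda>k. phi k x) v\<bar>) < \<delta> \<Longrightarrow> \<bar>F h' - F (lin B (\<lambda>k. phi k x))\<bar> < e"
      by blast
    define q where "q y = sig * (\<Sum>k\<in>B. \<bar>phi k y - phi k x\<bar>)" for y
    have ph: "(phi k \<longlongrightarrow> phi k x) (at x)" if "k \<in> B" for k
      using phi[OF that] by (auto simp: continuous_on)
    have "((\<lambda>y. sig * (\<Sum>k\<in>B. \<bar>phi k y - phi k x\<bar>)) \<longlongrightarrow> sig * (\<Sum>k\<in>B. \<bar>phi k x - phi k x\<bar>)) (at x)"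
      by (intro tendsto_intros ph)
    then have "(q \<longlongrightarrow> 0) (at x)" by (simp add: q_def[abs_def])
    then have "\<forall>\<^sub>F y in at x. q y < \<delta>" using \<delta>(1) by (rule order_tendstoD)
    then show "\<forall>\<^sub>F y in at x. dist (F (lin B (\<lambda>k. phi k y))) (F (lin B (\<lambda>k. phi k x))) < e"
    proof eventually_elim
      fix y assume y: "q y < \<delta>"
      have "(SUP v\<in>V. \<bar>lin B (\<lambda>k. phi k y) v - lin B (\<lambda>k. phi k x) v\<bar>) \<le> q y"
      proof (intro cSUP_least V_ne)
        fix v assume "v \<in> V"
        have "lin B (\<lambda>k. phi k y) v - lin B (\<lambda>k. phi k x) v = lin B (\<lambda>k. phi k y - phi k x) v"
          by (simp add: lin_def sum_subtractf algebra_simps)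
        then show "\<bar>lin B (\<lambda>k. phi k y) v - lin B (\<lambda>k. phi k x) v\<bar> \<le> q y"
          unfolding q_def using lin_bound[OF B] by simp
      qed
      then show "dist (F (lin B (\<lambda>k. phi k y))) (F (lin B (\<lambda>k. phi k x))) < e"
        using y \<delta>(2)[OF lin_CV[OF B]] by (simp add: dist_real_def)
    qed
  qed
  then show "((\<lambda>y. F (lin B (\<lambda>k. phi k y))) \<longlongrightarrow> F (lin B (\<lambda>k. phi k x))) (at x within UNIV)" by simp
qed

text \<open>Measurability into sequences of reals can be checked coordinatewise, so composing with a
  continuous function of the coefficients stays measurable. The indices in \<open>B\<close> are
  numbered by \<open>idx\<close>; the remaining coordinates of the sequence are filled with
  0.\<close>

lemma measurable_comp_lin:
  assumes F: "bounded_cont_fun V rho F" and B: "finite B" "B \<subseteq> K"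
    and R: "\<And>k. k \<in> B \<Longrightarrow> R k \<in> borel_measurable M"
  shows "(\<lambda>\<omega>. F (lin B (\<lambda>k. R k \<omega>))) \<in> borel_measurable M"
proof -
  obtain idx :: "'k \<Rightarrow> nat" where idx: "inj_on idx B"
    using finite_imp_inj_to_nat_seg[OF B(1)] by blast
  have "continuous_on UNIV (\<lambda>x::nat \<Rightarrow> real. F (lin B (\<lambda>k. x (idx k))))"
    by (intro continuous_comp_lin[OF F B] continuous_on_product_coordinates)
  then have 1: "(\<lambda>x::nat \<Rightarrow> real. F (lin B (\<lambda>k. x (idx k)))) \<in> borel_measurable borel"
    by (rule borel_measurable_continuous_onI)
  define Y where "Y \<omega> i = (if i \<in> idx ` B then R (inv_into B idx i) \<omega> else 0)" for \<omega> i
  have "Y \<in> borel_measurable M"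
  proof (rule measurable_coordinatewise_then_product)
    show "(\<lambda>\<omega>. Y \<omega> i) \<in> borel_measurable M" for i
      using R inv_into_into[of i idx B] by (cases "i \<in> idx ` B") (simp_all add: Y_def)
  qed
  from measurable_compose[OF this 1] have "(\<lambda>\<omega>. F (lin B (\<lambda>k. Y \<omega> (idx k)))) \<in> borel_measurable M" .
  moreover have "lin B (\<lambda>k. Y \<omega> (idx k)) = lin B (\<lambda>k. R k \<omega>)" for \<omega>
    using idx by (auto simp: lin_def Y_def fun_eq_iff intro!: sum.cong)
  ultimately show ?thesis by simp
qed

definition exhaustion :: "(nat \<Rightarrow> 'k set) \<Rightarrow> bool" where
  "exhaustion A \<longleftrightarrow> incseq A \<and> (\<forall>m. finite (A m) \<and> A m \<subseteq> K) \<and> (\<Union>m. A m) = K \<and>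
     (\<forall>m. \<exists>t\<ge>0. Phi t \<le> (1/4) ^ m \<and> (\<forall>v\<in>V. \<forall>B. finite B \<longrightarrow> B \<subseteq> K - A m \<longrightarrow> (\<Sum>k\<in>B. \<bar>lam v k\<bar>) \<le> t))"

text \<open>The rate 4^-m is required after chaining: a coefficient level \<open>t m\<close> with
  \<open>Phi (t m)\<close> that small is fixed before the uniform tails provide the finite set. A
  geometric rate makes the expected sup norms of consecutive blocks summable.\<close>

lemma ex_exhaustion: "\<exists>A. exhaustion A"
proof -
  have "\<exists>t>0. Phi t \<le> (1/4) ^ m" for m :: nat by (intro Phi_small) simp
  then obtain t where t: "\<And>m. 0 < t m" "\<And>m. Phi (t m) \<le> (1/4) ^ m" by metis
  have "\<exists>A. finite A \<and> A \<subseteq> K \<and> (\<forall>v\<in>V. \<forall>B. finite B \<longrightarrow> B \<subseteq> K - A \<longrightarrow> (\<Sum>k\<in>B. \<bar>lam v k\<bar>) \<le> t m)" for m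
    by (intro tails t)
  then obtain A where A: "\<And>m. finite (A m)" "\<And>m. A m \<subseteq> K"
    "\<And>m v B. v \<in> V \<Longrightarrow> finite B \<Longrightarrow> B \<subseteq> K - A m \<Longrightarrow> (\<Sum>k\<in>B. \<bar>lam v k\<bar>) \<le> t m" by metis
  \<comment> \<open>The sets from the tail condition may miss indices, for instance those with all
    coefficients zero; adjoining an enumeration of \<open>K\<close> makes their union exactly
    \<open>K\<close>. The intersection with \<open>K\<close> matters when \<open>K\<close> is
    empty.\<close>
  define A' where "A' m = (\<Union>i\<le>m. A i \<union> (K \<inter> {from_nat_into K i}))" for m
  have "exhaustion A'"
    unfolding exhaustion_def
  proof (intro conjI allI)
    show "incseq A'" unfolding A'_def by (intro monoI UN_mono) auto
    show "finite (A' m)" "A' m \<subseteq> K" for m using A by (auto simp: A'_def)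
    show "(\<Union>m. A' m) = K"
    proof
      show "K \<subseteq> (\<Union>m. A' m)"
      proof
        fix k assume k: "k \<in> K"
        then obtain i where "from_nat_into K i = k" using K_countable from_nat_into_surj by metis
        then have "k \<in> A' i" using k by (auto simp: A'_def)
        then show "k \<in> (\<Union>m. A' m)" by blast
      qed
    qed (use A in \<open>auto simp: A'_def\<close>)
    show "\<exists>t\<ge>0. Phi t \<le> (1/4) ^ m \<and> (\<forall>v\<in>V. \<forall>B. finite B \<longrightarrow> B \<subseteq> K - A' m \<longrightarrow> (\<Sum>k\<in>B. \<bar>lam v k\<bar>) \<le> t)" for m
    proof (intro exI[of _ "t m"] conjI ballI allI impI t(2) A(3))
      show "0 \<le> t m" using t(1)[of m] by simp
      show "B \<subseteq> K - A m" if "B \<subseteq> K - A' m" for B using that by (auto simp: A'_def)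
    qed auto
  qed
  then show ?thesis by blast
qed

end

section \<open>Continuous versions\<close>

lemma CV_D:
  assumes "h \<in> CV V r" "v \<in> V" "0 < e"
  shows "\<exists>\<delta>>0. \<forall>u\<in>V. r u v < \<delta> \<longrightarrow> \<bar>h u - h v\<bar> < e"
  using assms by (auto simp: CV_def)

context entropy_net
begin

lemma exhaustionD:
  assumes "exhaustion A"
  shows "finite (A m)" "A m \<subseteq> K" "m \<le> n \<Longrightarrow> A m \<subseteq> A n" "k \<in> K \<Longrightarrow> \<exists>m. k \<in> A m"
    "\<exists>t\<ge>0. Phi t \<le> (1/4) ^ m \<and> (\<forall>v\<in>V. \<forall>B. finite B \<longrightarrow> B \<subseteq> K - A m \<longrightarrow> (\<Sum>k\<in>B. \<bar>lam v k\<bar>) \<le> t)"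
proof -
  have A: "incseq A" "\<forall>m. finite (A m) \<and> A m \<subseteq> K" "(\<Union>m. A m) = K"
    "\<forall>m. \<exists>t\<ge>0. Phi t \<le> (1/4) ^ m \<and> (\<forall>v\<in>V. \<forall>B. finite B \<longrightarrow> B \<subseteq> K - A m \<longrightarrow> (\<Sum>k\<in>B. \<bar>lam v k\<bar>) \<le> t)"
    using assms unfolding exhaustion_def by simp_all
  show "finite (A m)" "A m \<subseteq> K" using A(2) by simp_all
  show "m \<le> n \<Longrightarrow> A m \<subseteq> A n" using A(1) by (rule incseqD)
  show "k \<in> K \<Longrightarrow> \<exists>m. k \<in> A m" using A(3) by (metis UN_E)
  show "\<exists>t\<ge>0. Phi t \<le> (1/4) ^ m \<and> (\<forall>v\<in>V. \<forall>B. finite B \<longrightarrow> B \<subseteq> K - A m \<longrightarrow> (\<Sum>k\<in>B. \<bar>lam v k\<bar>) \<le> t)"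
    using A(4) by (rule spec)
qed

lemma exhaustion_finite_subset:
  assumes A: "exhaustion A" and B: "finite B" "B \<subseteq> K"
  shows "\<exists>m. \<forall>n\<ge>m. B \<subseteq> A n"
  using B
proof (induction B rule: finite_induct)
  case (insert k B)
  then obtain m where m: "\<And>n. n \<ge> m \<Longrightarrow> B \<subseteq> A n" by auto
  obtain j where "k \<in> A j" using insert exhaustionD(4)[OF A, of k] by auto
  then have "k \<in> A n" if "n \<ge> j" for n
    using exhaustionD(3)[OF A that] by auto
  then show ?case using m by (intro exI[of _ "max m j"]) auto
qed auto

text \<open>An exhaustion is eventually above every finite subset of \<open>K\<close>, so the
  unordered sum is the limit along it.\<close>

lemma exhaustion_infsum:
  assumes A: "exhaustion A" and f: "f summable_on K"
  shows "(\<lambda>m. sum f (A m)) \<longlonglongrightarrow> infsum f K"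
proof -
  have "filterlim A (finite_subsets_at_top K) sequentially"
    unfolding filterlim_iff eventually_finite_subsets_at_top eventually_sequentially
  proof (intro allI impI, elim exE conjE)
    fix P X assume X: "finite X" "X \<subseteq> K" and P: "\<forall>Y. finite Y \<and> X \<subseteq> Y \<and> Y \<subseteq> K \<longrightarrow> P Y"
    from exhaustion_finite_subset[OF A X] obtain m where "\<forall>n\<ge>m. X \<subseteq> A n" by blast
    then have "P (A n)" if "n \<ge> m" for n using P exhaustionD(1,2)[OF A, of n] that by simp
    then show "\<exists>N. \<forall>n\<ge>N. P (A n)" by blast
  qed
  from filterlim_compose[OF infsum_tendsto[OF f] this] show ?thesis .
qed

text \<open>By monotone convergence along the exhaustion the sum of the |lam v k R k| has
  expectation at most c times \<open>sig\<close>, hence is finite almost surely. The null set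
  depends on \<open>v\<close>, which is why a continuous version has to be constructed and cannot be
  read off the series.\<close>

lemma AE_summable_on:
  assumes M: "prob_space M" and A: "exhaustion A" and v: "v \<in> V" and c: "0 \<le> c"
    and R: "\<And>k. k \<in> K \<Longrightarrow> mom_le M 2 (R k) c"
  shows "AE \<omega> in M. (\<lambda>k. lam v k * R k \<omega>) summable_on K"
proof -
  interpret prob_space M by fact
  have fin: "finite (A m)" "A m \<subseteq> K" for m using exhaustionD[OF A] by auto
  define g where "g m \<omega> = (\<Sum>k\<in>A m. \<bar>lam v k * R k \<omega>\<bar>)" for m \<omega>
  have g1: "mom_le M 1 (g m) (c * sig)" for m
  proof -
    have "mom_le M 1 (\<lambda>\<omega>. \<Sum>k\<in>A m. \<bar>lam v k\<bar> * \<bar>R k \<omega>\<bar>) (c * sig)"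
    proof (intro mom_le_weighted_sum fin)
      fix k assume "k \<in> A m"
      then have "mom_le M 2 (R k) c" using fin R by blast
      then have "mom_le M 1 (R k) c" by (rule mom_le_Lyapunov) auto
      then show "mom_le M 1 (\<lambda>\<omega>. \<bar>R k \<omega>\<bar>) c"
        by (auto simp: mom_le_def)
    qed (use c v fin lam_sum in auto)
    then show ?thesis by (simp add: g_def[abs_def] abs_mult)
  qed
  have [measurable]: "g m \<in> borel_measurable M" for m using mom_leD(1)[OF g1] .
  have g0: "0 \<le> g m \<omega>" for m \<omega> by (simp add: g_def sum_nonneg)
  have inc: "incseq (\<lambda>m \<omega>. ennreal (g m \<omega>))"
    unfolding incseq_def le_fun_def
  proof (intro allI impI ennreal_leI)
    show "g m \<omega> \<le> g n \<omega>" if "m \<le> n" for m n \<omega>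
      unfolding g_def using exhaustionD(3)[OF A that] fin by (intro sum_mono2) auto
  qed
  have "(\<integral>\<^sup>+\<omega>. (SUP m. ennreal (g m \<omega>)) \<partial>M) = (SUP m. \<integral>\<^sup>+\<omega>. ennreal (g m \<omega>) \<partial>M)"
    by (intro nn_integral_monotone_convergence_SUP inc) auto
  also have "\<dots> \<le> ennreal (c * sig)"
  proof (rule SUP_least)
    show "(\<integral>\<^sup>+\<omega>. ennreal (g m \<omega>) \<partial>M) \<le> ennreal (c * sig)" for m
      using mom_leD(3)[OF g1[of m]] g0 c sig_nonneg by simp
  qed
  finally have "(\<integral>\<^sup>+\<omega>. (SUP m. ennreal (g m \<omega>)) \<partial>M) \<noteq> \<infinity>"
    by (metis ennreal_less_top infinity_ennreal_def leD top.not_eq_extremum)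
  then have "AE \<omega> in M. (SUP m. ennreal (g m \<omega>)) \<noteq> \<infinity>"
    by (intro nn_integral_PInf_AE) auto
  then show ?thesis
  proof eventually_elim
    fix \<omega> assume fin_sup: "(SUP m. ennreal (g m \<omega>)) \<noteq> \<infinity>"
    then obtain b where b: "0 \<le> b" "(SUP m. ennreal (g m \<omega>)) = ennreal b"
      by (metis ennreal_cases infinity_ennreal_def)
    have gb: "g m \<omega> \<le> b" for m
    proof -
      have "ennreal (g m \<omega>) \<le> ennreal b" unfolding b(2)[symmetric] by (rule SUP_upper) simp
      then show ?thesis using b(1) by (simp add: ennreal_le_iff)
    qed
    have "(\<lambda>k. norm (lam v k * R k \<omega>)) summable_on K"
    proof (rule nonneg_bdd_above_summable_on)
      show "bdd_above (sum (\<lambda>k. norm (lam v k * R k \<omega>)) ` {F. F \<subseteq> K \<and> finite F})"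
      proof (rule bdd_aboveI2)
        fix B assume B: "B \<in> {F. F \<subseteq> K \<and> finite F}"
        then obtain m where "B \<subseteq> A m" using exhaustion_finite_subset[OF A, of B] by auto
        then have "(\<Sum>k\<in>B. norm (lam v k * R k \<omega>)) \<le> g m \<omega>"
          unfolding g_def using fin(1)[of m] by (simp add: sum_mono2)
        then show "(\<Sum>k\<in>B. norm (lam v k * R k \<omega>)) \<le> b" using gb[of m] by linarith
      qed
    qed auto
    then show "(\<lambda>k. lam v k * R k \<omega>) summable_on K" by (rule abs_summable_summable)
  qed
qed

section \<open>Uniform limits of the partial sums along an exhaustion\<close>

definition limlin :: "(nat \<Rightarrow> 'k set) \<Rightarrow> ('k \<Rightarrow> real) \<Rightarrow> 'v \<Rightarrow> real" where
  "limlin A x v = lim (\<lambda>m. lin (A m) x v)"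

definition incr :: "(nat \<Rightarrow> 'k set) \<Rightarrow> ('k \<Rightarrow> real) \<Rightarrow> nat \<Rightarrow> real" where
  "incr A x m = supn (lin (A (Suc m) - A m) x)"

lemma supn_nonneg: "bdd_above ((\<lambda>v. \<bar>h v\<bar>) ` V) \<Longrightarrow> 0 \<le> supn h"
proof -
  assume b: "bdd_above ((\<lambda>v. \<bar>h v\<bar>) ` V)"
  obtain v where "v \<in> V" using V_ne by (meson ex_in_conv)
  from cSUP_upper[OF this b] show ?thesis unfolding supn_def by linarith
qed

lemma supn_le: "(\<And>v. v \<in> V \<Longrightarrow> \<bar>h v\<bar> \<le> b) \<Longrightarrow> supn h \<le> b"
  unfolding supn_def by (intro cSUP_least V_ne)

lemma incr_nonneg: "exhaustion A \<Longrightarrow> 0 \<le> incr A x m"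
  unfolding incr_def
  by (intro supn_nonneg lin_bdd finite_Diff exhaustionD(1) order_trans[OF Diff_subset] exhaustionD(2))

text \<open>The Weierstrass test: consecutive partial sums differ by at most
  \<open>incr A x m\<close> at every point, so the tail sums of \<open>incr\<close> bound the error
  uniformly and continuity survives the limit.\<close>

lemma limlin:
  assumes A: "exhaustion A" and s: "summable (incr A x)"
  shows "(\<lambda>m. lin (A m) x v) \<longlonglongrightarrow> limlin A x v"
    and "\<bar>lin (A m) x v - limlin A x v\<bar> \<le> (\<Sum>i. incr A x (i + m))"
    and "(\<lambda>m. \<Sum>i. incr A x (i + m)) \<longlonglongrightarrow> 0"
    and "limlin A x \<in> CV V rho"
proof -
  have fin: "finite (A m)" "A m \<subseteq> K" for m using exhaustionD[OF A] by auto
  have step: "\<bar>lin (A (Suc m)) x v - lin (A m) x v\<bar> \<le> incr A x m" for m v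
  proof (cases "v \<in> V")
    case True
    have "lin (A (Suc m)) x v - lin (A m) x v = lin (A (Suc m) - A m) x v"
      by (intro lin_diff fin exhaustionD(3)[OF A]) auto
    then show ?thesis unfolding incr_def using fin True by (auto intro!: lin_le_supn)
  qed (auto simp: lin_def incr_nonneg[OF A])
  have sh: "summable (\<lambda>i. incr A x (i + m))" for m using s by (simp add: summable_iff_shift)
  have diff: "\<bar>lin (A (n + m)) x v - lin (A m) x v\<bar> \<le> (\<Sum>i. incr A x (i + m))" for n m v
  proof -
    have "\<bar>lin (A (n + m)) x v - lin (A m) x v\<bar> \<le> (\<Sum>i<n. incr A x (i + m))"
    proof (induction n)
      case (Suc n)
      then show ?case using step[of "n + m" v] by simp
    qed simp
    also have "\<dots> \<le> (\<Sum>i. incr A x (i + m))"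
      using incr_nonneg[OF A] by (intro sum_le_suminf sh) auto
    finally show ?thesis .
  qed
  have conv: "(\<lambda>m. lin (A m) x v) \<longlonglongrightarrow> limlin A x v" for v
  proof -
    have "summable (\<lambda>m. lin (A (Suc m)) x v - lin (A m) x v)"
      by (rule summable_comparison_test'[OF s]) (use step in auto)
    then have "(\<lambda>n. \<Sum>i<n. lin (A (Suc i)) x v - lin (A i) x v) \<longlonglongrightarrow> (\<Sum>m. lin (A (Suc m)) x v - lin (A m) x v)"
      by (rule summable_LIMSEQ)
    then have "(\<lambda>n. lin (A n) x v - lin (A 0) x v) \<longlonglongrightarrow> (\<Sum>m. lin (A (Suc m)) x v - lin (A m) x v)"
      by (subst (asm) sum_lessThan_telescope)
    then have "convergent (\<lambda>n. (lin (A n) x v - lin (A 0) x v) + lin (A 0) x v)"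
      by (intro convergent_add convergent_const) (auto simp: convergent_def)
    then show ?thesis unfolding limlin_def by (simp add: convergent_LIMSEQ_iff)
  qed
  then show "(\<lambda>m. lin (A m) x v) \<longlonglongrightarrow> limlin A x v" .
  have close: "\<bar>lin (A m) x v - limlin A x v\<bar> \<le> (\<Sum>i. incr A x (i + m))" for m v
  proof -
    have "(\<lambda>n. \<bar>lin (A (n + m)) x v - lin (A m) x v\<bar>) \<longlonglongrightarrow> \<bar>limlin A x v - lin (A m) x v\<bar>"
      by (intro tendsto_intros LIMSEQ_ignore_initial_segment conv)
    then have "\<bar>limlin A x v - lin (A m) x v\<bar> \<le> (\<Sum>i. incr A x (i + m))"
      by (rule LIMSEQ_le_const2) (use diff in auto)
    then show ?thesis by (simp add: abs_minus_commute)
  qed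
  then show "\<bar>lin (A m) x v - limlin A x v\<bar> \<le> (\<Sum>i. incr A x (i + m))" .
  show r0: "(\<lambda>m. \<Sum>i. incr A x (i + m)) \<longlonglongrightarrow> 0"
    using s by (rule suminf_exist_split2)
  have "\<exists>\<delta>>0. \<forall>u\<in>V. rho u v < \<delta> \<longrightarrow> \<bar>limlin A x u - limlin A x v\<bar> < e" if "v \<in> V" "0 < e" for v e
  proof -
    have "\<forall>\<^sub>F m in sequentially. (\<Sum>i. incr A x (i + m)) < e / 3"
      using r0 that by (intro order_tendstoD) auto
    then obtain m where m: "(\<Sum>i. incr A x (i + m)) < e / 3" by (auto simp: eventually_sequentially)
    from CV_D[OF lin_CV[OF fin[of m], of x] that(1), of "e / 3"] that(2) obtain \<delta> where \<delta>: "\<delta> > 0"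
      "\<forall>u\<in>V. rho u v < \<delta> \<longrightarrow> \<bar>lin (A m) x u - lin (A m) x v\<bar> < e / 3"
      by auto
    then show ?thesis
    proof (intro exI[of _ \<delta>] conjI ballI impI)
      fix u assume "u \<in> V" "rho u v < \<delta>"
      then have "\<bar>lin (A m) x u - lin (A m) x v\<bar> < e / 3" using \<delta> by blast
      then show "\<bar>limlin A x u - limlin A x v\<bar> < e"
        using close[of m u] close[of m v] m by linarith
    qed
  qed
  moreover have "limlin A x v = 0" if "v \<notin> V" for v
    using that by (simp add: limlin_def lin_def)
  ultimately show "limlin A x \<in> CV V rho" by (auto simp: CV_def)
qed

lemma zero_CV: "(\<lambda>_. 0) \<in> CV V rho"
  by (auto simp: CV_def intro!: exI[of _ 1])

text \<open>Uniform convergence passes to sup norms. These limits let Fatou's lemma transfer moment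
  bounds from finite blocks to the whole field and to its remainder after
  \<open>A m\<close>.\<close>

lemma supn_lin_tendsto:
  assumes A: "exhaustion A" and s: "summable (incr A x)"
  shows "(\<lambda>n. supn (lin (A (n + m) - A m) x)) \<longlonglongrightarrow> supn (\<lambda>v. limlin A x v - lin (A m) x v)"
    and "(\<lambda>n. supn (lin (A n) x)) \<longlonglongrightarrow> supn (limlin A x)"
    and "bdd_above ((\<lambda>v. \<bar>limlin A x v\<bar>) ` V)"
proof -
  have fin: "finite (A m)" "A m \<subseteq> K" for m using exhaustionD[OF A] by auto
  note L = limlin[OF A s]
  have b1: "bdd_above ((\<lambda>v. \<bar>limlin A x v - lin (A m) x v\<bar>) ` V)" for m
    using L(2)[of m] by (intro bdd_aboveI2) (simp add: abs_minus_commute)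
  show b2: "bdd_above ((\<lambda>v. \<bar>limlin A x v\<bar>) ` V)"
  proof (rule bdd_aboveI2)
    show "\<bar>limlin A x v\<bar> \<le> (\<Sum>i. incr A x (i + 0)) + sig * (\<Sum>k\<in>A 0. \<bar>x k\<bar>)" for v
      using L(2)[of 0 v] lin_bound[OF fin[of 0], of x v] by linarith
  qed
  have r: "(\<lambda>n. \<Sum>i. incr A x (i + (n + m))) \<longlonglongrightarrow> 0" for m
    using LIMSEQ_ignore_initial_segment[OF L(3), of m] by simp
  have "\<bar>supn (lin (A (n + m) - A m) x) - supn (\<lambda>v. limlin A x v - lin (A m) x v)\<bar> \<le> (\<Sum>i. incr A x (i + (n + m)))" for n
    unfolding supn_def
  proof (intro abs_SUP_diff_le V_ne lin_bdd b1)
    fix v assume "v \<in> V"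
    have "lin (A (n + m) - A m) x v = lin (A (n + m)) x v - lin (A m) x v"
      by (intro lin_diff[symmetric] fin exhaustionD(3)[OF A]) auto
    then show "\<bar>\<bar>lin (A (n + m) - A m) x v\<bar> - \<bar>limlin A x v - lin (A m) x v\<bar>\<bar> \<le> (\<Sum>i. incr A x (i + (n + m)))"
      using L(2)[of "n + m" v] by linarith
  qed (use fin in auto)
  then show "(\<lambda>n. supn (lin (A (n + m) - A m) x)) \<longlonglongrightarrow> supn (\<lambda>v. limlin A x v - lin (A m) x v)"
    by (intro Lim_transform_bound[OF _ r, THEN Lim_null[THEN iffD2]] always_eventually) (auto intro: order_trans[OF _ abs_ge_self])
  have "\<bar>supn (lin (A n) x) - supn (limlin A x)\<bar> \<le> (\<Sum>i. incr A x (i + n))" for n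
    unfolding supn_def
  proof (intro abs_SUP_diff_le V_ne lin_bdd b2)
    fix v
    show "\<bar>\<bar>lin (A n) x v\<bar> - \<bar>limlin A x v\<bar>\<bar> \<le> (\<Sum>i. incr A x (i + n))" using L(2)[of n v] by linarith
  qed (use fin in auto)
  then show "(\<lambda>n. supn (lin (A n) x)) \<longlonglongrightarrow> supn (limlin A x)"
    by (intro Lim_transform_bound[OF _ L(3), THEN Lim_null[THEN iffD2]] always_eventually) (auto intro: order_trans[OF _ abs_ge_self])
qed

text \<open>Collects what later arguments use of a field, including measurability after every
  bounded continuous functional. The constants involve neither \<open>M\<close> nor
  \<open>R\<close>, which makes them uniform over all boxes and common to the Gaussian
  limit.\<close>

definition field_version ::
    "'w measure \<Rightarrow> (nat \<Rightarrow> 'k set) \<Rightarrow> ('k \<Rightarrow> 'w \<Rightarrow> real) \<Rightarrow> ('w \<Rightarrow> 'v \<Rightarrow> real) \<Rightarrow> bool" where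
  "field_version M A R Y \<longleftrightarrow>
    cont_version M V rho Y (\<lambda>v \<omega>. infsum (\<lambda>k. lam v k * R k \<omega>) K) \<and>
    (\<forall>\<omega>. bdd_above ((\<lambda>v. \<bar>Y \<omega> v\<bar>) ` V)) \<and>
    (\<forall>p\<in>T. mom_le M p (\<lambda>\<omega>. supn (Y \<omega>)) (tau p * Phi sig)) \<and>
    (\<forall>m. mom_le M 2 (\<lambda>\<omega>. supn (\<lambda>v. Y \<omega> v - lin (A m) (\<lambda>k. R k \<omega>) v)) (tau 2 * (1/4) ^ m)) \<and>
    (\<forall>F. bounded_cont_fun V rho F \<longrightarrow> (\<lambda>\<omega>. F (Y \<omega>)) \<in> borel_measurable M)"

lemma field_versionD:
  assumes "field_version M A R Y"
  shows "cont_version M V rho Y (\<lambda>v \<omega>. infsum (\<lambda>k. lam v k * R k \<omega>) K)"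
    "bdd_above ((\<lambda>v. \<bar>Y \<omega> v\<bar>) ` V)"
    "p \<in> T \<Longrightarrow> mom_le M p (\<lambda>\<omega>. supn (Y \<omega>)) (tau p * Phi sig)"
    "mom_le M 2 (\<lambda>\<omega>. supn (\<lambda>v. Y \<omega> v - lin (A m) (\<lambda>k. R k \<omega>) v)) (tau 2 * (1/4) ^ m)"
    "bounded_cont_fun V rho F \<Longrightarrow> (\<lambda>\<omega>. F (Y \<omega>)) \<in> borel_measurable M"
  using assms unfolding field_version_def by simp_all

theorem ex_field_version:
  assumes M: "prob_space M" and A: "exhaustion A"
    and R: "\<And>k q. k \<in> K \<Longrightarrow> q \<in> T \<Longrightarrow> mom_le M q (R k) (tau q)"
  shows "\<exists>Y. field_version M A R Y"
proof -
  interpret prob_space M by fact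
  have fin: "finite (A m)" "A m \<subseteq> K" for m using exhaustionD[OF A] by auto
  define x where "x \<omega> k = R k \<omega>" for \<omega> k
  have tau0: "0 < tau q" if "q \<in> T" for q using tau_ge[OF that] by simp
  have Rm: "R k \<in> borel_measurable M" if "k \<in> K" for k using mom_leD(1)[OF R[OF that T2]] .
  have chain: "mom_le M p (\<lambda>\<omega>. supn (lin B (x \<omega>))) (tau p * Phi t)"
    if "finite B" "B \<subseteq> K" "\<And>v. v \<in> V \<Longrightarrow> (\<Sum>k\<in>B. \<bar>lam v k\<bar>) \<le> t" "p \<in> T" for B t p
    unfolding x_def[abs_def] using that R by (intro mom_le_supn_lin M) auto
  \<comment> \<open>Stated for every finite block outside \<open>A m\<close>, so that one estimate
    serves the single increments as well as the remainders \<open>A (n + m) - A m\<close>.\<close>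
  have inc2: "mom_le M 2 (\<lambda>\<omega>. supn (lin B (x \<omega>))) (tau 2 * (1/4) ^ m)" if B: "finite B" "B \<subseteq> K - A m" for B m
  proof -
    from exhaustionD(5)[OF A, of m] obtain t where t: "0 \<le> t" "Phi t \<le> (1/4) ^ m"
      "\<forall>v\<in>V. \<forall>B. finite B \<longrightarrow> B \<subseteq> K - A m \<longrightarrow> (\<Sum>k\<in>B. \<bar>lam v k\<bar>) \<le> t"
      by (elim exE conjE)
    have "mom_le M 2 (\<lambda>\<omega>. supn (lin B (x \<omega>))) (tau 2 * Phi t)" using B t(3) by (intro chain T2) auto
    then show ?thesis by (rule mom_le_weaken) (use t tau0[OF T2] in auto)
  qed
  have sub: "A (n + m) - A m \<subseteq> K - A m" "A (Suc m) - A m \<subseteq> K - A m" for n m using fin by auto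
  have "mom_le M 2 (\<lambda>\<omega>. supn (lin (A m) (x \<omega>))) (tau 2 * Phi sig)" for m
    by (intro chain fin lam_sum T2)
  then have [measurable]: "(\<lambda>\<omega>. supn (lin (A m) (x \<omega>))) \<in> borel_measurable M" for m
    by (rule mom_leD(1))
  have "mom_le M 2 (\<lambda>\<omega>. supn (lin (A (n + m) - A m) (x \<omega>))) (tau 2 * (1/4) ^ m)" for m n
    by (intro inc2 finite_Diff fin sub)
  then have [measurable]: "(\<lambda>\<omega>. supn (lin (A (n + m) - A m) (x \<omega>))) \<in> borel_measurable M" for m n
    by (rule mom_leD(1))
  have incr_mom: "mom_le M 2 (\<lambda>\<omega>. incr A (x \<omega>) m) (tau 2 * (1/4) ^ m)" for m
    unfolding incr_def by (intro inc2 finite_Diff fin sub)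
  then have [measurable]: "(\<lambda>\<omega>. incr A (x \<omega>) m) \<in> borel_measurable M" for m
    by (rule mom_leD(1))
  \<comment> \<open>Summability of the increments is expressed by finiteness of an extended-valued
    series, which makes the event measurable. On its complement \<open>Y\<close> will be 0, so that
    every path is continuous.\<close>
  define good where "good \<omega> \<longleftrightarrow> (\<Sum>m. ennreal (incr A (x \<omega>) m)) < top" for \<omega>
  have good_meas[measurable]: "Measurable.pred M good" unfolding good_def[abs_def] by measurable
  have good: "summable (incr A (x \<omega>))" if "good \<omega>" for \<omega>
    using that incr_nonneg[OF A] by (intro summable_suminf_not_top) (auto simp: good_def)
  have good_AE: "AE \<omega> in M. good \<omega>"
  proof -
    have i1: "(\<integral>\<^sup>+\<omega>. ennreal (incr A (x \<omega>) m) \<partial>M) \<le> ennreal (tau 2 * (1/4) ^ m)" for m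
    proof -
      have "mom_le M 1 (\<lambda>\<omega>. incr A (x \<omega>) m) (tau 2 * (1/4) ^ m)"
        by (rule mom_le_Lyapunov[OF incr_mom]) auto
      from mom_leD(3)[OF this] show ?thesis using incr_nonneg[OF A] tau0[OF T2] by simp
    qed
    have "(\<integral>\<^sup>+\<omega>. (\<Sum>m. ennreal (incr A (x \<omega>) m)) \<partial>M) = (\<Sum>m. \<integral>\<^sup>+\<omega>. ennreal (incr A (x \<omega>) m) \<partial>M)"
      by (rule nn_integral_suminf) auto
    also have "\<dots> \<le> (\<Sum>m. ennreal (tau 2 * (1/4) ^ m))" by (intro suminf_le i1) auto
    also have "\<dots> = ennreal (\<Sum>m. tau 2 * (1/4) ^ m)"
      using tau0[OF T2] by (intro suminf_ennreal2 summable_mult summable_geometric) auto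
    also have "\<dots> < \<infinity>" by simp
    finally have "AE \<omega> in M. (\<Sum>m. ennreal (incr A (x \<omega>) m)) \<noteq> \<infinity>"
      by (intro nn_integral_PInf_AE) auto
    then show ?thesis by (auto simp: good_def top.not_eq_extremum)
  qed
  define Y where "Y \<omega> = (if good \<omega> then limlin A (x \<omega>) else (\<lambda>_. 0))" for \<omega>
  have Y_lim: "(\<lambda>m. if good \<omega> then lin (A m) (x \<omega>) v else 0) \<longlonglongrightarrow> Y \<omega> v" for \<omega> v
    using limlin(1)[OF A good] by (auto simp: Y_def)
  have lin_meas: "(\<lambda>\<omega>. lin (A m) (x \<omega>) v) \<in> borel_measurable M" for m v
    unfolding lin_def x_def using Rm fin
    by (cases "v \<in> V") (auto intro!: borel_measurable_sum borel_measurable_times)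
  have Y_meas: "(\<lambda>\<omega>. Y \<omega> v) \<in> borel_measurable M" for v
    by (rule borel_measurable_LIMSEQ_real[OF Y_lim]) (intro measurable_If lin_meas, auto)
  have cv: "cont_version M V rho Y (\<lambda>v \<omega>. infsum (\<lambda>k. lam v k * R k \<omega>) K)"
    unfolding cont_version_def
  proof (intro conjI ballI)
    show "Y \<omega> \<in> CV V rho" for \<omega> using limlin(4)[OF A good] zero_CV by (auto simp: Y_def)
    show "(\<lambda>\<omega>. Y \<omega> v) \<in> borel_measurable M" for v by (rule Y_meas)
    fix v assume v: "v \<in> V"
    have "AE \<omega> in M. (\<lambda>k. lam v k * R k \<omega>) summable_on K"
      using R T2 tau0[OF T2] by (intro AE_summable_on[OF M A v, of "tau 2"]) auto
    then show "AE \<omega> in M. Y \<omega> v = infsum (\<lambda>k. lam v k * R k \<omega>) K"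
      using good_AE
    proof eventually_elim
      fix \<omega> assume s: "(\<lambda>k. lam v k * R k \<omega>) summable_on K" and g: "good \<omega>"
      have "(\<lambda>m. lin (A m) (x \<omega>) v) \<longlonglongrightarrow> infsum (\<lambda>k. lam v k * R k \<omega>) K"
        using exhaustion_infsum[OF A s] v by (simp add: lin_def x_def)
      then show "Y \<omega> v = infsum (\<lambda>k. lam v k * R k \<omega>) K"
        using limlin(1)[OF A good[OF g], of v] g LIMSEQ_unique by (auto simp: Y_def)
    qed
  qed
  have b1: "bdd_above ((\<lambda>v. \<bar>Y \<omega> v\<bar>) ` V)" for \<omega>
    using supn_lin_tendsto(3)[OF A good] by (auto simp: Y_def)
  have lim1: "(\<lambda>n. if good \<omega> then supn (lin (A n) (x \<omega>)) else 0) \<longlonglongrightarrow> supn (Y \<omega>)" for \<omega>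
    using supn_lin_tendsto(2)[OF A good] V_ne by (auto simp: Y_def supn_def)
  \<comment> \<open>Off the good event \<open>Y \<omega>\<close> is 0 and the difference has the sup
    norm of \<open>lin (A m) (x \<omega>)\<close>; hence the else branch.\<close>
  have lim2: "(\<lambda>n. if good \<omega> then supn (lin (A (n + m) - A m) (x \<omega>)) else supn (lin (A m) (x \<omega>)))
      \<longlonglongrightarrow> supn (\<lambda>v. Y \<omega> v - lin (A m) (x \<omega>) v)" for \<omega> m
    using supn_lin_tendsto(1)[OF A good] by (auto simp: Y_def supn_def)
  have m1: "mom_le M p (\<lambda>\<omega>. supn (Y \<omega>)) (tau p * Phi sig)" if "p \<in> T" for p
  proof (rule mom_le_limit[where X = "\<lambda>n \<omega>. supn (lin (A n) (x \<omega>))" and c = "\<lambda>_. tau p * Phi sig"])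
    show "mom_le M p (\<lambda>\<omega>. supn (lin (A n) (x \<omega>))) (tau p * Phi sig)" for n
      by (intro chain fin lam_sum that)
    show "(\<lambda>\<omega>. supn (Y \<omega>)) \<in> borel_measurable M"
      by (rule borel_measurable_LIMSEQ_real[OF lim1]) measurable
    show "AE \<omega> in M. (\<lambda>n. supn (lin (A n) (x \<omega>))) \<longlonglongrightarrow> supn (Y \<omega>)"
      using good_AE
    proof eventually_elim
      fix \<omega> assume "good \<omega>"
      then show "(\<lambda>n. supn (lin (A n) (x \<omega>))) \<longlonglongrightarrow> supn (Y \<omega>)"
        using lim1[of \<omega>] by simp
    qed
  qed (use T_ge that in force)+
  have m2: "mom_le M 2 (\<lambda>\<omega>. supn (\<lambda>v. Y \<omega> v - lin (A m) (x \<omega>) v)) (tau 2 * (1/4) ^ m)" for m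
  proof (rule mom_le_limit[where X = "\<lambda>n \<omega>. supn (lin (A (n + m) - A m) (x \<omega>))" and c = "\<lambda>_. tau 2 * (1/4) ^ m"])
    show "mom_le M 2 (\<lambda>\<omega>. supn (lin (A (n + m) - A m) (x \<omega>))) (tau 2 * (1/4) ^ m)" for n
      by (intro inc2 finite_Diff fin sub)
    show "(\<lambda>\<omega>. supn (\<lambda>v. Y \<omega> v - lin (A m) (x \<omega>) v)) \<in> borel_measurable M"
      by (rule borel_measurable_LIMSEQ_real[OF lim2]) measurable
    show "AE \<omega> in M. (\<lambda>n. supn (lin (A (n + m) - A m) (x \<omega>))) \<longlonglongrightarrow> supn (\<lambda>v. Y \<omega> v - lin (A m) (x \<omega>) v)"
      using good_AE
    proof eventually_elim
      fix \<omega> assume "good \<omega>"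
      then show "(\<lambda>n. supn (lin (A (n + m) - A m) (x \<omega>))) \<longlonglongrightarrow> supn (\<lambda>v. Y \<omega> v - lin (A m) (x \<omega>) v)"
        using lim2[of \<omega> m] by simp
    qed
  qed auto
  \<comment> \<open>On the good event the partial sums converge in sup norm, so continuity of
    \<open>F\<close> makes \<open>F (Y \<omega>)\<close> a pointwise limit of measurable
    functions.\<close>
  have FY: "(\<lambda>\<omega>. F (Y \<omega>)) \<in> borel_measurable M" if F: "bounded_cont_fun V rho F" for F
  proof (rule borel_measurable_LIMSEQ_real)
    show "(\<lambda>m. if good \<omega> then F (lin (A m) (x \<omega>)) else F (\<lambda>_. 0)) \<longlonglongrightarrow> F (Y \<omega>)" for \<omega>
    proof (cases "good \<omega>")
      case True
      note L = limlin[OF A good[OF True]]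
      have "(\<lambda>m. F (lin (A m) (x \<omega>))) \<longlonglongrightarrow> F (limlin A (x \<omega>))"
      proof (rule tendstoI)
        fix e :: real assume "0 < e"
        from bounded_cont_funD[OF F L(4) this] obtain \<delta> where \<delta>: "0 < \<delta>"
          "\<And>h'. h' \<in> CV V rho \<Longrightarrow> (SUP v\<in>V. \<bar>h' v - limlin A (x \<omega>) v\<bar>) < \<delta> \<Longrightarrow> \<bar>F h' - F (limlin A (x \<omega>))\<bar> < e"
          by blast
        have "\<forall>\<^sub>F m in sequentially. (\<Sum>i. incr A (x \<omega>) (i + m)) < \<delta>"
          using L(3) \<delta>(1) by (rule order_tendstoD)
        then show "\<forall>\<^sub>F m in sequentially. dist (F (lin (A m) (x \<omega>))) (F (limlin A (x \<omega>))) < e"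
        proof eventually_elim
          fix m assume m: "(\<Sum>i. incr A (x \<omega>) (i + m)) < \<delta>"
          have "(SUP v\<in>V. \<bar>lin (A m) (x \<omega>) v - limlin A (x \<omega>) v\<bar>) \<le> (\<Sum>i. incr A (x \<omega>) (i + m))"
            by (intro cSUP_least V_ne L(2))
          then show "dist (F (lin (A m) (x \<omega>))) (F (limlin A (x \<omega>))) < e"
            using \<delta>(2)[OF lin_CV[OF fin]] m by (simp add: dist_real_def)
        qed
      qed
      then show ?thesis using True by (simp add: Y_def)
    qed (simp add: Y_def)
    show "(\<lambda>\<omega>. if good \<omega> then F (lin (A m) (x \<omega>)) else F (\<lambda>_. 0)) \<in> borel_measurable M" for m
    proof (intro measurable_If)
      show "(\<lambda>\<omega>. F (lin (A m) (x \<omega>))) \<in> borel_measurable M"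
        unfolding x_def[abs_def] using fin Rm by (intro measurable_comp_lin[OF F]) auto
    qed auto
  qed
  show ?thesis
    unfolding field_version_def using cv b1 m1 m2 FY by (intro exI[of _ Y]) (auto simp: x_def[abs_def])
qed

end

section \<open>Weak convergence from characteristic functions\<close>

text \<open>Trigonometric polynomials in the coordinates from \<open>I\<close>. The phase
  \<open>\<theta>\<close> takes the place of a separate sine, and closure under products is the
  formula turning a product of cosines into a sum.\<close>

inductive_set trig :: "'i set \<Rightarrow> (('i \<Rightarrow> real) \<Rightarrow> real) set" for I :: "'i set" where
  cos: "(\<lambda>x. c * cos ((\<Sum>i\<in>I. t i * x i) + \<theta>)) \<in> trig I"
| add: "f \<in> trig I \<Longrightarrow> g \<in> trig I \<Longrightarrow> (\<lambda>x. f x + g x) \<in> trig I"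

lemma trig_const: "(\<lambda>_. c) \<in> trig I"
  using trig.cos[of c "\<lambda>_. 0" I 0] by simp

lemma trig_mult:
  assumes "f \<in> trig I" "g \<in> trig I"
  shows "(\<lambda>x. f x * g x) \<in> trig I"
  using assms
proof (induction rule: trig.induct)
  case f: (cos c t \<theta>)
  from f show ?case
  proof (induction rule: trig.induct)
    case (cos d u \<eta>)
    have "(\<lambda>x. c * cos ((\<Sum>i\<in>I. t i * x i) + \<theta>) * (d * cos ((\<Sum>i\<in>I. u i * x i) + \<eta>))) =
      (\<lambda>x. c * d / 2 * cos ((\<Sum>i\<in>I. (t i - u i) * x i) + (\<theta> - \<eta>)) + c * d / 2 * cos ((\<Sum>i\<in>I. (t i + u i) * x i) + (\<theta> + \<eta>)))"
    proof
      fix x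
      define a where "a = (\<Sum>i\<in>I. t i * x i) + \<theta>"
      define b where "b = (\<Sum>i\<in>I. u i * x i) + \<eta>"
      have 1: "(\<Sum>i\<in>I. (t i - u i) * x i) + (\<theta> - \<eta>) = a - b" "(\<Sum>i\<in>I. (t i + u i) * x i) + (\<theta> + \<eta>) = a + b"
        by (simp_all add: a_def b_def algebra_simps sum_subtractf sum.distrib)
      show "c * cos ((\<Sum>i\<in>I. t i * x i) + \<theta>) * (d * cos ((\<Sum>i\<in>I. u i * x i) + \<eta>)) =
        c * d / 2 * cos ((\<Sum>i\<in>I. (t i - u i) * x i) + (\<theta> - \<eta>)) + c * d / 2 * cos ((\<Sum>i\<in>I. (t i + u i) * x i) + (\<theta> + \<eta>))"
        unfolding 1 unfolding a_def[symmetric] b_def[symmetric] by (simp add: cos_add cos_diff algebra_simps)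
    qed
    then show ?case by (simp only:) (intro trig.add trig.cos)
  next
    case (add g h)
    then show ?case by (simp add: distrib_left trig.add)
  qed
next
  case (add f h)
  then show ?case by (simp add: distrib_right trig.add)
qed

lemma trig_continuous: "f \<in> trig I \<Longrightarrow> continuous_on UNIV f"
proof (induction rule: trig.induct)
  case (cos c t \<theta>)
  have 1: "continuous_on UNIV (\<lambda>x. (\<Sum>i\<in>I. t i * x i) + \<theta>)"
    by (intro continuous_intros continuous_on_product_coordinates)
  have "continuous_on UNIV (\<lambda>y::real. c * cos y)" by (intro continuous_intros)
  from continuous_on_compose2[OF this 1 subset_UNIV] show ?case .
next
  case (add f g)
  then show ?case by (intro continuous_on_add)
qed

lemma trig_bounded: "f \<in> trig I \<Longrightarrow> \<exists>B. \<forall>x. \<bar>f x\<bar> \<le> B"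
proof (induction rule: trig.induct)
  case (cos c t \<theta>)
  have "\<bar>c * cos r\<bar> \<le> \<bar>c\<bar>" for r by (simp add: abs_mult mult_left_le)
  then show ?case by blast
next
  case (add f g)
  then obtain B C where "\<And>x. \<bar>f x\<bar> \<le> B" "\<And>x. \<bar>g x\<bar> \<le> C" by auto
  then have "\<bar>f x + g x\<bar> \<le> B + C" for x by (meson abs_triangle_ineq add_mono order_trans)
  then show ?case by blast
qed

lemma trig_real_polynomial:
  assumes "real_polynomial_function p" "f \<in> trig I"
  shows "(\<lambda>x. p (f x)) \<in> trig I"
  using assms
proof (induction rule: real_polynomial_function.induct)
  case (linear p)
  then obtain c where "p = (\<lambda>x. x * c)" using real_bounded_linear by blast
  then show ?case using linear trig_mult[OF linear(2) trig_const[of c]] by simp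
qed (auto intro: trig_const trig.add trig_mult)

text \<open>Coordinates outside \<open>I\<close> are pinned to 0: the box is then compact in the
  product topology and its points are separated by the coordinates in \<open>I\<close>.\<close>

definition coord_box :: "'i set \<Rightarrow> real \<Rightarrow> ('i \<Rightarrow> real) set" where
  "coord_box I r = {x. (\<forall>i\<in>I. \<bar>x i\<bar> \<le> r) \<and> (\<forall>i. i \<notin> I \<longrightarrow> x i = 0)}"

lemma compact_coord_box: "compact (coord_box I r)"
proof -
  have "coord_box I r = (\<Pi>\<^sub>E i\<in>UNIV. if i \<in> I then {-r..r} else {0})"
    by (auto simp: coord_box_def PiE_iff abs_le_iff split: if_splits) (metis abs_le_iff minus_le_iff)+
  moreover have "compactin (product_topology (\<lambda>_. euclidean) UNIV) (\<Pi>\<^sub>E i\<in>UNIV. if i \<in> I then {-r..r} else {0::real})"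
    by (auto simp: compactin_PiE)
  ultimately show ?thesis
    by (simp add: euclidean_product_topology)
qed

text \<open>Stone--Weierstrass gives no control off the box, so the approximant is composed with a
  polynomial close to the truncation at level \<open>B\<close>.\<close>

lemma trig_approx:
  fixes \<phi> :: "('i::countable \<Rightarrow> real) \<Rightarrow> real"
  assumes I: "finite I" and \<phi>: "continuous_on UNIV \<phi>" and B: "\<And>x. \<bar>\<phi> x\<bar> \<le> B" and e: "0 < e"
  shows "\<exists>h\<in>trig I. (\<forall>x\<in>coord_box I r. \<bar>\<phi> x - h x\<bar> \<le> 2 * e) \<and> (\<forall>x. \<bar>h x\<bar> \<le> B + e)"
proof -
  interpret function_ring_on "trig I" "coord_box I r"
  proof
    show "compact (coord_box I r)" by (rule compact_coord_box)
    show "f \<in> trig I \<Longrightarrow> continuous_on (coord_box I r) f" for f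
      using trig_continuous continuous_on_subset by blast
    fix x y assume xy: "x \<in> coord_box I r" "y \<in> coord_box I r" "x \<noteq> y"
    then obtain i where i: "i \<in> I" "x i \<noteq> y i" unfolding coord_box_def by (auto simp: fun_eq_iff) metis
    \<comment> \<open>At this frequency the shifted cosine takes the values -1 at \<open>x\<close>
      and 1 at \<open>y\<close>.\<close>
    define c where "c = pi / (x i - y i)"
    define f where "f z = 1 * cos ((\<Sum>j\<in>I. (if j = i then c else 0) * z j) + (- c * y i))" for z
    have "f \<in> trig I" unfolding f_def[abs_def] by (rule trig.cos)
    have f: "f z = cos (c * (z i - y i))" for z
    proof -
      have "(\<Sum>j\<in>I. (if j = i then c else 0) * z j) = (\<Sum>j\<in>I. if j = i then c * z j else 0)"
        by (intro sum.cong) auto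
      also have "\<dots> = c * z i" using I i by (simp add: sum.delta)
      finally show ?thesis by (simp add: f_def algebra_simps)
    qed
    have "f x = -1" "f y = 1" using i by (simp_all add: f c_def)
    then show "\<exists>f\<in>trig I. f x \<noteq> f y" using \<open>f \<in> trig I\<close> by (intro bexI[of _ f]) auto
  qed (auto intro: trig.add trig_mult trig_const)
  have B0: "0 \<le> B" using B[of "\<lambda>_. 0"] by linarith
  obtain g where g: "g \<in> trig I" "\<And>x. x \<in> coord_box I r \<Longrightarrow> \<bar>\<phi> x - g x\<bar> < e"
    using Stone_Weierstrass_basic[OF continuous_on_subset[OF \<phi>] e] by blast
  obtain C where C: "\<And>x. \<bar>g x\<bar> \<le> C" using trig_bounded[OF g(1)] by blast
  define \<psi> where "\<psi> y = max (- B) (min B y)" for y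
  have "continuous_on {-C..C} \<psi>" unfolding \<psi>_def by (intro continuous_intros)
  from Stone_Weierstrass_real_polynomial_function[OF compact_Icc this e]
  obtain p where p: "real_polynomial_function p" "\<And>y. y \<in> {-C..C} \<Longrightarrow> \<bar>\<psi> y - p y\<bar> < e" by blast
  have pg: "\<bar>\<psi> (g x) - p (g x)\<bar> < e" for x
    using C[of x] by (intro p) (auto simp: abs_le_iff)
  show ?thesis
  proof (intro bexI conjI ballI allI)
    show "(\<lambda>x. p (g x)) \<in> trig I" by (rule trig_real_polynomial[OF p(1) g(1)])
    show "\<bar>p (g x)\<bar> \<le> B + e" for x
    proof -
      have "\<bar>\<psi> (g x)\<bar> \<le> B" using B0 by (auto simp: \<psi>_def)
      then show ?thesis using pg[of x] by linarith
    qed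
    fix x assume x: "x \<in> coord_box I r"
    have "\<bar>\<psi> (g x) - \<phi> x\<bar> \<le> \<bar>g x - \<phi> x\<bar>" using B[of x] by (auto simp: \<psi>_def)
    then show "\<bar>\<phi> x - p (g x)\<bar> \<le> 2 * e" using pg[of x] g(2)[OF x] by linarith
  qed
qed

definition restrict0 :: "'i set \<Rightarrow> ('i \<Rightarrow> real) \<Rightarrow> 'i \<Rightarrow> real" where
  "restrict0 I x i = (if i \<in> I then x i else 0)"

text \<open>On the box the integrands differ by at most 2 e. Off the box some |X i| exceeds r, so
  the sum of the squares divided by r^2 is at least 1 and may multiply the crude bound 2 B + e.
  Taking expectations is then Chebyshev's inequality.\<close>

lemma (in prob_space) trig_approx_expectation:
  fixes X :: "'i::countable \<Rightarrow> 'a \<Rightarrow> real" and \<phi> :: "('i \<Rightarrow> real) \<Rightarrow> real" and B c e r :: real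
  assumes I: "finite I" and X: "\<And>i. i \<in> I \<Longrightarrow> mom_le M 2 (X i) c" and r: "0 < r"
    and \<phi>: "continuous_on UNIV \<phi>" "\<And>x. \<bar>\<phi> x\<bar> \<le> B"
    and h: "h \<in> trig I" "\<And>x. x \<in> coord_box I r \<Longrightarrow> \<bar>\<phi> x - h x\<bar> \<le> 2 * e" "\<And>x. \<bar>h x\<bar> \<le> B + e"
    and e: "0 \<le> e"
  shows "\<bar>expectation (\<lambda>\<omega>. \<phi> (restrict0 I (\<lambda>i. X i \<omega>))) - expectation (\<lambda>\<omega>. h (restrict0 I (\<lambda>i. X i \<omega>)))\<bar>
    \<le> 2 * e + (2 * B + e) * (card I * c\<^sup>2 / r\<^sup>2)"
proof -
  define x where "x \<omega> = restrict0 I (\<lambda>i. X i \<omega>)" for \<omega>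
  have Xm: "X i \<in> borel_measurable M" if "i \<in> I" for i using mom_leD(1)[OF X[OF that]] .
  have xm: "x \<in> borel_measurable M"
  proof (rule measurable_coordinatewise_then_product)
    show "(\<lambda>\<omega>. x \<omega> i) \<in> borel_measurable M" for i
      using Xm by (cases "i \<in> I") (auto simp: x_def restrict0_def)
  qed
  have \<phi>m: "(\<lambda>\<omega>. \<phi> (x \<omega>)) \<in> borel_measurable M"
    by (rule measurable_compose[OF xm borel_measurable_continuous_onI[OF \<phi>(1)]])
  have hm: "(\<lambda>\<omega>. h (x \<omega>)) \<in> borel_measurable M"
    by (rule measurable_compose[OF xm borel_measurable_continuous_onI[OF trig_continuous[OF h(1)]]])
  have \<phi>i: "integrable M (\<lambda>\<omega>. \<phi> (x \<omega>))" using \<phi>(2) \<phi>m by (intro integrable_const_bound[of _ B]) auto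
  have hi: "integrable M (\<lambda>\<omega>. h (x \<omega>))" using h(3) hm by (intro integrable_const_bound[of _ "B + e"]) auto
  have X2: "integrable M (\<lambda>\<omega>. (X i \<omega>)\<^sup>2)" "expectation (\<lambda>\<omega>. (X i \<omega>)\<^sup>2) \<le> c\<^sup>2" if "i \<in> I" for i
    using mom_le_integrable[OF X[OF that]] mom_le_integral[OF X[OF that]] mom_leD(2)[OF X[OF that]]
    by simp_all
  have B0: "0 \<le> B" using \<phi>(2)[of "\<lambda>_. 0"] by linarith
  have pw: "\<bar>\<phi> (x \<omega>) - h (x \<omega>)\<bar> \<le> 2 * e + (2 * B + e) * ((\<Sum>i\<in>I. (X i \<omega>)\<^sup>2) / r\<^sup>2)" for \<omega>
  proof (cases "x \<omega> \<in> coord_box I r")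
    case True
    have "0 \<le> (2 * B + e) * ((\<Sum>i\<in>I. (X i \<omega>)\<^sup>2) / r\<^sup>2)"
      using B0 e by (intro mult_nonneg_nonneg divide_nonneg_nonneg sum_nonneg) auto
    then show ?thesis using h(2)[OF True] by linarith
  next
    case False
    then obtain i where i: "i \<in> I" "r < \<bar>X i \<omega>\<bar>" by (auto simp: coord_box_def x_def restrict0_def not_le)
    have "r\<^sup>2 \<le> (X i \<omega>)\<^sup>2" using i r by (metis abs_le_square_iff abs_of_pos less_imp_le)
    also have "\<dots> \<le> (\<Sum>i\<in>I. (X i \<omega>)\<^sup>2)" using I i by (intro member_le_sum) auto
    finally have "1 \<le> (\<Sum>i\<in>I. (X i \<omega>)\<^sup>2) / r\<^sup>2" using r by (simp add: field_simps)
    then have "(2 * B + e) * 1 \<le> (2 * B + e) * ((\<Sum>i\<in>I. (X i \<omega>)\<^sup>2) / r\<^sup>2)"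
      using B0 e by (intro mult_left_mono) auto
    moreover have "\<bar>\<phi> (x \<omega>) - h (x \<omega>)\<bar> \<le> 2 * B + e" using \<phi>(2)[of "x \<omega>"] h(3)[of "x \<omega>"] by linarith
    ultimately have "\<bar>\<phi> (x \<omega>) - h (x \<omega>)\<bar> \<le> (2 * B + e) * ((\<Sum>i\<in>I. (X i \<omega>)\<^sup>2) / r\<^sup>2)"
      by (simp only: mult_1_right)
    then show ?thesis by (rule order_trans) (use e in simp)
  qed
  have "\<bar>expectation (\<lambda>\<omega>. \<phi> (x \<omega>)) - expectation (\<lambda>\<omega>. h (x \<omega>))\<bar> = \<bar>expectation (\<lambda>\<omega>. \<phi> (x \<omega>) - h (x \<omega>))\<bar>"
    using \<phi>i hi by simp
  also have "\<dots> \<le> expectation (\<lambda>\<omega>. \<bar>\<phi> (x \<omega>) - h (x \<omega>)\<bar>)" by (rule integral_abs_bound)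
  also have "\<dots> \<le> expectation (\<lambda>\<omega>. 2 * e + (2 * B + e) * ((\<Sum>i\<in>I. (X i \<omega>)\<^sup>2) / r\<^sup>2))"
    using X2 \<phi>i hi pw by (intro integral_mono integrable_abs Bochner_Integration.integrable_diff Bochner_Integration.integrable_add integrable_mult_right integrable_divide Bochner_Integration.integrable_sum) auto
  also have "\<dots> = 2 * e + (2 * B + e) * ((\<Sum>i\<in>I. expectation (\<lambda>\<omega>. (X i \<omega>)\<^sup>2)) / r\<^sup>2)"
    using X2 by (subst Bochner_Integration.integral_add) (auto simp: prob_space)
  also have "\<dots> \<le> 2 * e + (2 * B + e) * ((\<Sum>i\<in>I. c\<^sup>2) / r\<^sup>2)"
    using X2 B0 e by (intro add_left_mono mult_left_mono divide_right_mono sum_mono) auto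
  finally show ?thesis by (simp add: x_def)
qed

lemma trig_expectation_tendsto:
  fixes X :: "'n \<Rightarrow> 'i::countable \<Rightarrow> 'w \<Rightarrow> real" and Z :: "'i \<Rightarrow> 'u \<Rightarrow> real"
  assumes P: "prob_space P" and N: "prob_space N"
    and X: "\<And>n i. i \<in> I \<Longrightarrow> X n i \<in> borel_measurable P" and Z: "\<And>i. i \<in> I \<Longrightarrow> Z i \<in> borel_measurable N"
    and conv: "\<And>t \<theta>. ((\<lambda>n. \<integral>\<omega>. cos ((\<Sum>i\<in>I. t i * X n i \<omega>) + \<theta>) \<partial>P) \<longlongrightarrow> (\<integral>\<omega>. cos ((\<Sum>i\<in>I. t i * Z i \<omega>) + \<theta>) \<partial>N)) F"
    and h: "h \<in> trig I"
  shows "((\<lambda>n. \<integral>\<omega>. h (restrict0 I (\<lambda>i. X n i \<omega>)) \<partial>P) \<longlongrightarrow> (\<integral>\<omega>. h (restrict0 I (\<lambda>i. Z i \<omega>)) \<partial>N)) F"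
  using h
proof (induction rule: trig.induct)
  case (cos c t \<theta>)
  have "(\<Sum>i\<in>I. t i * restrict0 I x i) = (\<Sum>i\<in>I. t i * x i)" for x
    by (intro sum.cong) (auto simp: restrict0_def)
  then show ?case using conv[of t \<theta>] by (auto intro!: tendsto_intros)
next
  case (add f g)
  have int: "integrable Q (\<lambda>\<omega>. f (restrict0 I (\<lambda>i. Y i \<omega>)))"
    if f: "f \<in> trig I" and Q: "prob_space Q" and Y: "\<And>i. i \<in> I \<Longrightarrow> Y i \<in> borel_measurable Q" for f and Q :: "'q measure" and Y
  proof -
    interpret prob_space Q by fact
    obtain B where B: "\<And>x. \<bar>f x\<bar> \<le> B" using trig_bounded[OF f] by blast
    have "(\<lambda>\<omega>. restrict0 I (\<lambda>i. Y i \<omega>)) \<in> borel_measurable Q"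
    proof (rule measurable_coordinatewise_then_product)
      show "(\<lambda>\<omega>. restrict0 I (\<lambda>i. Y i \<omega>) i) \<in> borel_measurable Q" for i
        using Y by (cases "i \<in> I") (auto simp: restrict0_def)
    qed
    from measurable_compose[OF this borel_measurable_continuous_onI[OF trig_continuous[OF f]]]
    show ?thesis using B by (intro integrable_const_bound[of _ B]) auto
  qed
  have "integrable P (\<lambda>\<omega>. f (restrict0 I (\<lambda>i. X n i \<omega>)))" "integrable P (\<lambda>\<omega>. g (restrict0 I (\<lambda>i. X n i \<omega>)))" for n
    using int[OF add(1) P X] int[OF add(2) P X] by auto
  moreover have "integrable N (\<lambda>\<omega>. f (restrict0 I (\<lambda>i. Z i \<omega>)))" "integrable N (\<lambda>\<omega>. g (restrict0 I (\<lambda>i. Z i \<omega>)))"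
    using int[OF add(1) N Z] int[OF add(2) N Z] by auto
  ultimately show ?case using add by (auto intro!: tendsto_add)
qed

text \<open>A multivariate continuity theorem along an arbitrary filter. Tightness comes from the
  common second moment bound \<open>c\<close>, and trigonometric polynomials inherit the assumed
  convergence by linearity.\<close>

lemma expectation_tendsto_of_cos:
  fixes X :: "'n \<Rightarrow> 'i::countable \<Rightarrow> 'w \<Rightarrow> real" and Z :: "'i \<Rightarrow> 'u \<Rightarrow> real" and \<phi> :: "('i \<Rightarrow> real) \<Rightarrow> real" and B c :: real
  assumes P: "prob_space P" and N: "prob_space N" and I: "finite I"
    and X: "\<And>n i. i \<in> I \<Longrightarrow> mom_le P 2 (X n i) c" and Z: "\<And>i. i \<in> I \<Longrightarrow> mom_le N 2 (Z i) c"
    and conv: "\<And>t \<theta>. ((\<lambda>n. \<integral>\<omega>. cos ((\<Sum>i\<in>I. t i * X n i \<omega>) + \<theta>) \<partial>P) \<longlongrightarrow> (\<integral>\<omega>. cos ((\<Sum>i\<in>I. t i * Z i \<omega>) + \<theta>) \<partial>N)) F"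
    and \<phi>: "continuous_on UNIV \<phi>" "\<And>x. \<bar>\<phi> x\<bar> \<le> B"
  shows "((\<lambda>n. \<integral>\<omega>. \<phi> (restrict0 I (\<lambda>i. X n i \<omega>)) \<partial>P) \<longlongrightarrow> (\<integral>\<omega>. \<phi> (restrict0 I (\<lambda>i. Z i \<omega>)) \<partial>N)) F"
proof (rule tendstoI)
  fix e :: real assume e: "0 < e"
  \<comment> \<open>With this choice the approximation costs at most 2 \<eta> + e/16 = 3 e/16, below
    e/4. The radius \<open>r\<close> can be fixed before \<open>h\<close>, since the bound on
    \<open>h\<close> off the box does not depend on \<open>r\<close>; the added 1 keeps
    \<open>r\<close> positive.\<close>
  define \<eta> where "\<eta> = e / 16"
  have B0: "0 \<le> B" using \<phi>(2)[of "\<lambda>_. 0"] by linarith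
  define C where "C = (2 * B + \<eta>) * (card I * c\<^sup>2)"
  have C0: "0 \<le> C" using B0 e by (auto simp: C_def \<eta>_def)
  define r where "r = sqrt (C * 16 / e + 1)"
  have r0: "0 < r" using C0 e by (auto simp: r_def intro!: add_nonneg_pos)
  have r: "C / r\<^sup>2 \<le> e / 16"
  proof -
    have "r\<^sup>2 = C * 16 / e + 1" using C0 e by (simp add: r_def)
    then have "C \<le> e / 16 * r\<^sup>2" using e by (simp add: field_simps)
    then show ?thesis using r0 by (simp add: divide_le_eq)
  qed
  obtain h where h: "h \<in> trig I" "\<And>x. x \<in> coord_box I r \<Longrightarrow> \<bar>\<phi> x - h x\<bar> \<le> 2 * \<eta>" "\<And>x. \<bar>h x\<bar> \<le> B + \<eta>"
    using trig_approx[OF I \<phi>, of \<eta> r] e by (auto simp: \<eta>_def)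
  have le: "2 * \<eta> + (2 * B + \<eta>) * (card I * c\<^sup>2 / r\<^sup>2) \<le> e / 4"
    using r e by (simp add: \<eta>_def C_def)
  have XP: "\<bar>(\<integral>\<omega>. \<phi> (restrict0 I (\<lambda>i. X n i \<omega>)) \<partial>P) - (\<integral>\<omega>. h (restrict0 I (\<lambda>i. X n i \<omega>)) \<partial>P)\<bar> \<le> e / 4" for n
    by (rule order_trans[OF prob_space.trig_approx_expectation[OF P I _ r0 \<phi> h] le])
       (use X e in \<open>auto simp: \<eta>_def\<close>)
  have ZN: "\<bar>(\<integral>\<omega>. \<phi> (restrict0 I (\<lambda>i. Z i \<omega>)) \<partial>N) - (\<integral>\<omega>. h (restrict0 I (\<lambda>i. Z i \<omega>)) \<partial>N)\<bar> \<le> e / 4"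
    by (rule order_trans[OF prob_space.trig_approx_expectation[OF N I _ r0 \<phi> h] le])
       (use Z e in \<open>auto simp: \<eta>_def\<close>)
  have "((\<lambda>n. \<integral>\<omega>. h (restrict0 I (\<lambda>i. X n i \<omega>)) \<partial>P) \<longlongrightarrow> (\<integral>\<omega>. h (restrict0 I (\<lambda>i. Z i \<omega>)) \<partial>N)) F"
    by (intro trig_expectation_tendsto[OF P N _ _ conv h(1)] mom_leD(1)[OF X] mom_leD(1)[OF Z])
  then have "\<forall>\<^sub>F n in F. dist (\<integral>\<omega>. h (restrict0 I (\<lambda>i. X n i \<omega>)) \<partial>P) (\<integral>\<omega>. h (restrict0 I (\<lambda>i. Z i \<omega>)) \<partial>N) < e / 4"
    using e by (intro tendstoD) auto
  then show "\<forall>\<^sub>F n in F. dist (\<integral>\<omega>. \<phi> (restrict0 I (\<lambda>i. X n i \<omega>)) \<partial>P) (\<integral>\<omega>. \<phi> (restrict0 I (\<lambda>i. Z i \<omega>)) \<partial>N) < e"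
  proof eventually_elim
    case (elim n)
    then show ?case using XP[of n] ZN e unfolding dist_real_def by linarith
  qed
qed

section \<open>Reduction to Lipschitz functionals\<close>

context entropy_net
begin

lemma bounded_cont_fun_supn:
  "bounded_cont_fun V rho F \<longleftrightarrow> (\<exists>B. \<forall>h\<in>CV V rho. \<bar>F h\<bar> \<le> B) \<and>
    (\<forall>h\<in>CV V rho. \<forall>e>0. \<exists>\<delta>>0. \<forall>h'\<in>CV V rho. supn (\<lambda>v. h' v - h v) < \<delta> \<longrightarrow> \<bar>F h' - F h\<bar> < e)"
  unfolding bounded_cont_fun_def supn_def ..

lemma supn_minus_commute: "supn (\<lambda>v. h v - h' v) = supn (\<lambda>v. h' v - h v)"
  unfolding supn_def by (simp add: abs_minus_commute)

lemma supn_zero: "supn (\<lambda>v. h v - h v) = 0"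
  unfolding supn_def using V_ne by simp

text \<open>For a Lipschitz functional, truncation at level \<open>m\<close> costs at most
  \<open>L * c m\<close>, uniformly in \<open>n\<close>. So \<open>m\<close> can be fixed first and
  the convergence of the truncated fields used afterwards.\<close>

lemma Lipschitz_expectation_tendsto:
  assumes P: "prob_space P" and N: "prob_space N"
    and YC: "\<And>n \<omega>. \<omega> \<in> space P \<Longrightarrow> Y n \<omega> \<in> CV V rho" and ZC: "\<And>\<omega>. \<omega> \<in> space N \<Longrightarrow> Z \<omega> \<in> CV V rho"
    and YA: "\<And>n m \<omega>. \<omega> \<in> space P \<Longrightarrow> YA n m \<omega> \<in> CV V rho" and ZA: "\<And>m \<omega>. \<omega> \<in> space N \<Longrightarrow> ZA m \<omega> \<in> CV V rho"
    and Ymom: "\<And>n m. mom_le P 1 (\<lambda>\<omega>. supn (\<lambda>v. Y n \<omega> v - YA n m \<omega> v)) (c m)"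
    and Zmom: "\<And>m. mom_le N 1 (\<lambda>\<omega>. supn (\<lambda>v. Z \<omega> v - ZA m \<omega> v)) (c m)"
    and c: "c \<longlonglongrightarrow> 0"
    and FYm: "\<And>n. (\<lambda>\<omega>. F (Y n \<omega>)) \<in> borel_measurable P" and FZm: "(\<lambda>\<omega>. F (Z \<omega>)) \<in> borel_measurable N"
    and FYAm: "\<And>n m. (\<lambda>\<omega>. F (YA n m \<omega>)) \<in> borel_measurable P" and FZAm: "\<And>m. (\<lambda>\<omega>. F (ZA m \<omega>)) \<in> borel_measurable N"
    and conv: "\<And>m. ((\<lambda>n. \<integral>\<omega>. F (YA n m \<omega>) \<partial>P) \<longlongrightarrow> (\<integral>\<omega>. F (ZA m \<omega>) \<partial>N)) Fl"
    and B: "\<And>h. h \<in> CV V rho \<Longrightarrow> \<bar>F h\<bar> \<le> B"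
    and L: "\<And>h h'. h \<in> CV V rho \<Longrightarrow> h' \<in> CV V rho \<Longrightarrow> \<bar>F h - F h'\<bar> \<le> L * supn (\<lambda>v. h v - h' v)" "0 \<le> L"
  shows "((\<lambda>n. \<integral>\<omega>. F (Y n \<omega>) \<partial>P) \<longlongrightarrow> (\<integral>\<omega>. F (Z \<omega>) \<partial>N)) Fl"
proof (rule tendstoI)
  fix e :: real assume e: "0 < e"
  have close: "\<bar>(\<integral>\<omega>. F (U \<omega>) \<partial>Q) - (\<integral>\<omega>. F (W \<omega>) \<partial>Q)\<bar> \<le> L * b"
    if "prob_space Q" "\<And>\<omega>. \<omega> \<in> space Q \<Longrightarrow> U \<omega> \<in> CV V rho" "\<And>\<omega>. \<omega> \<in> space Q \<Longrightarrow> W \<omega> \<in> CV V rho"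
      "mom_le Q 1 (\<lambda>\<omega>. supn (\<lambda>v. U \<omega> v - W \<omega> v)) b"
      "(\<lambda>\<omega>. F (U \<omega>)) \<in> borel_measurable Q" "(\<lambda>\<omega>. F (W \<omega>)) \<in> borel_measurable Q"
    for Q :: "'q measure" and U W b
  proof -
    interpret prob_space Q by fact
    have i: "integrable Q (\<lambda>\<omega>. F (U \<omega>))" "integrable Q (\<lambda>\<omega>. F (W \<omega>))"
      using that B by (auto intro!: integrable_const_bound[of _ B] AE_I2)
    have "\<bar>(\<integral>\<omega>. F (U \<omega>) \<partial>Q) - (\<integral>\<omega>. F (W \<omega>) \<partial>Q)\<bar> = \<bar>\<integral>\<omega>. F (U \<omega>) - F (W \<omega>) \<partial>Q\<bar>"
      using i by simp
    also have "\<dots> \<le> (\<integral>\<omega>. \<bar>F (U \<omega>) - F (W \<omega>)\<bar> \<partial>Q)" by (rule integral_abs_bound)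
    also have "\<dots> \<le> (\<integral>\<omega>. L * \<bar>supn (\<lambda>v. U \<omega> v - W \<omega> v)\<bar> \<partial>Q)"
    proof (intro integral_mono integrable_abs Bochner_Integration.integrable_diff i integrable_mult_right mom_le_1D(1)[OF that(4)])
      fix \<omega> assume "\<omega> \<in> space Q"
      then have "\<bar>F (U \<omega>) - F (W \<omega>)\<bar> \<le> L * supn (\<lambda>v. U \<omega> v - W \<omega> v)" using that L by blast
      also have "\<dots> \<le> L * \<bar>supn (\<lambda>v. U \<omega> v - W \<omega> v)\<bar>" using L(2) by (intro mult_left_mono) auto
      finally show "\<bar>F (U \<omega>) - F (W \<omega>)\<bar> \<le> L * \<bar>supn (\<lambda>v. U \<omega> v - W \<omega> v)\<bar>" .
    qed
    also have "\<dots> \<le> L * b" using mom_le_1D(2)[OF that(4)] L(2) by (simp add: mult_left_mono)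
    finally show ?thesis .
  qed
  have "(\<lambda>m. L * c m) \<longlonglongrightarrow> L * 0" by (intro tendsto_intros c)
  then have "\<forall>\<^sub>F m in sequentially. L * c m < e / 3" using e by (intro order_tendstoD) auto
  then obtain m where m: "L * c m < e / 3" by (auto simp: eventually_sequentially)
  have 1: "\<bar>(\<integral>\<omega>. F (Y n \<omega>) \<partial>P) - (\<integral>\<omega>. F (YA n m \<omega>) \<partial>P)\<bar> \<le> L * c m" for n
    by (rule close[OF P YC YA Ymom FYm FYAm])
  have 2: "\<bar>(\<integral>\<omega>. F (Z \<omega>) \<partial>N) - (\<integral>\<omega>. F (ZA m \<omega>) \<partial>N)\<bar> \<le> L * c m"
    by (rule close[OF N ZC ZA Zmom FZm FZAm])
  have "\<forall>\<^sub>F n in Fl. dist (\<integral>\<omega>. F (YA n m \<omega>) \<partial>P) (\<integral>\<omega>. F (ZA m \<omega>) \<partial>N) < e / 3"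
    using e by (intro tendstoD conv) auto
  then show "\<forall>\<^sub>F n in Fl. dist (\<integral>\<omega>. F (Y n \<omega>) \<partial>P) (\<integral>\<omega>. F (Z \<omega>) \<partial>N) < e"
  proof eventually_elim
    case (elim n)
    then show ?case using 1[of n] 2 m unfolding dist_real_def by linarith
  qed
qed

section \<open>Lipschitz regularization of bounded continuous functionals\<close>

definition infconv :: "(('v \<Rightarrow> real) \<Rightarrow> real) \<Rightarrow> real \<Rightarrow> ('v \<Rightarrow> real) \<Rightarrow> real" where
  "infconv F L h = (INF h'\<in>CV V rho. F h' + L * supn (\<lambda>v. h v - h' v))"

text \<open>\<open>infconv F L\<close> is the Pasch-Hausdorff envelope, an infimum of L-Lipschitz
  functionals and hence L-Lipschitz itself. For convergence at \<open>h\<close>, competitors closer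
  than \<delta> have a value near \<open>F h\<close> by continuity, while the others pay a penalty
  of at least k \<delta>, which outweighs the possible gain 2 B once k is large.\<close>

lemma infconv:
  assumes bdd: "\<And>h. h \<in> CV V rho \<Longrightarrow> bdd_above ((\<lambda>v. \<bar>h v\<bar>) ` V)"
    and F: "bounded_cont_fun V rho F" and B: "\<And>h. h \<in> CV V rho \<Longrightarrow> \<bar>F h\<bar> \<le> B" and L: "0 \<le> L"
    and h: "h \<in> CV V rho"
  shows "infconv F L h \<le> F h" and "\<bar>infconv F L h\<bar> \<le> B"
    and "g \<in> CV V rho \<Longrightarrow> \<bar>infconv F L h - infconv F L g\<bar> \<le> L * supn (\<lambda>v. h v - g v)"
    and "(\<lambda>k. infconv F (real k) h) \<longlonglongrightarrow> F h"
proof -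
  have ne: "CV V rho \<noteq> {}" using h by blast
  have bd: "bdd_above ((\<lambda>v. \<bar>h v - h' v\<bar>) ` V)" if hh: "h \<in> CV V rho" "h' \<in> CV V rho" for h h'
  proof -
    obtain b b' where b: "\<And>v. v \<in> V \<Longrightarrow> \<bar>h v\<bar> \<le> b" "\<And>v. v \<in> V \<Longrightarrow> \<bar>h' v\<bar> \<le> b'"
      using bdd[OF hh(1)] bdd[OF hh(2)] unfolding bdd_above_def by auto
    have "\<bar>h v - h' v\<bar> \<le> b + b'" if "v \<in> V" for v using b[OF that] by linarith
    then show ?thesis by (intro bdd_aboveI2)
  qed
  have pos: "0 \<le> supn (\<lambda>v. h v - h' v)" if "h \<in> CV V rho" "h' \<in> CV V rho" for h h'
    using bd[OF that] by (rule supn_nonneg)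
  have low: "- B \<le> F h' + L * supn (\<lambda>v. h v - h' v)" if "h \<in> CV V rho" "h' \<in> CV V rho" "0 \<le> L" for h h' L
    using B[OF that(2)] mult_nonneg_nonneg[OF that(3) pos[OF that(1,2)]] by linarith
  have bb: "bdd_below ((\<lambda>h'. F h' + L * supn (\<lambda>v. h v - h' v)) ` CV V rho)" if "h \<in> CV V rho" "0 \<le> L" for h L
    using low that by (intro bdd_belowI2) auto
  have up: "infconv F L h \<le> F h" if "0 \<le> L" for L
  proof -
    have "infconv F L h \<le> F h + L * supn (\<lambda>v. h v - h v)"
      unfolding infconv_def by (intro cINF_lower bb h that)
    then show ?thesis by (simp add: supn_zero[unfolded diff_self])
  qed
  show "infconv F L h \<le> F h" by (rule up[OF L])
  moreover have "- B \<le> infconv F L h"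
    unfolding infconv_def using ne low h L by (intro cINF_greatest) auto
  ultimately show "\<bar>infconv F L h\<bar> \<le> B" using B[OF h] by linarith
  have lip: "infconv F L h \<le> infconv F L g + L * supn (\<lambda>v. h v - g v)" if hg: "h \<in> CV V rho" "g \<in> CV V rho" for h g
  proof -
    have "infconv F L h - L * supn (\<lambda>v. h v - g v) \<le> infconv F L g"
      unfolding infconv_def[of F L g]
    proof (intro cINF_greatest ne)
      fix h' assume h': "h' \<in> CV V rho"
      have "supn (\<lambda>v. h v - h' v) \<le> supn (\<lambda>v. h v - g v) + supn (\<lambda>v. g v - h' v)"
      proof (rule supn_le)
        fix v assume v: "v \<in> V"
        have "\<bar>h v - g v\<bar> \<le> supn (\<lambda>v. h v - g v)" "\<bar>g v - h' v\<bar> \<le> supn (\<lambda>v. g v - h' v)"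
          unfolding supn_def using bd hg h' v by (auto intro!: cSUP_upper)
        then show "\<bar>h v - h' v\<bar> \<le> supn (\<lambda>v. h v - g v) + supn (\<lambda>v. g v - h' v)" by linarith
      qed
      then have "L * supn (\<lambda>v. h v - h' v) \<le> L * (supn (\<lambda>v. h v - g v) + supn (\<lambda>v. g v - h' v))"
        using L by (rule mult_left_mono)
      moreover have "infconv F L h \<le> F h' + L * supn (\<lambda>v. h v - h' v)"
        unfolding infconv_def by (intro cINF_lower bb hg h' L)
      ultimately show "infconv F L h - L * supn (\<lambda>v. h v - g v) \<le> F h' + L * supn (\<lambda>v. g v - h' v)"
        by (simp add: distrib_left)
    qed
    then show ?thesis by linarith
  qed
  show "\<bar>infconv F L h - infconv F L g\<bar> \<le> L * supn (\<lambda>v. h v - g v)" if "g \<in> CV V rho"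
    using lip[OF h that] lip[OF that h, unfolded supn_minus_commute[of g h]] by linarith
  show "(\<lambda>k. infconv F (real k) h) \<longlonglongrightarrow> F h"
  proof (rule LIMSEQ_I)
    fix e :: real assume e: "0 < e"
    have "\<exists>\<delta>>0. \<forall>h'\<in>CV V rho. supn (\<lambda>v. h' v - h v) < \<delta> \<longrightarrow> \<bar>F h' - F h\<bar> < e / 2"
      using conjunct2[OF F[unfolded bounded_cont_fun_supn], rule_format, OF h, of "e / 2"] e by simp
    then obtain \<delta> where \<delta>: "\<delta> > 0" "\<And>h'. h' \<in> CV V rho \<Longrightarrow> supn (\<lambda>v. h' v - h v) < \<delta> \<Longrightarrow> \<bar>F h' - F h\<bar> < e / 2"
      by blast
    obtain k0 :: nat where k0: "2 * B / \<delta> \<le> real k0" using real_arch_simple by blast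
    have "\<bar>infconv F (real k) h - F h\<bar> < e" if k: "k \<ge> k0" for k
    proof -
      have "F h - e / 2 \<le> infconv F (real k) h"
        unfolding infconv_def
      proof (intro cINF_greatest ne)
        fix h' assume h': "h' \<in> CV V rho"
        show "F h - e / 2 \<le> F h' + real k * supn (\<lambda>v. h v - h' v)"
        proof (cases "supn (\<lambda>v. h v - h' v) < \<delta>")
          case True
          then have "\<bar>F h' - F h\<bar> < e / 2" using \<delta>(2)[OF h'] supn_minus_commute[of h h'] by simp
          moreover have "0 \<le> real k * supn (\<lambda>v. h v - h' v)" using pos[OF h h'] by simp
          ultimately show ?thesis by linarith
        next
          case False
          have "2 * B \<le> real k0 * \<delta>" using k0 \<delta>(1) by (simp add: divide_le_eq)
          also have "\<dots> \<le> real k * supn (\<lambda>v. h v - h' v)"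
            using k False \<delta>(1) by (intro mult_mono) auto
          finally show ?thesis using B[OF h] B[OF h'] e by linarith
        qed
      qed
      then show ?thesis using up[of "real k"] e by simp
    qed
    then show "\<exists>no. \<forall>n\<ge>no. norm (infconv F (real n) h - F h) < e" by auto
  qed
qed

lemma infconv_bounded_cont:
  assumes bdd: "\<And>h. h \<in> CV V rho \<Longrightarrow> bdd_above ((\<lambda>v. \<bar>h v\<bar>) ` V)"
    and F: "bounded_cont_fun V rho F" and B: "\<And>h. h \<in> CV V rho \<Longrightarrow> \<bar>F h\<bar> \<le> B" and L: "0 \<le> L"
  shows "bounded_cont_fun V rho (infconv F L)"
  unfolding bounded_cont_fun_supn
proof (intro conjI ballI allI impI)
  show "\<exists>B. \<forall>h\<in>CV V rho. \<bar>infconv F L h\<bar> \<le> B" using infconv(2)[OF bdd F B L] by blast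
  fix h and e :: real assume h: "h \<in> CV V rho" and e: "0 < e"
  show "\<exists>\<delta>>0. \<forall>h'\<in>CV V rho. supn (\<lambda>v. h' v - h v) < \<delta> \<longrightarrow> \<bar>infconv F L h' - infconv F L h\<bar> < e"
  proof (intro exI[of _ "e / (L + 1)"] conjI ballI impI)
    fix h' assume h': "h' \<in> CV V rho" and s: "supn (\<lambda>v. h' v - h v) < e / (L + 1)"
    have "\<bar>infconv F L h' - infconv F L h\<bar> \<le> L * supn (\<lambda>v. h' v - h v)"
      by (rule infconv(3)[OF bdd F B L h' h])
    also have "\<dots> \<le> L * (e / (L + 1))" using s L by (intro mult_left_mono) auto
    also have "\<dots> < e" using L e by (simp add: field_simps)
    finally show "\<bar>infconv F L h' - infconv F L h\<bar> < e" .
  qed (use e L in auto)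
qed

lemma bounded_cont_fun_uminus: "bounded_cont_fun V r F \<Longrightarrow> bounded_cont_fun V r (\<lambda>h. - F h)"
  unfolding bounded_cont_fun_def by (simp add: abs_minus_commute)

theorem bounded_cont_expectation_tendsto:
  assumes P: "prob_space P" and N: "prob_space N"
    and bdd: "\<And>h. h \<in> CV V rho \<Longrightarrow> bdd_above ((\<lambda>v. \<bar>h v\<bar>) ` V)"
    and YC: "\<And>n \<omega>. \<omega> \<in> space P \<Longrightarrow> Y n \<omega> \<in> CV V rho" and ZC: "\<And>\<omega>. \<omega> \<in> space N \<Longrightarrow> Z \<omega> \<in> CV V rho"
    and FYm: "\<And>F n. bounded_cont_fun V rho F \<Longrightarrow> (\<lambda>\<omega>. F (Y n \<omega>)) \<in> borel_measurable P"
    and FZm: "\<And>F. bounded_cont_fun V rho F \<Longrightarrow> (\<lambda>\<omega>. F (Z \<omega>)) \<in> borel_measurable N"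
    and conv: "\<And>F L. bounded_cont_fun V rho F \<Longrightarrow> 0 \<le> L \<Longrightarrow>
       (\<And>h h'. h \<in> CV V rho \<Longrightarrow> h' \<in> CV V rho \<Longrightarrow> \<bar>F h - F h'\<bar> \<le> L * supn (\<lambda>v. h v - h' v)) \<Longrightarrow>
       ((\<lambda>n. \<integral>\<omega>. F (Y n \<omega>) \<partial>P) \<longlongrightarrow> (\<integral>\<omega>. F (Z \<omega>) \<partial>N)) Fl"
    and F: "bounded_cont_fun V rho F"
  shows "((\<lambda>n. \<integral>\<omega>. F (Y n \<omega>) \<partial>P) \<longlongrightarrow> (\<integral>\<omega>. F (Z \<omega>) \<partial>N)) Fl"
proof -
  interpret P: prob_space P by fact
  interpret N: prob_space N by fact
  text \<open>\<open>infconv F k\<close> increases to \<open>F\<close>, which gives the lower half of the limit; the upper half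
    is the lower half for \<open>- F\<close>.\<close>
  have lower: "\<forall>\<^sub>F n in Fl. (\<integral>\<omega>. F (Z \<omega>) \<partial>N) - e < (\<integral>\<omega>. F (Y n \<omega>) \<partial>P)"
    if F: "bounded_cont_fun V rho F" and e: "0 < e" for F e
  proof -
    obtain B where B: "\<And>h. h \<in> CV V rho \<Longrightarrow> \<bar>F h\<bar> \<le> B" using F unfolding bounded_cont_fun_def by blast
    note ic = infconv[OF bdd F B] and icb = infconv_bounded_cont[OF bdd F B]
    have "(\<lambda>k. \<integral>\<omega>. infconv F (real k) (Z \<omega>) \<partial>N) \<longlonglongrightarrow> (\<integral>\<omega>. F (Z \<omega>) \<partial>N)"
    proof (rule integral_dominated_convergence[where w = "\<lambda>_. B"])
      show "AE \<omega> in N. (\<lambda>k. infconv F (real k) (Z \<omega>)) \<longlonglongrightarrow> F (Z \<omega>)"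
        using ic(4)[of 0] ZC by (intro AE_I2) auto
      show "AE \<omega> in N. norm (infconv F (real k) (Z \<omega>)) \<le> B" for k
        using ic(2)[of "real k"] ZC by (intro AE_I2) auto
    qed (use FZm F icb in auto)
    then have "\<forall>\<^sub>F k in sequentially. (\<integral>\<omega>. F (Z \<omega>) \<partial>N) - e / 2 < (\<integral>\<omega>. infconv F (real k) (Z \<omega>) \<partial>N)"
      using e by (intro order_tendstoD) auto
    then obtain k where k: "(\<integral>\<omega>. F (Z \<omega>) \<partial>N) - e / 2 < (\<integral>\<omega>. infconv F (real k) (Z \<omega>) \<partial>N)"
      by (auto simp: eventually_sequentially)
    have "((\<lambda>n. \<integral>\<omega>. infconv F (real k) (Y n \<omega>) \<partial>P) \<longlongrightarrow> (\<integral>\<omega>. infconv F (real k) (Z \<omega>) \<partial>N)) Fl"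
      using ic(3)[of "real k"] icb[of "real k"] by (intro conv[of _ "real k"]) auto
    then have "\<forall>\<^sub>F n in Fl. (\<integral>\<omega>. infconv F (real k) (Z \<omega>) \<partial>N) - e / 2 < (\<integral>\<omega>. infconv F (real k) (Y n \<omega>) \<partial>P)"
      using e by (intro order_tendstoD) auto
    then show ?thesis
    proof eventually_elim
      case (elim n)
      have "(\<integral>\<omega>. infconv F (real k) (Y n \<omega>) \<partial>P) \<le> (\<integral>\<omega>. F (Y n \<omega>) \<partial>P)"
        using ic(1)[of "real k"] ic(2)[of "real k"] B YC FYm[OF F] FYm[OF icb[of "real k"]]
        by (intro integral_mono P.integrable_const_bound[of _ B] AE_I2) auto
      then show ?case using k elim by linarith
    qed
  qed
  show ?thesis
  proof (rule order_tendstoI)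
    fix b assume "b < (\<integral>\<omega>. F (Z \<omega>) \<partial>N)"
    then show "\<forall>\<^sub>F n in Fl. b < (\<integral>\<omega>. F (Y n \<omega>) \<partial>P)"
      using lower[OF F, of "(\<integral>\<omega>. F (Z \<omega>) \<partial>N) - b"] by simp
  next
    fix b assume "(\<integral>\<omega>. F (Z \<omega>) \<partial>N) < b"
    then have "\<forall>\<^sub>F n in Fl. (\<integral>\<omega>. - F (Z \<omega>) \<partial>N) - (b - (\<integral>\<omega>. F (Z \<omega>) \<partial>N)) < (\<integral>\<omega>. - F (Y n \<omega>) \<partial>P)"
      by (intro lower bounded_cont_fun_uminus F) simp
    then show "\<forall>\<^sub>F n in Fl. (\<integral>\<omega>. F (Y n \<omega>) \<partial>P) < b" by eventually_elim simp
  qed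
qed

end

section \<open>Normalized sums of independent variables\<close>

lemma (in prob_space) indep_vars_block:
  assumes "indep_vars M' X I" "\<And>j. j \<in> L \<Longrightarrow> K j \<subseteq> I" "disjoint_family_on K L"
    and "\<And>j. j \<in> L \<Longrightarrow> f j \<in> measurable (PiM (K j) M') (N j)"
  shows "indep_vars N (\<lambda>j \<omega>. f j (restrict (\<lambda>i. X i \<omega>) (K j))) L"
  by (rule indep_vars_compose2[OF indep_vars_restrict[OF assms(1-3)] assms(4)])

lemma prod_mono_ennreal:
  fixes f g :: "'i \<Rightarrow> ennreal"
  assumes "\<And>i. i \<in> I \<Longrightarrow> f i \<le> g i"
  shows "(\<Prod>i\<in>I. f i) \<le> (\<Prod>i\<in>I. g i)"
  using assms by (induction I rule: infinite_finite_induct) (auto intro: mult_mono)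

text \<open>Independence turns the integral of the product of the |U s|^p into a product of
  integrals, so the bounds multiply. This is the origin of the product form of
  \<open>tau\<close>.\<close>

lemma (in prob_space) mom_le_prod:
  assumes I: "finite I" and U: "indep_vars (\<lambda>_. borel) U I" "\<And>s. s \<in> I \<Longrightarrow> mom_le M p (U s) (c s)"
  shows "mom_le M p (\<lambda>\<omega>. \<Prod>s\<in>I. U s \<omega>) (\<Prod>s\<in>I. c s)"
proof -
  have c0: "0 \<le> c s" if "s \<in> I" for s using mom_leD(2)[OF U(2)[OF that]] .
  have "indep_vars (\<lambda>_. borel) (\<lambda>s \<omega>. ennreal (\<bar>U s \<omega>\<bar> powr p)) I"
    by (rule indep_vars_compose2[OF U(1), where Y = "\<lambda>_ x. ennreal (\<bar>x\<bar> powr p)"]) measurable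
  then have "(\<integral>\<^sup>+\<omega>. (\<Prod>s\<in>I. ennreal (\<bar>U s \<omega>\<bar> powr p)) \<partial>M) = (\<Prod>s\<in>I. \<integral>\<^sup>+\<omega>. ennreal (\<bar>U s \<omega>\<bar> powr p) \<partial>M)"
    using I by (intro indep_vars_nn_integral) auto
  also have "\<dots> \<le> (\<Prod>s\<in>I. ennreal (c s powr p))"
    by (intro prod_mono_ennreal mom_leD(3) U(2))
  also have "\<dots> = ennreal ((\<Prod>s\<in>I. c s) powr p)"
    using c0 by (simp add: prod_ennreal prod_powr_distrib)
  finally have "(\<integral>\<^sup>+\<omega>. (\<Prod>s\<in>I. ennreal (\<bar>U s \<omega>\<bar> powr p)) \<partial>M) \<le> ennreal ((\<Prod>s\<in>I. c s) powr p)" .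
  moreover have "(\<Prod>s\<in>I. ennreal (\<bar>U s \<omega>\<bar> powr p)) = ennreal (\<bar>\<Prod>s\<in>I. U s \<omega>\<bar> powr p)" for \<omega>
    by (simp add: prod_ennreal abs_prod prod_powr_distrib)
  moreover have "(\<lambda>\<omega>. \<Prod>s\<in>I. U s \<omega>) \<in> borel_measurable M"
    by (intro borel_measurable_prod mom_leD(1)[OF U(2)])
  moreover have "0 \<le> (\<Prod>s\<in>I. c s)" by (intro prod_nonneg ballI c0)
  ultimately show ?thesis by (simp add: mom_le_def)
qed

lemma (in prob_space) clt_weak_conv:
  fixes Y :: "nat \<Rightarrow> 'a \<Rightarrow> real"
  assumes Y: "indep_vars (\<lambda>_. borel) Y UNIV" "\<And>i. distr M borel (Y i) = m"
    and mean: "\<And>i. expectation (Y i) = 0" and sq: "\<And>i. integrable M (\<lambda>\<omega>. (Y i \<omega>)\<^sup>2)"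
    and v: "\<And>i. expectation (\<lambda>\<omega>. (Y i \<omega>)\<^sup>2) = v" "0 < v"
  shows "weak_conv_m (\<lambda>n. distr M borel (\<lambda>\<omega>. (\<Sum>i<n. Y i \<omega>) / sqrt (n * (sqrt v)\<^sup>2))) std_normal_distribution"
  using v by (intro central_limit_theorem_zero_mean[where \<mu> = m] Y mean sq) (auto simp: mean)

text \<open>Frequency 1 suffices because coefficients can be absorbed into \<open>Y\<close>;
  evaluating the characteristic function at sqrt v undoes the normalization of the limit theorem.
  The case v = 0 does occur, for linear combinations with zero coefficients, and then every
  \<open>Y i\<close> vanishes almost surely.\<close>

lemma (in prob_space) clt_char:
  fixes Y :: "nat \<Rightarrow> 'a \<Rightarrow> real"
  assumes Y: "indep_vars (\<lambda>_. borel) Y UNIV" "\<And>i. distr M borel (Y i) = m"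
    and mean: "\<And>i. expectation (Y i) = 0" and sq: "\<And>i. integrable M (\<lambda>\<omega>. (Y i \<omega>)\<^sup>2)"
    and v: "\<And>i. expectation (\<lambda>\<omega>. (Y i \<omega>)\<^sup>2) = v"
  shows "(\<lambda>n. \<integral>\<omega>. iexp ((\<Sum>i<n. Y i \<omega>) / sqrt n) \<partial>M) \<longlonglongrightarrow> complex_of_real (exp (- v / 2))"
proof -
  have [measurable]: "random_variable borel (Y i)" for i using Y(1) by (auto simp: indep_vars_def)
  have v0: "0 \<le> v" unfolding v[of 0, symmetric] by (intro Bochner_Integration.integral_nonneg) auto
  show ?thesis
  proof (cases "v = 0")
    case True
    have "AE \<omega> in M. \<forall>i. Y i \<omega> = 0"
    proof (subst AE_all_countable, intro allI)
      fix i
      have "AE \<omega> in M. (Y i \<omega>)\<^sup>2 = 0"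
        using integral_nonneg_eq_0_iff_AE[OF sq[of i]] v[of i] True by simp
      then show "AE \<omega> in M. Y i \<omega> = 0" by eventually_elim simp
    qed
    then have "(\<integral>\<omega>. iexp ((\<Sum>i<n. Y i \<omega>) / sqrt n) \<partial>M) = (\<integral>\<omega>. 1 \<partial>M)" for n
      by (intro integral_cong_AE) (auto elim!: eventually_mono)
    then show ?thesis using True by (simp add: prob_space)
  next
    case False
    then have v1: "0 < v" using v0 by simp
    have "(\<lambda>n. char (distr M borel (\<lambda>\<omega>. (\<Sum>i<n. Y i \<omega>) / sqrt (n * (sqrt v)\<^sup>2))) (sqrt v)) \<longlonglongrightarrow> char std_normal_distribution (sqrt v)"
      by (rule levy_continuity1[OF _ _ clt_weak_conv[OF Y mean sq v v1]]) (auto intro!: real_distribution_distr real_dist_normal_dist)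
    moreover have "char (distr M borel (\<lambda>\<omega>. (\<Sum>i<n. Y i \<omega>) / sqrt (n * (sqrt v)\<^sup>2))) (sqrt v) = (\<integral>\<omega>. iexp ((\<Sum>i<n. Y i \<omega>) / sqrt n) \<partial>M)" for n
      unfolding char_def using v1 by (subst integral_distr) (auto simp: real_sqrt_mult)
    moreover have "char std_normal_distribution (sqrt v) = complex_of_real (exp (- v / 2))"
      using v0 by (simp add: char_std_normal_distribution)
    ultimately show ?thesis by simp
  qed
qed

text \<open>Weak convergence tests bounded continuous functions, so |x| is cut at level k first. The
  truncated moment inherits the bound of the normalized sums, and Fatou's lemma removes the
  cut.\<close>

lemma (in prob_space) clt_moment:
  fixes Y :: "nat \<Rightarrow> 'a \<Rightarrow> real"
  assumes Y: "indep_vars (\<lambda>_. borel) Y UNIV" "\<And>i. distr M borel (Y i) = m"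
    and mean: "\<And>i. expectation (Y i) = 0" and sq: "\<And>i. integrable M (\<lambda>\<omega>. (Y i \<omega>)\<^sup>2)"
    and v: "\<And>i. expectation (\<lambda>\<omega>. (Y i \<omega>)\<^sup>2) = 1" and p: "0 < p"
    and mom: "\<And>n. mom_le M p (\<lambda>\<omega>. (\<Sum>i<n. Y i \<omega>) / sqrt n) b"
  shows "mom_le std_normal_distribution p (\<lambda>x. x) b"
proof -
  have [measurable]: "random_variable borel (Y i)" for i using Y(1) by (auto simp: indep_vars_def)
  have b: "0 \<le> b" using mom_leD(2)[OF mom] .
  interpret std: real_distribution std_normal_distribution by (rule real_dist_normal_dist)
  have trunc: "mom_le std_normal_distribution p (\<lambda>x. min \<bar>x\<bar> (real k)) b" for k :: nat
  proof -
    define f where "f x = (min \<bar>x\<bar> (real k)) powr p" for x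
    have cont: "isCont f x" for x
      unfolding isCont_def f_def using p by (intro tendsto_powr' tendsto_intros) auto
    have fb: "norm (f x) \<le> real k powr p" for x
      unfolding f_def using p by (auto intro!: powr_mono2)
    have [measurable]: "f \<in> borel_measurable borel" unfolding f_def by measurable
    have "(\<lambda>n. integral\<^sup>L (distr M borel (\<lambda>\<omega>. (\<Sum>i<n. Y i \<omega>) / sqrt (n * (sqrt 1)\<^sup>2))) f) \<longlonglongrightarrow> integral\<^sup>L std_normal_distribution f"
      using cont fb by (intro weak_conv_imp_integral_bdd_continuous_conv[OF _ _ clt_weak_conv[OF Y mean sq v]])
        (auto intro!: real_distribution_distr real_dist_normal_dist)
    moreover have "integral\<^sup>L (distr M borel (\<lambda>\<omega>. (\<Sum>i<n. Y i \<omega>) / sqrt (n * (sqrt 1)\<^sup>2))) f \<le> b powr p" for n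
    proof -
      have "integral\<^sup>L (distr M borel (\<lambda>\<omega>. (\<Sum>i<n. Y i \<omega>) / sqrt (n * (sqrt 1)\<^sup>2))) f = (\<integral>\<omega>. f ((\<Sum>i<n. Y i \<omega>) / sqrt n) \<partial>M)"
        by (subst integral_distr) auto
      also have "\<dots> \<le> (\<integral>\<omega>. \<bar>(\<Sum>i<n. Y i \<omega>) / sqrt n\<bar> powr p \<partial>M)"
      proof (intro integral_mono mom_le_integrable[OF mom])
        show "integrable M (\<lambda>\<omega>. f ((\<Sum>i<n. Y i \<omega>) / sqrt n))"
          using fb by (intro integrable_const_bound[of _ "real k powr p"]) auto
        show "f ((\<Sum>i<n. Y i \<omega>) / sqrt n) \<le> \<bar>(\<Sum>i<n. Y i \<omega>) / sqrt n\<bar> powr p" for \<omega>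
          unfolding f_def using p by (intro powr_mono2) auto
      qed
      also have "\<dots> \<le> b powr p" by (rule mom_le_integral[OF mom])
      finally show ?thesis .
    qed
    ultimately have "integral\<^sup>L std_normal_distribution f \<le> b powr p" by (intro LIMSEQ_le_const2) auto
    moreover have fi: "integrable std_normal_distribution f"
      using fb by (intro std.integrable_const_bound[of _ "real k powr p"]) auto
    have "(\<integral>\<^sup>+x. ennreal (f x) \<partial>std_normal_distribution) = ennreal (integral\<^sup>L std_normal_distribution f)"
      by (rule nn_integral_eq_integral[OF fi]) (simp add: f_def)
    ultimately show ?thesis using b by (auto simp: mom_le_def f_def intro!: ennreal_leI)
  qed
  have "mom_le std_normal_distribution p (\<lambda>x. \<bar>x\<bar>) b"
  proof (rule mom_le_limit[OF trunc])
    have "(\<lambda>k. min \<bar>x\<bar> (real k)) \<longlonglongrightarrow> \<bar>x\<bar>" for x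
    proof (rule tendsto_eventually)
      obtain k0 :: nat where "\<bar>x\<bar> \<le> real k0" using real_arch_simple by blast
      then show "\<forall>\<^sub>F k in sequentially. min \<bar>x\<bar> (real k) = \<bar>x\<bar>"
        unfolding eventually_sequentially by (intro exI[of _ k0]) auto
    qed
    then show "AE x in std_normal_distribution. (\<lambda>k. min \<bar>x\<bar> (real k)) \<longlonglongrightarrow> \<bar>x\<bar>" by simp
  qed (use p in auto)
  then show ?thesis by (auto simp: mom_le_def)
qed

text \<open>Samples are numbered from 1 and the summation index from 0, hence the
  \<open>Suc\<close>. For \<open>n = 0\<close> the value is 0, by the convention for division by
  zero.\<close>

definition nsum :: "(nat \<Rightarrow> nat \<Rightarrow> 'w \<Rightarrow> 'a) \<Rightarrow> ('a \<Rightarrow> real) \<Rightarrow> nat \<Rightarrow> nat \<Rightarrow> 'w \<Rightarrow> real" where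
  "nsum \<xi> h n s \<omega> = (\<Sum>i<n. h (\<xi> (Suc i) s \<omega>)) / sqrt n"

locale iid_samples = prob_space P for P :: "'w measure" +
  fixes \<mu> :: "nat \<Rightarrow> 'a measure" and \<xi> :: "nat \<Rightarrow> nat \<Rightarrow> 'w \<Rightarrow> 'a" and d :: nat
  assumes prob_mu: "s \<in> {1..d} \<Longrightarrow> prob_space (\<mu> s)"
    and indep: "indep_vars (\<lambda>(i, s). \<mu> s) (\<lambda>(i, s). \<xi> i s) ({1..} \<times> {1..d})"
    and distr_xi: "i \<ge> 1 \<Longrightarrow> s \<in> {1..d} \<Longrightarrow> distr P (\<mu> s) (\<xi> i s) = \<mu> s"
begin

lemma xi_measurable: "i \<ge> 1 \<Longrightarrow> s \<in> {1..d} \<Longrightarrow> \<xi> i s \<in> measurable P (\<mu> s)"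
  using indep unfolding indep_vars_def by auto

lemma distr_comp:
  assumes "i \<ge> 1" "s \<in> {1..d}" "h \<in> borel_measurable (\<mu> s)"
  shows "distr P borel (\<lambda>\<omega>. h (\<xi> i s \<omega>)) = distr (\<mu> s) borel h"
  using distr_distr[OF assms(3) xi_measurable[OF assms(1,2)]]
  unfolding distr_xi[OF assms(1,2)] comp_def by simp

lemma integral_xi:
  fixes h :: "'a \<Rightarrow> real"
  assumes "i \<ge> 1" "s \<in> {1..d}" "h \<in> borel_measurable (\<mu> s)"
  shows "(\<integral>\<omega>. h (\<xi> i s \<omega>) \<partial>P) = (\<integral>x. h x \<partial>\<mu> s)" "integrable P (\<lambda>\<omega>. h (\<xi> i s \<omega>)) \<longleftrightarrow> integrable (\<mu> s) h"
  using integral_distr[OF xi_measurable[OF assms(1,2)] assms(3)] integrable_distr_eq[OF xi_measurable[OF assms(1,2)] assms(3)]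
  by (simp_all add: distr_xi[OF assms(1,2)])

lemma mom_le_xi:
  assumes "i \<ge> 1" "s \<in> {1..d}" "h \<in> borel_measurable (\<mu> s)"
  shows "mom_le P p (\<lambda>\<omega>. h (\<xi> i s \<omega>)) b \<longleftrightarrow> mom_le (\<mu> s) p h b"
  using mom_le_distr[OF xi_measurable[OF assms(1,2)] assms(3)] by (simp add: distr_xi[OF assms(1,2)])

lemma indep_column:
  assumes "s \<in> {1..d}" "h \<in> borel_measurable (\<mu> s)"
  shows "indep_vars (\<lambda>_. borel) (\<lambda>i \<omega>. h (\<xi> (Suc i) s \<omega>)) UNIV"
proof -
  have "indep_vars (\<lambda>_. borel) (\<lambda>i \<omega>. (\<lambda>z. h (z (Suc i, s))) (restrict (\<lambda>j. (case j of (i, s) \<Rightarrow> \<xi> i s) \<omega>) {(Suc i, s)})) UNIV"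
  proof (rule indep_vars_block[OF indep])
    show "(\<lambda>z. h (z (Suc i, s))) \<in> borel_measurable (PiM {(Suc i, s)} (\<lambda>(i, s). \<mu> s))" for i
      by (rule measurable_compose[OF measurable_component_singleton[of "(Suc i, s)" _ "\<lambda>(i, s). \<mu> s"]]) (use assms in auto)
  qed (use assms in \<open>auto simp: disjoint_family_on_def\<close>)
  then show ?thesis by simp
qed

text \<open>Different values of \<open>s\<close> use the disjoint index blocks
  \<open>{1..n s} \<times> {s}\<close>, so the lengths of the columns may differ freely.\<close>

lemma indep_columns:
  assumes h: "\<And>s. s \<in> {1..d} \<Longrightarrow> h s \<in> borel_measurable (\<mu> s)"
  shows "indep_vars (\<lambda>_. borel) (\<lambda>s. nsum \<xi> (h s) (n s) s) {1..d}"
proof -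
  have "indep_vars (\<lambda>_. borel) (\<lambda>s \<omega>. (\<lambda>z. (\<Sum>i<n s. h s (z (Suc i, s))) / sqrt (n s)) (restrict (\<lambda>j. (case j of (i, s) \<Rightarrow> \<xi> i s) \<omega>) ({1..n s} \<times> {s}))) {1..d}"
  proof (rule indep_vars_block[OF indep])
    fix s assume s: "s \<in> {1..d}"
    have "(\<lambda>z. h s (z (Suc i, s))) \<in> borel_measurable (PiM ({1..n s} \<times> {s}) (\<lambda>(i, s). \<mu> s))" if "i < n s" for i
      by (rule measurable_compose[OF measurable_component_singleton[of "(Suc i, s)" _ "\<lambda>(i, s). \<mu> s"]]) (use s h that in auto)
    then show "(\<lambda>z. (\<Sum>i<n s. h s (z (Suc i, s))) / sqrt (n s)) \<in> borel_measurable (PiM ({1..n s} \<times> {s}) (\<lambda>(i, s). \<mu> s))"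
      by (intro borel_measurable_divide borel_measurable_sum borel_measurable_const) auto
  qed (auto simp: disjoint_family_on_def)
  then show ?thesis by (simp add: nsum_def[abs_def])
qed

text \<open>\<open>KR\<close> speaks of coordinates on a product space. By independence the joint
  law of the values of \<open>h\<close> along a column is the product of their common law, so the
  bound can be pulled back to \<open>P\<close>. With coefficients 1/sqrt n the sum of squares is
  1.\<close>

lemma mom_le_nsum:
  assumes s: "s \<in> {1..d}" and p: "2 \<le> p" and h: "mom_le (\<mu> s) p h b" "(\<integral>x. h x \<partial>\<mu> s) = 0"
  shows "mom_le P p (nsum \<xi> h n s) (KR p * b)"
proof (cases "n = 0")
  case True
  then show ?thesis using mom_leD(2)[OF h(1)] KR_attained(2)[OF p] by (auto simp: nsum_def[abs_def] mom_le_def)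
next
  case False
  interpret mu: prob_space "\<mu> s" using prob_mu s by blast
  have hm: "h \<in> borel_measurable (\<mu> s)" using mom_leD(1)[OF h(1)] .
  define m where "m = distr (\<mu> s) borel h"
  have hi: "integrable (\<mu> s) h"
    using mu.mom_le_Lyapunov[OF h(1), of 1] p by (intro mom_le_1D(1)) auto
  have m: "prob_space m" "sets m = sets borel" "integrable m (\<lambda>x. x)" "(\<integral>x. x \<partial>m) = 0" "mom_le m p (\<lambda>x. x) b"
    using hm hi h by (auto simp: m_def mu.prob_space_distr integrable_distr_eq integral_distr mom_le_distr)
  define X where "X i \<omega> = h (\<xi> (Suc i) s \<omega>)" for i \<omega>
  have X: "X i \<in> borel_measurable P" "distr P borel (X i) = m" for i
    using measurable_compose[OF xi_measurable hm] distr_comp[OF _ s hm] s by (auto simp: X_def[abs_def] m_def)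
  have "indep_vars (\<lambda>_. borel) X {..<n}"
    using indep_column[OF s hm] unfolding X_def[abs_def] by (rule indep_vars_subset) auto
  then have "distr P (PiM {..<n} (\<lambda>_. borel)) (\<lambda>\<omega>. \<lambda>i\<in>{..<n}. X i \<omega>) = PiM {..<n} (\<lambda>i. distr P borel (X i))"
    using False X by (subst (asm) indep_vars_iff_distr_eq_PiM') auto
  then have D: "distr P (PiM {..<n} (\<lambda>_. borel)) (\<lambda>\<omega>. \<lambda>i\<in>{..<n}. X i \<omega>) = PiM {..<n} (\<lambda>_. m)"
    by (simp add: X(2))
  define c where "c i = 1 / sqrt n" for i :: nat
  have c2: "sqrt (\<Sum>i<n. (c i)\<^sup>2) = 1" using False by (simp add: c_def power_divide)
  have "mom_le (PiM {..<n} (\<lambda>_. m)) p (\<lambda>\<omega>. \<Sum>i<n. c i * \<omega> i) (KR p * sqrt (\<Sum>i<n. (c i)\<^sup>2) * b)"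
    by (rule mom_le_iid_sum[OF p m])
  then have "mom_le (distr P (PiM {..<n} (\<lambda>_. borel)) (\<lambda>\<omega>. \<lambda>i\<in>{..<n}. X i \<omega>)) p (\<lambda>\<omega>. \<Sum>i<n. c i * \<omega> i) (KR p * b)"
    by (simp add: D c2)
  then have "mom_le P p (\<lambda>\<omega>. \<Sum>i<n. c i * (\<lambda>i\<in>{..<n}. X i \<omega>) i) (KR p * b)"
    by (subst (asm) mom_le_distr)
       (auto intro!: measurable_restrict X borel_measurable_sum borel_measurable_times measurable_component_singleton)
  moreover have "(\<lambda>\<omega>. \<Sum>i<n. c i * (\<lambda>i\<in>{..<n}. X i \<omega>) i) = nsum \<xi> h n s"
    by (auto simp: fun_eq_iff nsum_def X_def c_def sum_divide_distrib intro!: sum.cong)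
  ultimately show ?thesis by simp
qed

lemma nsum_char:
  assumes s: "s \<in> {1..d}" and hm: "h \<in> borel_measurable (\<mu> s)" and h: "(\<integral>x. h x \<partial>\<mu> s) = 0"
    "integrable (\<mu> s) (\<lambda>x. (h x)\<^sup>2)" "(\<integral>x. (h x)\<^sup>2 \<partial>\<mu> s) = v"
  shows "(\<lambda>n. \<integral>\<omega>. iexp (nsum \<xi> h n s \<omega>) \<partial>P) \<longlonglongrightarrow> complex_of_real (exp (- v / 2))"
proof -
  have sq: "(\<lambda>x. (h x)\<^sup>2) \<in> borel_measurable (\<mu> s)" using hm by measurable
  show ?thesis
    unfolding nsum_def
    by (rule clt_char[OF indep_column[OF s hm] distr_comp[OF _ s hm]])
       (use h integral_xi[OF _ s hm] integral_xi[OF _ s sq] in auto)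
qed

text \<open>Puts the Gaussian factors under the same bound \<open>KR p * b\<close> as the column
  sums of a normalized \<open>h\<close>, so that both fields share the weight
  \<open>tau\<close>.\<close>

lemma std_normal_moment_le:
  assumes s: "s \<in> {1..d}" and p: "2 \<le> p" and h: "mom_le (\<mu> s) p h b" "(\<integral>x. h x \<partial>\<mu> s) = 0"
    "integrable (\<mu> s) (\<lambda>x. (h x)\<^sup>2)" "(\<integral>x. (h x)\<^sup>2 \<partial>\<mu> s) = 1"
  shows "mom_le std_normal_distribution p (\<lambda>x. x) (KR p * b)"
proof -
  have hm: "h \<in> borel_measurable (\<mu> s)" using mom_leD(1)[OF h(1)] .
  have sq: "(\<lambda>x. (h x)\<^sup>2) \<in> borel_measurable (\<mu> s)" using hm by measurable
  show ?thesis
    by (rule clt_moment[OF indep_column[OF s hm] distr_comp[OF _ s hm]])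
       (use h p integral_xi[OF _ s hm] integral_xi[OF _ s sq] mom_le_nsum[OF s p h(1,2)] in \<open>auto simp: nsum_def[abs_def]\<close>)
qed

end

section \<open>Entropy\<close>

lemma countable_Kset: "countable (Kset d Mc)"
proof -
  have "inj_on (\<lambda>k. map k [1..<Suc d]) (Kset d Mc)"
  proof (rule inj_onI)
    fix k l assume kl: "k \<in> Kset d Mc" "l \<in> Kset d Mc" "map k [1..<Suc d] = map l [1..<Suc d]"
    show "k = l"
    proof
      fix s
      show "k s = l s"
      proof (cases "s \<in> {1..d}")
        case True
        then have "s \<in> set [1..<Suc d]" by auto
        then show ?thesis using kl(3) by (metis map_eq_conv)
      qed (use kl in \<open>auto simp: Kset_def\<close>)
    qed
  qed
  then show ?thesis by (rule countable_image_inj_on[rotated]) simp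
qed

text \<open>\<open>infsum\<close> is 0 on a non-summable family, so the triangle inequality rests on
  summability of the differences, which follows from that of |lam u k| and |lam v k|.\<close>

lemma rho_lam_facts:
  assumes "sigma_lam_finite V d Mc lam" and uv: "u \<in> V" "v \<in> V" "w \<in> V"
  shows "(\<lambda>k. \<bar>lam u k - lam v k\<bar>) summable_on Kset d Mc"
    and "rho_lam d Mc lam u v = rho_lam d Mc lam v u"
    and "rho_lam d Mc lam u w \<le> rho_lam d Mc lam u v + rho_lam d Mc lam v w"
proof -
  have s: "(\<lambda>k. \<bar>lam u k - lam v k\<bar>) summable_on Kset d Mc" if "u \<in> V" "v \<in> V" for u v
  proof -
    have "(\<lambda>k. \<bar>lam u k\<bar> + \<bar>lam v k\<bar>) summable_on Kset d Mc"
      using assms(1) that by (intro summable_on_add) (auto simp: sigma_lam_finite_def)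
    then show ?thesis by (rule summable_on_comparison_test) auto
  qed
  show "(\<lambda>k. \<bar>lam u k - lam v k\<bar>) summable_on Kset d Mc" by (rule s[OF uv(1,2)])
  show "rho_lam d Mc lam u v = rho_lam d Mc lam v u" by (simp add: rho_lam_def abs_minus_commute)
  have "rho_lam d Mc lam u w \<le> infsum (\<lambda>k. \<bar>lam u k - lam v k\<bar> + \<bar>lam v k - lam w k\<bar>) (Kset d Mc)"
    unfolding rho_lam_def by (intro infsum_mono summable_on_add s uv) auto
  also have "\<dots> = rho_lam d Mc lam u v + rho_lam d Mc lam v w"
    unfolding rho_lam_def by (intro infsum_add s uv)
  finally show "rho_lam d Mc lam u w \<le> rho_lam d Mc lam u v + rho_lam d Mc lam v w" .
qed

text \<open>Without a finite net, points can be chosen one after another at distance more than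
  \<open>e\<close> from all earlier ones. In a convergent subsequence, consecutive terms far out
  would be closer than that.\<close>

lemma pm_compact_finite_net:
  assumes c: "pm_compact V r" and e: "0 < e"
    and sym: "\<And>u v. u \<in> V \<Longrightarrow> v \<in> V \<Longrightarrow> r u v = r v u"
    and tri: "\<And>u v w. u \<in> V \<Longrightarrow> v \<in> V \<Longrightarrow> w \<in> V \<Longrightarrow> r u w \<le> r u v + r v w"
  shows "\<exists>S. S \<subseteq> V \<and> finite S \<and> (\<forall>v\<in>V. \<exists>u\<in>S. r v u \<le> e)"
proof (rule ccontr)
  assume neg: "\<not> ?thesis"
  have "\<exists>x::nat \<Rightarrow> 'a. \<forall>n. (x n \<in> V \<and> (\<forall>i<n. e < r (x n) (x i)))"
  proof (rule dependent_wellorder_choice)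
    fix n :: nat and x :: "nat \<Rightarrow> 'a"
    assume "\<And>m. m < n \<Longrightarrow> x m \<in> V \<and> (\<forall>i<m. e < r (x m) (x i))"
    then have "x ` {..<n} \<subseteq> V \<and> finite (x ` {..<n})" by auto
    then have "\<not> (\<forall>v\<in>V. \<exists>u\<in>x ` {..<n}. r v u \<le> e)"
      using neg[unfolded not_ex, THEN spec[of _ "x ` {..<n}"]] by simp
    then obtain v where "v \<in> V" "\<forall>u\<in>x ` {..<n}. \<not> r v u \<le> e" by auto
    then show "\<exists>v. v \<in> V \<and> (\<forall>i<n. e < r v (x i))"
      by (intro exI[of _ v]) (metis image_eqI lessThan_iff not_le)
  qed auto
  then obtain x where x: "\<And>n::nat. x n \<in> V" "\<And>n i. i < n \<Longrightarrow> e < r (x n) (x i)" by blast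
  then obtain l h where l: "l \<in> V" "strict_mono h" "(\<lambda>n. r (x (h n)) l) \<longlonglongrightarrow> 0"
    using c unfolding pm_compact_def by blast
  have "\<forall>\<^sub>F n in sequentially. r (x (h n)) l < e / 2" using l(3) e by (intro order_tendstoD) auto
  then obtain n where n: "\<And>m. m \<ge> n \<Longrightarrow> r (x (h m)) l < e / 2" by (auto simp: eventually_sequentially)
  have "e < r (x (h (Suc n))) (x (h n))" using l(2) by (intro x(2)) (auto simp: strict_mono_Suc_iff)
  also have "\<dots> \<le> r (x (h (Suc n))) l + r (x (h n)) l" using tri sym x(1) l(1) by metis
  also have "\<dots> < e" using n[of n] n[of "Suc n"] by simp
  finally show False .
qed

text \<open>Points with |h (x n)| > n would have a subsequence converging to a point of
  \<open>V\<close>, near which continuity keeps \<open>h\<close> bounded.\<close>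

lemma CV_bounded:
  assumes c: "pm_compact V r" and h: "h \<in> CV V r"
  shows "bdd_above ((\<lambda>v. \<bar>h v\<bar>) ` V)"
proof (rule ccontr)
  assume "\<not> ?thesis"
  then have "\<exists>v\<in>V. real n < \<bar>h v\<bar>" for n
    unfolding bdd_above_def by (auto simp: not_le)
  then obtain x where x: "\<And>n. x n \<in> V" "\<And>n. real n < \<bar>h (x n)\<bar>" by metis
  then obtain l g where l: "l \<in> V" "strict_mono g" "(\<lambda>n. r (x (g n)) l) \<longlonglongrightarrow> 0"
    using c unfolding pm_compact_def by blast
  obtain \<delta> where \<delta>: "\<delta> > 0" "\<And>u. u \<in> V \<Longrightarrow> r u l < \<delta> \<Longrightarrow> \<bar>h u - h l\<bar> < 1"
    using CV_D[OF h l(1), of 1] by auto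
  have "\<forall>\<^sub>F n in sequentially. r (x (g n)) l < \<delta>" using l(3) \<delta>(1) by (rule order_tendstoD)
  then obtain n where n: "\<And>m. m \<ge> n \<Longrightarrow> r (x (g m)) l < \<delta>" by (auto simp: eventually_sequentially)
  obtain k :: nat where k: "\<bar>h l\<bar> + 1 \<le> real k" using real_arch_simple by blast
  define m where "m = max n k"
  have "\<bar>h (x (g m)) - h l\<bar> < 1" using n[of m] \<delta>(2) x(1) by (auto simp: m_def)
  moreover have "real k \<le> real (g m)" using seq_suble[OF l(2), of m] by (auto simp: m_def)
  ultimately show False using x(2)[of "g m"] k by linarith
qed

text \<open>The \<open>LEAST\<close> in \<open>cover_num\<close> is informative once some finite net
  exists. Compactness provides one, and then the covering number is the size of an actual
  net.\<close>

lemma cover_num_props: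
  assumes c: "pm_compact V r" and V: "V \<noteq> {}" and e: "0 < e"
    and sym: "\<And>u v. u \<in> V \<Longrightarrow> v \<in> V \<Longrightarrow> r u v = r v u"
    and tri: "\<And>u v w. u \<in> V \<Longrightarrow> v \<in> V \<Longrightarrow> w \<in> V \<Longrightarrow> r u w \<le> r u v + r v w"
  shows "\<exists>S. S \<subseteq> V \<and> finite S \<and> card S = cover_num V r e \<and> (\<forall>v\<in>V. \<exists>u\<in>S. r v u \<le> e)"
    and "1 \<le> cover_num V r e"
    and "e \<le> e' \<Longrightarrow> cover_num V r e' \<le> cover_num V r e"
proof -
  obtain S where "S \<subseteq> V" "finite S" "\<forall>v\<in>V. \<exists>u\<in>S. r v u \<le> e"
    using pm_compact_finite_net[OF c e sym tri] by auto
  then have "\<exists>n. \<exists>S. S \<subseteq> V \<and> finite S \<and> card S = n \<and> (\<forall>v\<in>V. \<exists>u\<in>S. r v u \<le> e)" by blast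
  then show S: "\<exists>S. S \<subseteq> V \<and> finite S \<and> card S = cover_num V r e \<and> (\<forall>v\<in>V. \<exists>u\<in>S. r v u \<le> e)"
    unfolding cover_num_def by (rule LeastI_ex)
  then obtain S where S': "S \<subseteq> V" "finite S" "card S = cover_num V r e" "\<forall>v\<in>V. \<exists>u\<in>S. r v u \<le> e" by blast
  then have "S \<noteq> {}" using V by blast
  then show "1 \<le> cover_num V r e" using S'(2,3) by (metis One_nat_def Suc_leI card_gt_0_iff)
  show "cover_num V r e' \<le> cover_num V r e" if "e \<le> e'"
    unfolding cover_num_def[of V r e']
  proof (rule Least_le, intro exI conjI)
    show "\<forall>v\<in>V. \<exists>u\<in>S. r v u \<le> e'" using S'(4) that by (meson order_trans)
  qed (use S' in auto)
qed

text \<open>The substitution p = 1/y, which carries the range of y to the exponents from 2 up to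
  \<open>a\<close>. It includes the case of infinite \<open>a\<close>, where
  \<open>inverse a\<close> is 0.\<close>

lemma wfun_index_set:
  assumes "a > 2"
  shows "1/2 \<in> {y::real. inverse a < ereal y \<and> y \<le> 1/2}"
    and "y \<in> {y::real. inverse a < ereal y \<and> y \<le> 1/2} \<Longrightarrow> 0 < y \<and> 2 \<le> 1 / y \<and> ereal (1 / y) < a"
proof -
  have inv: "0 \<le> inverse a" using assms by (cases a) auto
  show "1/2 \<in> {y::real. inverse a < ereal y \<and> y \<le> 1/2}"
    using assms by (cases a) (auto simp: field_simps)
  assume y: "y \<in> {y::real. inverse a < ereal y \<and> y \<le> 1/2}"
  then have "0 < ereal y" using le_less_trans[OF inv, of "ereal y"] by simp
  then have y0: "0 < y" by simp
  then have "2 \<le> 1 / y" using y by (simp add: field_simps)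
  moreover have "ereal (1 / y) < a"
    using y y0 assms by (cases a) (auto simp: field_simps)
  ultimately show "0 < y \<and> 2 \<le> 1 / y \<and> ereal (1 / y) < a" using y0 by blast
qed

text \<open>For x = ln N and q = 1/y the quantity exp(x y + ln (t q)) is N^(1/q) t(q), the price of
  a chaining link on a net of N points. The infimum need not be attained, so a slack of ln 2 is
  allowed in the exponent, whence the factor 2.\<close>

lemma wfun_props:
  assumes a: "a > 2" and t: "\<And>p. 2 \<le> p \<Longrightarrow> ereal p < a \<Longrightarrow> 1 \<le> t p" and x: "0 \<le> x"
  shows "x \<le> x' \<Longrightarrow> wfun a (\<lambda>y. ln (t (1 / y))) x \<le> wfun a (\<lambda>y. ln (t (1 / y))) x'"
    and "\<exists>q. 2 \<le> q \<and> ereal q < a \<and> exp x powr (1 / q) * t q \<le> 2 * exp (wfun a (\<lambda>y. ln (t (1 / y))) x)"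
proof -
  let ?Y = "{y::real. inverse a < ereal y \<and> y \<le> 1/2}"
  note Y = wfun_index_set[OF a]
  have z0: "0 \<le> ln (t (1 / y))" if "y \<in> ?Y" for y using t Y(2)[OF that] by simp
  have bdd: "bdd_below ((\<lambda>y. x * y + ln (t (1 / y))) ` ?Y)"
  proof (rule bdd_belowI2)
    fix y assume y: "y \<in> ?Y"
    have "0 \<le> x * y" using Y(2)[OF y] x by simp
    then show "0 \<le> x * y + ln (t (1 / y))" using z0[OF y] by simp
  qed
  have ne: "?Y \<noteq> {}" using Y(1) by blast
  show "wfun a (\<lambda>y. ln (t (1 / y))) x \<le> wfun a (\<lambda>y. ln (t (1 / y))) x'" if xx: "x \<le> x'"
    unfolding wfun_def
  proof (rule cINF_mono[OF ne bdd])
    fix y assume y: "y \<in> ?Y"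
    then have "x * y \<le> x' * y" using xx Y(2)[OF y] by (intro mult_right_mono) auto
    then show "\<exists>n\<in>?Y. x * n + ln (t (1 / n)) \<le> x' * y + ln (t (1 / y))" using y by (intro bexI[of _ y]) auto
  qed
  define b where "b = wfun a (\<lambda>y. ln (t (1 / y))) x + ln 2"
  have "wfun a (\<lambda>y. ln (t (1 / y))) x < b" by (simp add: b_def)
  then have "\<exists>y\<in>?Y. x * y + ln (t (1 / y)) < b"
    unfolding wfun_def cINF_less_iff[OF ne bdd] .
  then obtain y where y: "y \<in> ?Y" "x * y + ln (t (1 / y)) < wfun a (\<lambda>y. ln (t (1 / y))) x + ln 2"
    unfolding b_def by (elim bexE)
  have q: "0 < y" "2 \<le> 1 / y" "ereal (1 / y) < a" using Y(2)[OF y(1)] by auto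
  have "exp x powr y * t (1 / y) = exp (x * y + ln (t (1 / y)))"
    using t[OF q(2,3)] by (simp add: exp_add powr_def)
  also have "\<dots> \<le> exp (wfun a (\<lambda>y. ln (t (1 / y))) x + ln 2)" using y(2) by simp
  also have "\<dots> = 2 * exp (wfun a (\<lambda>y. ln (t (1 / y))) x)" by (simp add: exp_add)
  finally show "\<exists>q. 2 \<le> q \<and> ereal q < a \<and> exp x powr (1 / q) * t q \<le> 2 * exp (wfun a (\<lambda>y. ln (t (1 / y))) x)"
    using q by (intro exI[of _ "1 / y"]) auto
qed

text \<open>Integral test on the disjoint intervals from 2^-(n+2) to 2^-(n+1). On such an interval
  the antitone \<open>f\<close> is at least its value at the right end, and the length is 2^-n / 4,
  so the partial sums are at most four times the integral.\<close>

lemma summable_dyadic_of_nn_integral: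
  fixes f :: "real \<Rightarrow> real"
  assumes anti: "\<And>e e'. 0 < e \<Longrightarrow> e \<le> e' \<Longrightarrow> f e' \<le> f e" and nn: "\<And>e. 0 \<le> f e"
    and J: "(\<integral>\<^sup>+\<epsilon>\<in>{0..1}. ennreal (f \<epsilon>) \<partial>lborel) < \<infinity>"
  shows "summable (\<lambda>n. f ((1/2) ^ Suc n) * (1/2) ^ n)"
proof -
  define I where "I n = {(1/2::real) ^ (n + 2)<..(1/2) ^ (n + 1)}" for n :: nat
  obtain j where j: "0 \<le> j" "(\<integral>\<^sup>+\<epsilon>\<in>{0..1}. ennreal (f \<epsilon>) \<partial>lborel) = ennreal j"
    using J by (metis ennreal_cases infinity_ennreal_def less_irrefl)
  have pw: "(1/2::real) ^ m \<le> (1/2) ^ n" if "n \<le> m" for m n :: nat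
    using that by (intro power_decreasing) auto
  have uniq: "i = n" if "e \<in> I i" "e \<in> I n" for e i n
  proof (rule ccontr)
    assume "i \<noteq> n"
    then consider "i + 2 \<le> n + 1" | "n + 2 \<le> i + 1" by linarith
    then show False
    proof cases
      case 1
      then have "(1/2::real) ^ (n + 1) \<le> (1/2) ^ (i + 2)" by (rule pw)
      then show False using that unfolding I_def by auto
    next
      case 2
      then have "(1/2::real) ^ (i + 1) \<le> (1/2) ^ (n + 2)" by (rule pw)
      then show False using that unfolding I_def by auto
    qed
  qed
  have part: "(\<Sum>n<m. ennreal (f ((1/2) ^ Suc n)) * indicator (I n) e) \<le> ennreal (f e) * indicator {0..1} e" for m e
  proof (cases "\<exists>i<m. e \<in> I i")
    case True
    then obtain i where i: "i < m" "e \<in> I i" by blast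
    have "(\<Sum>n<m. ennreal (f ((1/2) ^ Suc n)) * indicator (I n) e) = (\<Sum>n<m. if n = i then ennreal (f ((1/2) ^ Suc n)) else 0)"
    proof (intro sum.cong refl)
      fix n
      have "indicator (I n) e = (if n = i then 1 else 0 :: ennreal)"
        using uniq[OF i(2), of n] i(2) by (cases "n = i") (auto simp: indicator_def)
      then show "ennreal (f ((1/2) ^ Suc n)) * indicator (I n) e = (if n = i then ennreal (f ((1/2) ^ Suc n)) else 0)"
        by simp
    qed
    also have "\<dots> = ennreal (f ((1/2) ^ Suc i))" using i(1) by simp
    also have "\<dots> \<le> ennreal (f e)"
    proof (intro ennreal_leI anti)
      show "0 < e" using i(2) less_trans[of 0 "(1/2::real) ^ (i + 2)" e] unfolding I_def by simp
      show "e \<le> (1/2) ^ Suc i" using i(2) unfolding I_def by simp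
    qed
    also have "e \<in> {0..1}"
    proof -
      have "(1/2::real) ^ (i + 1) \<le> 1" by (intro power_le_one) auto
      moreover have "(0::real) < (1/2) ^ (i + 2)" by simp
      ultimately show ?thesis using i(2) unfolding I_def by (simp only: greaterThanAtMost_iff atLeastAtMost_iff) linarith
    qed
    then have "ennreal (f e) = ennreal (f e) * indicator {0..1} e" by simp
    finally show ?thesis .
  next
    case False
    then have "(\<Sum>n<m. ennreal (f ((1/2) ^ Suc n)) * indicator (I n) e) = 0" by (intro sum.neutral) auto
    then show ?thesis by simp
  qed
  have int: "(\<integral>\<^sup>+e. ennreal (f ((1/2) ^ Suc n)) * indicator (I n) e \<partial>lborel) = ennreal (f ((1/2) ^ Suc n) * (1/2) ^ n / 4)" for n
  proof -
    have "(\<integral>\<^sup>+e. ennreal (f ((1/2) ^ Suc n)) * indicator (I n) e \<partial>lborel) = ennreal (f ((1/2) ^ Suc n)) * emeasure lborel (I n)"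
      by (intro nn_integral_cmult_indicator) (simp add: I_def)
    also have "emeasure lborel (I n) = ennreal ((1/2) ^ n / 4)"
      unfolding I_def by (subst emeasure_lborel_Ioc) (auto intro: pw)
    finally show ?thesis using nn by (simp add: ennreal_mult'[symmetric])
  qed
  have "(\<Sum>n<m. f ((1/2) ^ Suc n) * (1/2) ^ n / 4) \<le> j" for m
  proof -
    have "ennreal (\<Sum>n<m. f ((1/2) ^ Suc n) * (1/2) ^ n / 4) = (\<Sum>n<m. ennreal (f ((1/2) ^ Suc n) * (1/2) ^ n / 4))"
      using nn by (intro sum_ennreal[symmetric]) simp
    also have "\<dots> = (\<integral>\<^sup>+e. (\<Sum>n<m. ennreal (f ((1/2) ^ Suc n)) * indicator (I n) e) \<partial>lborel)"
      unfolding int[symmetric] by (intro nn_integral_sum[symmetric]) (simp add: I_def)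
    also have "\<dots> \<le> ennreal j" unfolding j(2)[symmetric] by (intro nn_integral_mono part)
    finally show ?thesis using j(1) by (simp add: ennreal_le_iff)
  qed
  then have "summable (\<lambda>n. f ((1/2) ^ Suc n) * (1/2) ^ n / 4)"
    using nn by (intro summableI_nonneg_bounded) auto
  from summable_mult[OF this, of 4] show ?thesis by simp
qed

lemma ex_entropy_net:
  assumes V: "V \<noteq> {}" and sig: "sigma_lam_finite V d Mc lam" and c: "pm_compact V (rho_lam d Mc lam)"
    and a: "a > 2" and t: "\<And>p. 2 \<le> p \<Longrightarrow> ereal p < a \<Longrightarrow> 1 \<le> t p"
    and J: "(\<integral>\<^sup>+\<epsilon>\<in>{0..1}. ennreal (exp (wfun a (\<lambda>y. ln (t (1 / y))) (Hent V (rho_lam d Mc lam) \<epsilon>))) \<partial>lborel) < \<infinity>"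
  shows "\<exists>sig S E. entropy_net V (Kset d Mc) lam (rho_lam d Mc lam) sig {p. 2 \<le> p \<and> ereal p < a} t S E"
proof -
  define r where "r = rho_lam d Mc lam"
  note rf = rho_lam_facts[OF sig, folded r_def]
  have sym: "r u v = r v u" if "u \<in> V" "v \<in> V" for u v using rf(2) that by blast
  have tri: "r u w \<le> r u v + r v w" if "u \<in> V" "v \<in> V" "w \<in> V" for u v w using rf(3) that by blast
  note cn = cover_num_props[OF c[folded r_def] V _ sym tri]
  have "\<exists>S. S \<subseteq> V \<and> finite S \<and> card S = cover_num V r ((1/2) ^ n) \<and> (\<forall>v\<in>V. \<exists>u\<in>S. r v u \<le> (1/2) ^ n)" for n :: nat
    by (rule cn(1)) auto
  then obtain S where S: "\<And>n. S n \<subseteq> V" "\<And>n. finite (S n)" "\<And>n. card (S n) = cover_num V r ((1/2) ^ n)"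
    "\<And>n v. v \<in> V \<Longrightarrow> \<exists>u\<in>S n. r v u \<le> (1/2) ^ n" by metis
  define W where "W x = wfun a (\<lambda>y. ln (t (1 / y))) x" for x
  \<comment> \<open>The links of stage \<open>n\<close> start from \<open>S (Suc n)\<close>, so the
    entropy is taken at radius 2^-(n+1). The factor 2 pays for a nearly optimal exponent.\<close>
  define E where "E n = 2 * exp (W (Hent V r ((1/2) ^ Suc n)))" for n :: nat
  have H0: "0 \<le> Hent V r e" if "0 < e" for e
    unfolding Hent_def using cn(2)[of e] that by simp
  have Hmono: "Hent V r e' \<le> Hent V r e" if "0 < e" "e \<le> e'" for e e'
    unfolding Hent_def using cn(2)[of e'] cn(3)[of e e'] that by simp
  obtain sg where sg: "\<And>v. v \<in> V \<Longrightarrow> infsum (\<lambda>k. \<bar>lam v k\<bar>) (Kset d Mc) \<le> sg"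
    using sig unfolding sigma_lam_finite_def bdd_above_def by auto
  have sm: "(\<lambda>k. \<bar>lam v k\<bar>) summable_on Kset d Mc" if "v \<in> V" for v
    using sig that unfolding sigma_lam_finite_def by blast
  have "entropy_net V (Kset d Mc) lam r sg {p. 2 \<le> p \<and> ereal p < a} t S E"
  proof
    show "V \<noteq> {}" by (rule V)
    show "countable (Kset d Mc)" by (rule countable_Kset)
    show "(\<Sum>k\<in>B. \<bar>lam v k\<bar>) \<le> sg" if "v \<in> V" "finite B" "B \<subseteq> Kset d Mc" for v B
      by (rule order_trans[OF finite_sum_le_infsum[OF sm] sg]) (use that in auto)
    show "(\<Sum>k\<in>B. \<bar>lam u k - lam v k\<bar>) \<le> r u v" if "u \<in> V" "v \<in> V" "finite B" "B \<subseteq> Kset d Mc" for u v B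
      unfolding r_def rho_lam_def by (rule finite_sum_le_infsum) (use that rf(1) in auto)
    show "2 \<in> {p. 2 \<le> p \<and> ereal p < a}" using a by simp
    show "\<exists>u\<in>S n. r v u \<le> (1/2) ^ n" if "v \<in> V" for n v using S(4)[OF that] .
    show "\<exists>q\<in>{p. 2 \<le> p \<and> ereal p < a}. real (card (S (Suc n))) powr (1 / q) * t q \<le> E n" for n
    proof -
      have h: "0 < (1/2::real) ^ Suc n" by simp
      obtain q where q: "2 \<le> q" "ereal q < a" "exp (Hent V r ((1/2) ^ Suc n)) powr (1 / q) * t q \<le> E n"
        using wfun_props(2)[where t = t, OF a t H0[OF h]] unfolding E_def W_def by blast
      have "exp (Hent V r ((1/2) ^ Suc n)) = real (card (S (Suc n)))"
        unfolding Hent_def S(3) using cn(2)[OF h] by simp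
      then show ?thesis using q(1,2) q(3) by (intro bexI[of _ q]) simp_all
    qed
    have "summable (\<lambda>n. exp (W (Hent V r ((1/2) ^ Suc n))) * (1/2) ^ n)"
    proof (rule summable_dyadic_of_nn_integral[where f = "\<lambda>e. exp (W (Hent V r e))"])
      show "exp (W (Hent V r e')) \<le> exp (W (Hent V r e))" if "0 < e" "e \<le> e'" for e e'
        unfolding W_def exp_le_cancel_iff
        by (rule wfun_props(1)[where t = t, OF a t]) (use that H0[of e'] Hmono[OF that] in auto)
      show "(\<integral>\<^sup>+\<epsilon>\<in>{0..1}. ennreal (exp (W (Hent V r \<epsilon>))) \<partial>lborel) < \<infinity>"
        using J by (simp add: W_def r_def)
    qed simp
    from summable_mult[OF this, of 2] show "summable (\<lambda>n. E n * (1/2) ^ n)"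
      by (simp add: E_def mult.assoc)
    \<comment> \<open>A Dini-type argument: each single point has a small tail outside a finite set,
      and a finite net of radius e/2 transfers this to all of \<open>V\<close>, since
      \<open>r\<close> dominates the difference of two tails.\<close>
    show "\<exists>A. finite A \<and> A \<subseteq> Kset d Mc \<and> (\<forall>v\<in>V. \<forall>B. finite B \<longrightarrow> B \<subseteq> Kset d Mc - A \<longrightarrow> (\<Sum>k\<in>B. \<bar>lam v k\<bar>) \<le> e)"
      if e: "0 < e" for e
    proof -
      obtain U where U: "U \<subseteq> V" "finite U" "\<forall>v\<in>V. \<exists>u\<in>U. r v u \<le> e / 2"
        using pm_compact_finite_net[OF c[folded r_def] _ sym tri, of "e / 2"] e by auto
      have "\<exists>A. finite A \<and> A \<subseteq> Kset d Mc \<and> (\<forall>B. finite B \<longrightarrow> B \<subseteq> Kset d Mc - A \<longrightarrow> (\<Sum>k\<in>B. \<bar>lam u k\<bar>) \<le> e / 2)"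
        if u: "u \<in> V" for u
      proof -
        have "\<forall>\<^sub>F A in finite_subsets_at_top (Kset d Mc). infsum (\<lambda>k. \<bar>lam u k\<bar>) (Kset d Mc) - e / 2 < (\<Sum>k\<in>A. \<bar>lam u k\<bar>)"
          using infsum_tendsto[OF sm[OF u]] e by (intro order_tendstoD) auto
        then obtain A where A: "finite A" "A \<subseteq> Kset d Mc"
          and A': "\<forall>Y. finite Y \<and> A \<subseteq> Y \<and> Y \<subseteq> Kset d Mc \<longrightarrow> infsum (\<lambda>k. \<bar>lam u k\<bar>) (Kset d Mc) - e / 2 < (\<Sum>k\<in>Y. \<bar>lam u k\<bar>)"
          unfolding eventually_finite_subsets_at_top by (elim exE conjE)
        have A'': "infsum (\<lambda>k. \<bar>lam u k\<bar>) (Kset d Mc) - e / 2 < (\<Sum>k\<in>A. \<bar>lam u k\<bar>)"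
          using spec[OF A', of A] A by simp
        have "(\<Sum>k\<in>B. \<bar>lam u k\<bar>) \<le> e / 2" if B: "finite B" "B \<subseteq> Kset d Mc - A" for B
        proof -
          have "(\<Sum>k\<in>A. \<bar>lam u k\<bar>) + (\<Sum>k\<in>B. \<bar>lam u k\<bar>) = (\<Sum>k\<in>A \<union> B. \<bar>lam u k\<bar>)"
            using A B by (intro sum.union_disjoint[symmetric]) auto
          also have "\<dots> \<le> infsum (\<lambda>k. \<bar>lam u k\<bar>) (Kset d Mc)"
            using A B by (intro finite_sum_le_infsum sm u) auto
          finally show ?thesis using A'' by linarith
        qed
        then show ?thesis using A by blast
      qed
      then have "\<forall>u\<in>V. \<exists>A. finite A \<and> A \<subseteq> Kset d Mc \<and> (\<forall>B. finite B \<longrightarrow> B \<subseteq> Kset d Mc - A \<longrightarrow> (\<Sum>k\<in>B. \<bar>lam u k\<bar>) \<le> e / 2)"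
        by (rule ballI)
      from bchoice[OF this] obtain A where A0: "\<forall>u\<in>V. finite (A u) \<and> A u \<subseteq> Kset d Mc \<and>
          (\<forall>B. finite B \<longrightarrow> B \<subseteq> Kset d Mc - A u \<longrightarrow> (\<Sum>k\<in>B. \<bar>lam u k\<bar>) \<le> e / 2)"
        by (elim exE)
      have A: "finite (A u)" "A u \<subseteq> Kset d Mc"
        "finite B \<Longrightarrow> B \<subseteq> Kset d Mc - A u \<Longrightarrow> (\<Sum>k\<in>B. \<bar>lam u k\<bar>) \<le> e / 2" if "u \<in> V" for u B
        using bspec[OF A0 that] by simp_all
      show ?thesis
      proof (intro exI[of _ "\<Union>u\<in>U. A u"] conjI ballI allI impI)
        show "finite (\<Union>u\<in>U. A u)" using U A(1) by blast
        show "(\<Union>u\<in>U. A u) \<subseteq> Kset d Mc" using U A(2) by blast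
        fix v B assume v: "v \<in> V" and B: "finite B" "B \<subseteq> Kset d Mc - (\<Union>u\<in>U. A u)"
        obtain u where u: "u \<in> U" "r v u \<le> e / 2" using U(3) v by blast
        then have uV: "u \<in> V" using U(1) by blast
        have BK: "B \<subseteq> Kset d Mc" using B(2) by blast
        have "(\<Sum>k\<in>B. \<bar>lam v k\<bar>) \<le> (\<Sum>k\<in>B. \<bar>lam v k - lam u k\<bar> + \<bar>lam u k\<bar>)"
          by (intro sum_mono) linarith
        also have "\<dots> = (\<Sum>k\<in>B. \<bar>lam v k - lam u k\<bar>) + (\<Sum>k\<in>B. \<bar>lam u k\<bar>)" by (rule sum.distrib)
        also have "(\<Sum>k\<in>B. \<bar>lam v k - lam u k\<bar>) \<le> r v u"
          unfolding r_def rho_lam_def by (rule finite_sum_le_infsum[OF rf(1)[OF v uV uV] B(1) BK]) simp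
        also have "(\<Sum>k\<in>B. \<bar>lam u k\<bar>) \<le> e / 2" using B u(1) by (intro A(3)[OF uV]) auto
        finally show "(\<Sum>k\<in>B. \<bar>lam v k\<bar>) \<le> e" using u(2) by linarith
      qed
    qed
  qed (use S t in auto)
  then show ?thesis unfolding r_def by blast
qed

section \<open>The orthonormal system\<close>

lemma mom_le_2_iff:
  assumes "f \<in> borel_measurable M" "integrable M (\<lambda>x. (f x)\<^sup>2)" "0 \<le> c"
  shows "mom_le M 2 f c \<longleftrightarrow> (\<integral>x. (f x)\<^sup>2 \<partial>M) \<le> c\<^sup>2"
  using assms by (simp add: mom_le_def nn_integral_eq_integral ennreal_le_iff)

text \<open>Two conventions for functions on \<open>{1..d}\<close> meet here: members of
  \<open>Lbox\<close> are 0 elsewhere, members of the extensional product are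
  \<open>undefined\<close> there.\<close>

lemma Lbox_bij:
  "bij_betw (\<lambda>k. restrict k {1..d}) (Lbox d n) (\<Pi>\<^sub>E s\<in>{1..d}. {1..n s})"
proof (rule bij_betw_byWitness[where f' = "\<lambda>k s. if s \<in> {1..d} then k s else 0"])
  show "\<forall>k\<in>Lbox d n. (\<lambda>s. if s \<in> {1..d} then restrict k {1..d} s else 0) = k"
    by (auto simp: Lbox_def fun_eq_iff)
  show "\<forall>k\<in>\<Pi>\<^sub>E s\<in>{1..d}. {1..n s}. restrict (\<lambda>s. if s \<in> {1..d} then k s else 0) {1..d} = k"
    by (auto simp: fun_eq_iff PiE_def extensional_def)
qed (auto simp: Lbox_def PiE_def)

lemma finite_Lbox: "finite (Lbox d n)"
  using bij_betw_finite[OF Lbox_bij] by (simp add: finite_PiE)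

lemma card_Lbox: "card (Lbox d n) = (\<Prod>s\<in>{1..d}. n s)"
  using bij_betw_same_card[OF Lbox_bij] by (simp add: card_PiE)

lemma sum_Lbox_prod:
  fixes f :: "nat \<Rightarrow> nat \<Rightarrow> real"
  shows "(\<Sum>k\<in>Lbox d n. \<Prod>s\<in>{1..d}. f s (k s)) = (\<Prod>s\<in>{1..d}. \<Sum>i\<in>{1..n s}. f s i)"
proof -
  have "(\<Sum>k\<in>Lbox d n. \<Prod>s\<in>{1..d}. f s (k s)) = (\<Sum>k\<in>Lbox d n. \<Prod>s\<in>{1..d}. f s (restrict k {1..d} s))"
    by (intro sum.cong prod.cong) auto
  also have "\<dots> = (\<Sum>k\<in>(\<Pi>\<^sub>E s\<in>{1..d}. {1..n s}). \<Prod>s\<in>{1..d}. f s (k s))"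
    by (rule sum.reindex_bij_betw[OF Lbox_bij])
  also have "\<dots> = (\<Prod>s\<in>{1..d}. \<Sum>i\<in>{1..n s}. f s i)" by (rule prod_sum_PiE[symmetric]) auto
  finally show ?thesis .
qed

text \<open>Both the sum of products over a box and the cardinality of the box factor over the
  coordinates, so the normalization is distributed as 1/sqrt (n s) to each factor.\<close>

lemma normalized_Lbox_sum:
  "real (card (Lbox d n)) powr (-1/2) * (\<Sum>k\<in>Lbox d n. \<Prod>s\<in>{1..d}. h s (\<xi> (k s) s \<omega>)) =
    (\<Prod>s\<in>{1..d}. nsum \<xi> (h s) (n s) s \<omega>)"
proof -
  have "real (card (Lbox d n)) powr (-1/2) = (\<Prod>s\<in>{1..d}. 1 / sqrt (n s))"
  proof -
    have "real (card (Lbox d n)) powr (-1/2) = (\<Prod>s\<in>{1..d}. real (n s) powr (-1/2))"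
      by (simp add: card_Lbox prod_powr_distrib)
    also have "\<dots> = (\<Prod>s\<in>{1..d}. 1 / sqrt (n s))"
      by (intro prod.cong refl) (simp add: powr_half_sqrt powr_minus_divide)
    finally show ?thesis .
  qed
  then have "real (card (Lbox d n)) powr (-1/2) * (\<Sum>k\<in>Lbox d n. \<Prod>s\<in>{1..d}. h s (\<xi> (k s) s \<omega>)) =
      (\<Prod>s\<in>{1..d}. 1 / sqrt (n s) * (\<Sum>i\<in>{1..n s}. h s (\<xi> i s \<omega>)))"
    unfolding sum_Lbox_prod[where f = "\<lambda>s i. h s (\<xi> i s \<omega>)"] prod.distrib by (rule arg_cong)
  also have "\<dots> = (\<Prod>s\<in>{1..d}. nsum \<xi> (h s) (n s) s \<omega>)"
  proof (rule prod.cong[OF refl])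
    fix s
    have "(\<Sum>i\<in>{1..n s}. h s (\<xi> i s \<omega>)) = (\<Sum>i<n s. h s (\<xi> (Suc i) s \<omega>))"
      by (rule sum.reindex_bij_witness[of _ Suc "\<lambda>i. i - 1"]) auto
    then show "1 / sqrt (n s) * (\<Sum>i\<in>{1..n s}. h s (\<xi> i s \<omega>)) = nsum \<xi> (h s) (n s) s \<omega>"
      by (simp only: nsum_def) simp
  qed
  finally show ?thesis .
qed

locale orthonormal_samples = iid_samples P \<mu> \<xi> d
  for P :: "'w measure" and \<mu> :: "nat \<Rightarrow> 'a measure" and \<xi> :: "nat \<Rightarrow> nat \<Rightarrow> 'w \<Rightarrow> 'a" and d :: nat +
  fixes g :: "nat \<Rightarrow> nat \<Rightarrow> 'a \<Rightarrow> real"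
  assumes d1: "1 \<le> d" and ortho: "orthonormal_sys \<mu> g d"
begin

lemma g_facts:
  assumes "s \<in> {1..d}" "1 \<le> j"
  shows "g s j \<in> borel_measurable (\<mu> s)" "integrable (\<mu> s) (g s j)" "integrable (\<mu> s) (\<lambda>x. (g s j x)\<^sup>2)"
    "(\<integral>x. g s j x \<partial>\<mu> s) = 0" "(\<integral>x. (g s j x)\<^sup>2 \<partial>\<mu> s) = 1"
    "1 \<le> i \<Longrightarrow> (\<integral>x. g s i x * g s j x \<partial>\<mu> s) = (if i = j then 1 else 0)"
proof -
  have *: "\<And>i. 1 \<le> i \<Longrightarrow> g s j \<in> borel_measurable (\<mu> s) \<and> integrable (\<mu> s) (g s j) \<and>
        integrable (\<mu> s) (\<lambda>x. (g s j x)^2) \<and> (\<integral>x. g s j x \<partial>\<mu> s) = 0 \<and>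
        (\<integral>x. g s i x * g s j x \<partial>\<mu> s) = (if i = j then 1 else 0)"
    using ortho assms unfolding orthonormal_sys_def by blast
  show "g s j \<in> borel_measurable (\<mu> s)" "integrable (\<mu> s) (g s j)" "integrable (\<mu> s) (\<lambda>x. (g s j x)\<^sup>2)"
    "(\<integral>x. g s j x \<partial>\<mu> s) = 0" using *[OF assms(2)] by simp_all
  show "(\<integral>x. (g s j x)\<^sup>2 \<partial>\<mu> s) = 1" using *[OF assms(2)] by (simp add: power2_eq_square)
  show "1 \<le> i \<Longrightarrow> (\<integral>x. g s i x * g s j x \<partial>\<mu> s) = (if i = j then 1 else 0)" using * by blast
qed

lemma g_mom2: "s \<in> {1..d} \<Longrightarrow> 1 \<le> j \<Longrightarrow> mom_le (\<mu> s) 2 (g s j) 1"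
  using g_facts[of s j] by (subst mom_le_2_iff) auto

definition Gs :: "real \<Rightarrow> nat \<Rightarrow> real" where
  "Gs p s = (SUP j\<in>{1..}. lpn P (\<lambda>\<omega>. g s j (\<xi> 1 s \<omega>)) p)"

text \<open>The lower bound on \<open>Gs\<close> is Lyapunov's inequality: \<open>g s j\<close> has
  norm 1 in L2, and p is at least 2.\<close>

lemma g_mom:
  assumes G: "G_finite P \<xi> g d p" and p: "2 \<le> p" and s: "s \<in> {1..d}" and j: "1 \<le> j"
  shows "mom_le (\<mu> s) p (g s j) (Gs p s)" "1 \<le> Gs p s"
proof -
  have "lpn P (\<lambda>\<omega>. g s j (\<xi> 1 s \<omega>)) p \<le> Gs p s"
    unfolding Gs_def using G s j by (intro cSUP_upper) (auto simp: G_finite_def)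
  moreover have "integrable P (\<lambda>\<omega>. \<bar>g s j (\<xi> 1 s \<omega>)\<bar> powr p)" using G s j by (auto simp: G_finite_def)
  ultimately have "mom_le P p (\<lambda>\<omega>. g s j (\<xi> 1 s \<omega>)) (Gs p s)"
    using p measurable_compose[OF xi_measurable[OF _ s] g_facts(1)[OF s j], of 1]
    by (subst mom_le_iff_lpn) auto
  then show m: "mom_le (\<mu> s) p (g s j) (Gs p s)"
    using mom_le_xi[OF _ s g_facts(1)[OF s j], of 1] by simp
  interpret mu: prob_space "\<mu> s" using prob_mu s by blast
  have G0: "0 \<le> Gs p s" using mom_leD(2)[OF m] .
  have "mom_le (\<mu> s) 2 (g s j) (Gs p s)" using mu.mom_le_Lyapunov[OF m] p by simp
  then have "1 \<le> (Gs p s)\<^sup>2"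
    using g_facts[OF s j] G0 by (subst (asm) mom_le_2_iff) auto
  then show "1 \<le> Gs p s" using G0 by (simp add: abs_le_square_iff[of 1, simplified] power2_nonneg_ge_1_iff)
qed

lemma tau_eq: "tau P \<xi> g d p = (\<Prod>s\<in>{1..d}. KR p * Gs p s)"
  by (simp add: tau_def Gfun_def Gs_def prod.distrib)

lemma tau_ge_1:
  assumes G: "G_finite P \<xi> g d p" and p: "2 \<le> p"
  shows "1 \<le> tau P \<xi> g d p"
  unfolding tau_eq
proof (rule prod_ge_1)
  fix s assume s: "s \<in> {1..d}"
  have "1 * 1 \<le> KR p * Gs p s"
    using KR_attained(2)[OF p] g_mom(2)[OF G p s, of 1] by (intro mult_mono) auto
  then show "1 \<le> KR p * Gs p s" by simp
qed

definition Rs :: "(nat \<Rightarrow> nat) \<Rightarrow> (nat \<Rightarrow> nat) \<Rightarrow> 'w \<Rightarrow> real" where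
  "Rs n k \<omega> = (\<Prod>s\<in>{1..d}. nsum \<xi> (g s (k s)) (n s) s \<omega>)"

lemma Rs_mom:
  assumes G: "G_finite P \<xi> g d p" and p: "2 \<le> p" and k: "k \<in> Kset d Mc"
  shows "mom_le P p (Rs n k) (tau P \<xi> g d p)"
proof -
  have ks: "1 \<le> k s" if "s \<in> {1..d}" for s using k that by (auto simp: Kset_def)
  show ?thesis
    unfolding Rs_def[abs_def] tau_eq
    by (intro mom_le_prod indep_columns mom_le_nsum g_mom[OF G p] g_facts p ks) auto
qed

lemma single_index_mom:
  assumes i: "\<And>s. s \<in> {1..d} \<Longrightarrow> 1 \<le> i s" and k: "\<And>s. s \<in> {1..d} \<Longrightarrow> 1 \<le> k s"
  shows "mom_le P 2 (\<lambda>\<omega>. \<Prod>s\<in>{1..d}. g s (k s) (\<xi> (i s) s \<omega>)) 1"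
proof -
  have "indep_vars (\<lambda>_. borel) (\<lambda>s \<omega>. (\<lambda>z. g s (k s) (z (i s, s))) (restrict (\<lambda>j. (case j of (i, s) \<Rightarrow> \<xi> i s) \<omega>) {(i s, s)})) {1..d}"
  proof (rule indep_vars_block[OF indep])
    show "(\<lambda>z. g s (k s) (z (i s, s))) \<in> borel_measurable (PiM {(i s, s)} (\<lambda>(i, s). \<mu> s))" if s: "s \<in> {1..d}" for s
      using measurable_compose[OF measurable_component_singleton[of "(i s, s)" "{(i s, s)}" "\<lambda>(i, s). \<mu> s"], of "g s (k s)" borel]
        g_facts(1)[OF s k[OF s]] by simp
    show "{(i s, s)} \<subseteq> {1..} \<times> {1..d}" if "s \<in> {1..d}" for s using i[OF that] that by simp
  qed (auto simp: disjoint_family_on_def)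
  then have "indep_vars (\<lambda>_. borel) (\<lambda>s \<omega>. g s (k s) (\<xi> (i s) s \<omega>)) {1..d}" by simp
  moreover have "mom_le P 2 (\<lambda>\<omega>. g s (k s) (\<xi> (i s) s \<omega>)) 1" if s: "s \<in> {1..d}" for s
    using mom_le_xi[OF i[OF s] s g_facts(1)[OF s k[OF s]]] g_mom2[OF s k[OF s]] by simp
  ultimately have "mom_le P 2 (\<lambda>\<omega>. \<Prod>s\<in>{1..d}. g s (k s) (\<xi> (i s) s \<omega>)) (\<Prod>s\<in>{1..d}. 1)"
    by (intro mom_le_prod) auto
  then show ?thesis by simp
qed

text \<open>\<open>QL\<close> adds up the series for \<open>f_par\<close> over the box, whereas
  \<open>Rs\<close> performs the box sum inside the series. The interchange needs convergence of the
  finitely many series at the sample tuples of the box, which holds off a finite union of null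
  sets.\<close>

lemma Rs_QL:
  assumes v: "v \<in> V" and net: "entropy_net V (Kset d Mc) lam rho sig T t S E"
  shows "AE \<omega> in P. infsum (\<lambda>k. lam v k * Rs n k \<omega>) (Kset d Mc) = QL \<xi> d Mc lam g n v \<omega>"
proof -
  interpret net: entropy_net V "Kset d Mc" lam rho sig T t S E by (rule net)
  obtain A where A: "net.exhaustion A" using net.ex_exhaustion by blast
  define f where "f i \<omega> k = lam v k * (\<Prod>s\<in>{1..d}. g s (k s) (\<xi> (i s) s \<omega>))" for i \<omega> k
  have P: "prob_space P" by (rule prob_space_axioms)
  have "AE \<omega> in P. f i \<omega> summable_on Kset d Mc" if i: "i \<in> Lbox d n" for i
    unfolding f_def
  proof (rule net.AE_summable_on[OF P A v, of 1])
    fix k assume "k \<in> Kset d Mc"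
    then show "mom_le P 2 (\<lambda>\<omega>. \<Prod>s\<in>{1..d}. g s (k s) (\<xi> (i s) s \<omega>)) 1"
      using i by (intro single_index_mom) (auto simp: Lbox_def Kset_def)
  qed simp
  then have "AE \<omega> in P. \<forall>i\<in>Lbox d n. f i \<omega> summable_on Kset d Mc"
    by (intro AE_finite_allI finite_Lbox)
  then show ?thesis
  proof eventually_elim
    fix \<omega> assume sm: "\<forall>i\<in>Lbox d n. f i \<omega> summable_on Kset d Mc"
    define c where "c = real (card (Lbox d n)) powr (-1/2)"
    have "infsum (\<lambda>k. \<Sum>i\<in>B. f i \<omega> k) (Kset d Mc) = (\<Sum>i\<in>B. infsum (f i \<omega>) (Kset d Mc)) \<and>
        (\<lambda>k. \<Sum>i\<in>B. f i \<omega> k) summable_on Kset d Mc" if "finite B" "B \<subseteq> Lbox d n" for B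
      using that
    proof (induction B rule: finite_induct)
      case (insert i B)
      then show ?case using sm by (auto simp: infsum_add summable_on_add)
    qed auto
    then have 1: "infsum (\<lambda>k. \<Sum>i\<in>Lbox d n. f i \<omega> k) (Kset d Mc) = (\<Sum>i\<in>Lbox d n. infsum (f i \<omega>) (Kset d Mc))"
      using finite_Lbox by blast
    have "QL \<xi> d Mc lam g n v \<omega> = c * (\<Sum>i\<in>Lbox d n. infsum (f i \<omega>) (Kset d Mc))"
      unfolding QL_def f_par_def f_def c_def ..
    also have "\<dots> = infsum (\<lambda>k. c * (\<Sum>i\<in>Lbox d n. f i \<omega> k)) (Kset d Mc)"
      unfolding 1[symmetric] by (rule infsum_cmult_right'[symmetric])
    also have "(\<lambda>k. c * (\<Sum>i\<in>Lbox d n. f i \<omega> k)) = (\<lambda>k. lam v k * Rs n k \<omega>)"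
    proof
      fix k
      have "c * (\<Sum>i\<in>Lbox d n. f i \<omega> k) = lam v k * (c * (\<Sum>i\<in>Lbox d n. \<Prod>s\<in>{1..d}. g s (k s) (\<xi> (i s) s \<omega>)))"
        by (simp add: f_def sum_distrib_left mult_ac)
      then show "c * (\<Sum>i\<in>Lbox d n. f i \<omega> k) = lam v k * Rs n k \<omega>"
        unfolding c_def normalized_Lbox_sum[where h = "\<lambda>s. g s (k s)"] Rs_def .
    qed
    finally show "infsum (\<lambda>k. lam v k * Rs n k \<omega>) (Kset d Mc) = QL \<xi> d Mc lam g n v \<omega>" by simp
  qed
qed

text \<open>Orthonormality makes the variance of a linear combination equal to the sum of the
  squared coefficients, exactly as for independent standard normal variables. This identifies the
  limit within a column.\<close>

lemma comb_facts:
  fixes t :: "nat \<Rightarrow> real"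
  assumes s: "s \<in> {1..d}" and J: "finite J" "J \<subseteq> {1..}"
  defines "h \<equiv> \<lambda>x. \<Sum>j\<in>J. t j * g s j x"
  shows "h \<in> borel_measurable (\<mu> s)" "(\<integral>x. h x \<partial>\<mu> s) = 0" "integrable (\<mu> s) (\<lambda>x. (h x)\<^sup>2)"
    "(\<integral>x. (h x)\<^sup>2 \<partial>\<mu> s) = (\<Sum>j\<in>J. (t j)\<^sup>2)"
proof -
  have j1: "1 \<le> j" if "j \<in> J" for j using J that by auto
  note gf = g_facts[OF s j1]
  show "h \<in> borel_measurable (\<mu> s)" unfolding h_def using gf(1) by (intro borel_measurable_sum borel_measurable_times) auto
  show "(\<integral>x. h x \<partial>\<mu> s) = 0" unfolding h_def using gf(2,4) by (subst Bochner_Integration.integral_sum) auto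
  have int: "integrable (\<mu> s) (\<lambda>x. g s i x * g s j x)" if "i \<in> J" "j \<in> J" for i j
  proof (rule Bochner_Integration.integrable_bound)
    show "integrable (\<mu> s) (\<lambda>x. (g s i x)\<^sup>2 + (g s j x)\<^sup>2)" using gf(3) that by (intro Bochner_Integration.integrable_add) auto
    show "(\<lambda>x. g s i x * g s j x) \<in> borel_measurable (\<mu> s)" using gf(1) that by (intro borel_measurable_times) auto
    have "\<bar>u * w\<bar> \<le> u\<^sup>2 + w\<^sup>2" for u w :: real
    proof -
      have "2 * (\<bar>u\<bar> * \<bar>w\<bar>) \<le> u\<^sup>2 + w\<^sup>2" using sum_squares_bound[of "\<bar>u\<bar>" "\<bar>w\<bar>"] by simp
      moreover have "0 \<le> \<bar>u\<bar> * \<bar>w\<bar>" by simp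
      ultimately show ?thesis unfolding abs_mult by linarith
    qed
    then show "AE x in \<mu> s. norm (g s i x * g s j x) \<le> norm ((g s i x)\<^sup>2 + (g s j x)\<^sup>2)"
      by (intro AE_I2) (simp add: order_trans[OF _ abs_ge_self])
  qed
  have sq: "(h x)\<^sup>2 = (\<Sum>i\<in>J. \<Sum>j\<in>J. t i * t j * (g s i x * g s j x))" for x
    unfolding h_def power2_eq_square sum_product by (simp add: mult_ac)
  show "integrable (\<mu> s) (\<lambda>x. (h x)\<^sup>2)"
    unfolding sq using int by (intro Bochner_Integration.integrable_sum integrable_mult_right) auto
  have "(\<integral>x. (h x)\<^sup>2 \<partial>\<mu> s) = (\<Sum>i\<in>J. \<Sum>j\<in>J. t i * t j * (\<integral>x. g s i x * g s j x \<partial>\<mu> s))"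
    unfolding sq using int by (simp add: Bochner_Integration.integral_sum)
  also have "\<dots> = (\<Sum>i\<in>J. \<Sum>j\<in>J. if i = j then (t i)\<^sup>2 else 0)"
    using gf(6) j1 by (intro sum.cong refl) (auto simp: power2_eq_square)
  also have "\<dots> = (\<Sum>i\<in>J. (t i)\<^sup>2)" using J(1) by simp
  finally show "(\<integral>x. (h x)\<^sup>2 \<partial>\<mu> s) = (\<Sum>j\<in>J. (t j)\<^sup>2)" .
qed

end

text \<open>The cosine is written as the real part of a complex exponential, which independence
  factors.\<close>

lemma (in prob_space) expectation_cos_sum:
  fixes Y :: "'i \<Rightarrow> 'a \<Rightarrow> real"
  assumes I: "finite I" and Y: "indep_vars (\<lambda>_. borel) Y I"
  shows "expectation (\<lambda>\<omega>. cos ((\<Sum>i\<in>I. Y i \<omega>) + \<theta>)) = Re (iexp \<theta> * (\<Prod>i\<in>I. \<integral>\<omega>. iexp (Y i \<omega>) \<partial>M))"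
proof -
  have Ym: "random_variable borel (Y i)" if "i \<in> I" for i using Y that by (auto simp: indep_vars_def)
  have int: "integrable M (\<lambda>\<omega>. iexp (Y i \<omega>))" if "i \<in> I" for i
    using Ym[OF that] by (intro integrable_const_bound[of _ 1]) auto
  have ind: "indep_vars (\<lambda>_. borel) (\<lambda>i \<omega>. iexp (Y i \<omega>)) I"
    by (rule indep_vars_compose2[OF Y]) measurable
  have "iexp \<theta> * (\<Prod>i\<in>I. iexp (Y i \<omega>)) = iexp ((\<Sum>i\<in>I. Y i \<omega>) + \<theta>)" for \<omega>
    using I by (simp add: exp_sum[symmetric] exp_add[symmetric] sum_distrib_left algebra_simps)
  then have "cos ((\<Sum>i\<in>I. Y i \<omega>) + \<theta>) = Re (iexp \<theta> * (\<Prod>i\<in>I. iexp (Y i \<omega>)))" for \<omega>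
    by (simp add: Re_exp)
  then have "expectation (\<lambda>\<omega>. cos ((\<Sum>i\<in>I. Y i \<omega>) + \<theta>)) = expectation (\<lambda>\<omega>. Re (iexp \<theta> * (\<Prod>i\<in>I. iexp (Y i \<omega>))))"
    by simp
  also have "\<dots> = Re (\<integral>\<omega>. iexp \<theta> * (\<Prod>i\<in>I. iexp (Y i \<omega>)) \<partial>M)"
    using indep_vars_integrable[OF I ind int] by (intro integral_Re integrable_mult_right) auto
  also have "\<dots> = Re (iexp \<theta> * (\<Prod>i\<in>I. \<integral>\<omega>. iexp (Y i \<omega>) \<partial>M))"
    using indep_vars_lebesgue_integral[OF I ind int] by simp
  finally show ?thesis .
qed

locale gaussian_array = prob_space N for N :: "'u measure" +
  fixes \<beta> :: "nat \<Rightarrow> nat \<Rightarrow> 'u \<Rightarrow> real" and d :: nat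
  assumes indep_beta: "indep_vars (\<lambda>_. borel) (\<lambda>(s, j). \<beta> s j) ({1..d} \<times> {1..})"
    and normal: "s \<in> {1..d} \<Longrightarrow> 1 \<le> j \<Longrightarrow> distributed N lborel (\<beta> s j) std_normal_density"
begin

lemma beta_distr:
  assumes "s \<in> {1..d}" "1 \<le> j"
  shows "\<beta> s j \<in> borel_measurable N" "distr N borel (\<beta> s j) = std_normal_distribution"
proof -
  note n = normal[OF assms]
  show "\<beta> s j \<in> borel_measurable N" using distributed_measurable[OF n] by simp
  have "distr N borel (\<beta> s j) = distr N lborel (\<beta> s j)" by (rule distr_cong) auto
  also have "\<dots> = std_normal_distribution" by (rule distributed_distr_eq_density[OF n])
  finally show "distr N borel (\<beta> s j) = std_normal_distribution" .
qed

lemma beta_mom: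
  assumes s: "s \<in> {1..d}" "1 \<le> j" and c: "mom_le std_normal_distribution p (\<lambda>x. x) c"
  shows "mom_le N p (\<beta> s j) c"
  using c mom_le_distr[OF beta_distr(1)[OF s], of "\<lambda>x. x" p c] unfolding beta_distr(2)[OF s] by simp

lemma beta_prod_mom:
  assumes k: "\<And>s. s \<in> {1..d} \<Longrightarrow> 1 \<le> k s" and c: "\<And>s. s \<in> {1..d} \<Longrightarrow> mom_le std_normal_distribution p (\<lambda>x. x) (c s)"
  shows "mom_le N p (\<lambda>\<omega>. \<Prod>s\<in>{1..d}. \<beta> s (k s) \<omega>) (\<Prod>s\<in>{1..d}. c s)"
proof (rule mom_le_prod)
  have "indep_vars (\<lambda>_. borel) (\<lambda>s \<omega>. (\<lambda>z. z (s, k s)) (restrict (\<lambda>j. (case j of (s, j) \<Rightarrow> \<beta> s j) \<omega>) {(s, k s)})) {1..d}"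
  proof (rule indep_vars_block[OF indep_beta])
    show "(\<lambda>z. z (s, k s)) \<in> borel_measurable (PiM {(s, k s)} (\<lambda>_. borel))" for s
      by (rule measurable_component_singleton) simp
    show "{(s, k s)} \<subseteq> {1..d} \<times> {1..}" if "s \<in> {1..d}" for s using k[OF that] that by simp
  qed (auto simp: disjoint_family_on_def)
  then show "indep_vars (\<lambda>_. borel) (\<lambda>s. \<beta> s (k s)) {1..d}" by simp
qed (use k c beta_mom in auto)

lemma beta_cos:
  assumes J: "finite J" "J \<subseteq> {1..}"
  shows "expectation (\<lambda>\<omega>. cos ((\<Sum>i\<in>{1..d} \<times> J. t i * (case i of (s, j) \<Rightarrow> \<beta> s j) \<omega>) + \<theta>))
    = Re (iexp \<theta> * (\<Prod>i\<in>{1..d} \<times> J. complex_of_real (exp (- (t i)\<^sup>2 / 2))))"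
proof -
  have "indep_vars (\<lambda>_. borel) (\<lambda>i. (\<lambda>(s, j). \<beta> s j) i) ({1..d} \<times> J)"
    using J by (intro indep_vars_subset[OF indep_beta]) auto
  then have "indep_vars (\<lambda>_. borel) (\<lambda>i \<omega>. t i * (case i of (s, j) \<Rightarrow> \<beta> s j) \<omega>) ({1..d} \<times> J)"
    by (rule indep_vars_compose2[where Y = "\<lambda>i x. t i * x"]) measurable
  then have "expectation (\<lambda>\<omega>. cos ((\<Sum>i\<in>{1..d} \<times> J. t i * (case i of (s, j) \<Rightarrow> \<beta> s j) \<omega>) + \<theta>))
    = Re (iexp \<theta> * (\<Prod>i\<in>{1..d} \<times> J. \<integral>\<omega>. iexp (t i * (case i of (s, j) \<Rightarrow> \<beta> s j) \<omega>) \<partial>N))"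
    using J by (intro expectation_cos_sum) auto
  also have "(\<Prod>i\<in>{1..d} \<times> J. \<integral>\<omega>. iexp (t i * (case i of (s, j) \<Rightarrow> \<beta> s j) \<omega>) \<partial>N) = (\<Prod>i\<in>{1..d} \<times> J. complex_of_real (exp (- (t i)\<^sup>2 / 2)))"
  proof (rule prod.cong[OF refl])
    fix i assume i: "i \<in> {1..d} \<times> J"
    obtain s j where ij: "i = (s, j)" by (cases i)
    then have sj: "s \<in> {1..d}" "1 \<le> j" using i J by auto
    have "(\<integral>\<omega>. iexp (t i * \<beta> s j \<omega>) \<partial>N) = char (distr N borel (\<beta> s j)) (t i)"
      unfolding char_def using beta_distr(1)[OF sj] by (subst integral_distr) auto
    also have "\<dots> = complex_of_real (exp (- (t i)\<^sup>2 / 2))"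
      unfolding beta_distr(2)[OF sj] by (simp add: char_std_normal_distribution)
    finally show "(\<integral>\<omega>. iexp (t i * (case i of (s, j) \<Rightarrow> \<beta> s j) \<omega>) \<partial>N) = complex_of_real (exp (- (t i)\<^sup>2 / 2))"
      by (simp add: ij)
  qed
  finally show ?thesis .
qed

end

context orthonormal_samples
begin

text \<open>The Cramer-Wold device. Within column \<open>s\<close> the combination of the
  \<open>g s j\<close> is a single centered function \<open>h s\<close>, to which the
  one-dimensional limit theorem applies; the columns are independent, so the limits multiply as
  every \<open>n s\<close> grows.\<close>

lemma cos_tendsto:
  fixes N :: "'u measure"
  assumes N: "gaussian_array N \<beta> d" and J: "finite J" "J \<subseteq> {1..}"
    and Fl: "\<And>s. s \<in> {1..d} \<Longrightarrow> filterlim (\<lambda>n. n s) at_top Fl"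
  shows "((\<lambda>n. \<integral>\<omega>. cos ((\<Sum>i\<in>{1..d} \<times> J. t i * (case i of (s, j) \<Rightarrow> nsum \<xi> (g s j) (n s) s) \<omega>) + \<theta>) \<partial>P)
    \<longlongrightarrow> (\<integral>\<omega>. cos ((\<Sum>i\<in>{1..d} \<times> J. t i * (case i of (s, j) \<Rightarrow> \<beta> s j) \<omega>) + \<theta>) \<partial>N)) Fl"
proof -
  interpret N: gaussian_array N \<beta> d by (rule N)
  define h where "h s x = (\<Sum>j\<in>J. t (s, j) * g s j x)" for s x
  have h: "h s \<in> borel_measurable (\<mu> s)" "(\<integral>x. h s x \<partial>\<mu> s) = 0" "integrable (\<mu> s) (\<lambda>x. (h s x)\<^sup>2)"
    "(\<integral>x. (h s x)\<^sup>2 \<partial>\<mu> s) = (\<Sum>j\<in>J. (t (s, j))\<^sup>2)" if "s \<in> {1..d}" for s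
    using comb_facts[OF that J, of "\<lambda>j. t (s, j)"] unfolding h_def[abs_def] by auto
  have sum: "(\<Sum>i\<in>{1..d} \<times> J. t i * (case i of (s, j) \<Rightarrow> nsum \<xi> (g s j) (n s) s) \<omega>) = (\<Sum>s\<in>{1..d}. nsum \<xi> (h s) (n s) s \<omega>)" for n \<omega>
  proof -
    have "(\<Sum>i\<in>{1..d} \<times> J. t i * (case i of (s, j) \<Rightarrow> nsum \<xi> (g s j) (n s) s) \<omega>) = (\<Sum>s\<in>{1..d}. \<Sum>j\<in>J. t (s, j) * nsum \<xi> (g s j) (n s) s \<omega>)"
      by (subst sum.cartesian_product) (auto intro!: sum.cong)
    also have "\<dots> = (\<Sum>s\<in>{1..d}. nsum \<xi> (h s) (n s) s \<omega>)"
    proof (rule sum.cong[OF refl])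
      fix s
      show "(\<Sum>j\<in>J. t (s, j) * nsum \<xi> (g s j) (n s) s \<omega>) = nsum \<xi> (h s) (n s) s \<omega>"
        unfolding nsum_def h_def by (subst sum.swap) (simp add: sum_distrib_left sum_divide_distrib)
    qed
    finally show ?thesis .
  qed
  have "((\<lambda>n. Re (iexp \<theta> * (\<Prod>s\<in>{1..d}. \<integral>\<omega>. iexp (nsum \<xi> (h s) (n s) s \<omega>) \<partial>P))) \<longlongrightarrow>
      Re (iexp \<theta> * (\<Prod>s\<in>{1..d}. complex_of_real (exp (- (\<Sum>j\<in>J. (t (s, j))\<^sup>2) / 2))))) Fl"
    by (intro tendsto_Re tendsto_mult tendsto_const tendsto_prod filterlim_compose[OF nsum_char Fl] h)
  moreover have "(\<integral>\<omega>. cos ((\<Sum>s\<in>{1..d}. nsum \<xi> (h s) (n s) s \<omega>) + \<theta>) \<partial>P) = Re (iexp \<theta> * (\<Prod>s\<in>{1..d}. \<integral>\<omega>. iexp (nsum \<xi> (h s) (n s) s \<omega>) \<partial>P))" for n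
    by (intro expectation_cos_sum indep_columns h) auto
  moreover have "(\<Prod>s\<in>{1..d}. complex_of_real (exp (- (\<Sum>j\<in>J. (t (s, j))\<^sup>2) / 2))) = (\<Prod>i\<in>{1..d} \<times> J. complex_of_real (exp (- (t i)\<^sup>2 / 2)))"
  proof -
    have "exp (- (\<Sum>j\<in>J. (t (s, j))\<^sup>2) / 2) = (\<Prod>j\<in>J. exp (- (t (s, j))\<^sup>2 / 2))" for s
      using J(1) by (simp add: exp_sum[symmetric] sum_negf[symmetric] sum_divide_distrib)
    then show ?thesis by (simp add: prod.cartesian_product)
  qed
  ultimately show ?thesis unfolding sum N.beta_cos[OF J] by simp
qed

end

section \<open>The main theorem\<close>

context entropy_net
begin

text \<open>The supremum is 1-Lipschitz in the sup norm but unbounded, so it is clipped to fit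
  \<open>bounded_cont_fun\<close>. Letting the clipping level grow then yields measurability of a
  supremum over a possibly uncountable \<open>V\<close>.\<close>

lemma bounded_cont_fun_clipped_SUP:
  assumes bdd: "\<And>h. h \<in> CV V rho \<Longrightarrow> bdd_above ((\<lambda>v. \<bar>h v\<bar>) ` V)" and B: "0 \<le> B"
  shows "bounded_cont_fun V rho (\<lambda>h. max (- B) (min B (SUP v\<in>V. h v)))"
  unfolding bounded_cont_fun_supn
proof (intro conjI ballI allI impI)
  have "\<bar>max (- B) (min B (SUP v\<in>V. h v))\<bar> \<le> B" for h using B by auto
  then show "\<exists>C. \<forall>h\<in>CV V rho. \<bar>max (- B) (min B (SUP v\<in>V. h v))\<bar> \<le> C" by blast
  fix h and e :: real assume h: "h \<in> CV V rho" and e: "0 < e"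
  have bd: "bdd_above (h ` V)" "bdd_above ((\<lambda>v. \<bar>h v\<bar>) ` V)" if "h \<in> CV V rho" for h
    using bdd[OF that] by (auto simp: bdd_above_def abs_le_iff)
  show "\<exists>\<delta>>0. \<forall>h'\<in>CV V rho. supn (\<lambda>v. h' v - h v) < \<delta> \<longrightarrow>
    \<bar>max (- B) (min B (SUP v\<in>V. h' v)) - max (- B) (min B (SUP v\<in>V. h v))\<bar> < e"
  proof (intro exI[of _ e] conjI ballI impI e)
    fix h' assume h': "h' \<in> CV V rho" and s: "supn (\<lambda>v. h' v - h v) < e"
    obtain b b' where b: "\<And>v. v \<in> V \<Longrightarrow> \<bar>h v\<bar> \<le> b" "\<And>v. v \<in> V \<Longrightarrow> \<bar>h' v\<bar> \<le> b'"
      using bd(2)[OF h] bd(2)[OF h'] unfolding bdd_above_def by auto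
    have "bdd_above ((\<lambda>v. \<bar>h' v - h v\<bar>) ` V)"
    proof (rule bdd_aboveI2)
      show "\<bar>h' v - h v\<bar> \<le> b + b'" if "v \<in> V" for v using b[OF that] by linarith
    qed
    then have "\<bar>h' v - h v\<bar> \<le> supn (\<lambda>v. h' v - h v)" if "v \<in> V" for v
      unfolding supn_def using that by (intro cSUP_upper)
    then have "\<bar>(SUP v\<in>V. h' v) - (SUP v\<in>V. h v)\<bar> \<le> supn (\<lambda>v. h' v - h v)"
      by (intro abs_SUP_diff_le V_ne bd h h')
    then show "\<bar>max (- B) (min B (SUP v\<in>V. h' v)) - max (- B) (min B (SUP v\<in>V. h v))\<bar> < e"
      using s by (auto simp: max_def min_def abs_if split: if_splits)
  qed
qed

lemma measurable_SUP:
  assumes bdd: "\<And>h. h \<in> CV V rho \<Longrightarrow> bdd_above ((\<lambda>v. \<bar>h v\<bar>) ` V)"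
    and FY: "\<And>F. bounded_cont_fun V rho F \<Longrightarrow> (\<lambda>\<omega>. F (Y \<omega>)) \<in> borel_measurable M"
  shows "(\<lambda>\<omega>. SUP v\<in>V. Y \<omega> v) \<in> borel_measurable M"
proof (rule borel_measurable_LIMSEQ_real)
  show "(\<lambda>\<omega>. max (- real k) (min (real k) (SUP v\<in>V. Y \<omega> v))) \<in> borel_measurable M" for k
    by (intro FY[of "\<lambda>h. max (- real k) (min (real k) (SUP v\<in>V. h v))"] bounded_cont_fun_clipped_SUP bdd) auto
  show "(\<lambda>k. max (- real k) (min (real k) (SUP v\<in>V. Y \<omega> v))) \<longlonglongrightarrow> (SUP v\<in>V. Y \<omega> v)" for \<omega>
  proof (rule tendsto_eventually)
    obtain k0 :: nat where "\<bar>SUP v\<in>V. Y \<omega> v\<bar> \<le> real k0" using real_arch_simple by blast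
    then show "\<forall>\<^sub>F k in sequentially. max (- real k) (min (real k) (SUP v\<in>V. Y \<omega> v)) = (SUP v\<in>V. Y \<omega> v)"
      unfolding eventually_sequentially by (intro exI[of _ k0]) auto
  qed
qed

lemma abs_SUP_le_supn:
  assumes b: "bdd_above ((\<lambda>v. \<bar>h v\<bar>) ` V)"
  shows "\<bar>SUP v\<in>V. h v\<bar> \<le> supn h"
proof -
  have up: "\<bar>h v\<bar> \<le> supn h" if "v \<in> V" for v unfolding supn_def using that b by (intro cSUP_upper)
  then have bh: "bdd_above (h ` V)" by (intro bdd_aboveI2) (auto simp: abs_le_iff)
  have "(SUP v\<in>V. h v) \<le> supn h" using up by (intro cSUP_least V_ne) (auto simp: abs_le_iff)
  moreover obtain v where v: "v \<in> V" using V_ne by blast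
  have "- supn h \<le> h v" using up[OF v] by linarith
  then have "- supn h \<le> (SUP v\<in>V. h v)" using cSUP_upper[OF v bh] by linarith
  ultimately show ?thesis by linarith
qed

end

theorem theorem8p2:
  fixes P :: "'w measure" and \<mu> :: "nat \<Rightarrow> 'a measure" and \<xi> :: "nat \<Rightarrow> nat \<Rightarrow> 'w \<Rightarrow> 'a"
    and N :: "'u measure" and \<beta> :: "nat \<Rightarrow> nat \<Rightarrow> 'u \<Rightarrow> real"
    and d :: nat and Mc :: enat and g :: "nat \<Rightarrow> nat \<Rightarrow> 'a \<Rightarrow> real"
    and V :: "'v set" and lam :: "'v \<Rightarrow> (nat \<Rightarrow> nat) \<Rightarrow> real" and a :: ereal
  assumes "d \<ge> 1" and "V \<noteq> {}"
    and "prob_space P" and "\<forall>s\<in>{1..d}. prob_space (\<mu> s)"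
    and "prob_space.indep_vars P (\<lambda>(i, s). \<mu> s) (\<lambda>(i, s). \<xi> i s) ({1..} \<times> {1..d})"
    and "\<forall>i\<ge>1. \<forall>s\<in>{1..d}. distr P (\<mu> s) (\<xi> i s) = \<mu> s"
    and "orthonormal_sys \<mu> g d"
    and "prob_space N"
    and "prob_space.indep_vars N (\<lambda>_. borel) (\<lambda>(s, j). \<beta> s j) ({1..d} \<times> {1..})"
    and "\<forall>s\<in>{1..d}. \<forall>j\<ge>1. distributed N lborel (\<beta> s j) std_normal_density"
    and "sigma_lam_finite V d Mc lam"
    and "pm_compact V (rho_lam d Mc lam)"
    and "a > 2"
    and "\<forall>p. 2 \<le> p \<and> ereal p < a \<longrightarrow> G_finite P \<xi> g d p"
    and "(\<integral>\<^sup>+\<epsilon>\<in>{0..1}. ennreal (exp (wfun a (\<lambda>y. ln (tau P \<xi> g d (1 / y)))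
            (Hent V (rho_lam d Mc lam) \<epsilon>))) \<partial>lborel) < \<infinity>"
  shows "\<exists>Y Z.
     (\<forall>n. (\<forall>s\<in>{1..d}. 1 \<le> n s) \<longrightarrow> cont_version P V (rho_lam d Mc lam) (Y n) (QL \<xi> d Mc lam g n)) \<and>
     cont_version N V (rho_lam d Mc lam) Z (Qinf \<beta> d Mc lam) \<and>
     (\<forall>F. bounded_cont_fun V (rho_lam d Mc lam) F \<longrightarrow>
        (\<forall>n. (\<forall>s\<in>{1..d}. 1 \<le> n s) \<longrightarrow> (\<lambda>\<omega>. F (Y n \<omega>)) \<in> borel_measurable P) \<and>
        (\<lambda>\<omega>. F (Z \<omega>)) \<in> borel_measurable N \<and>
        (\<forall>e>0. \<exists>m. \<forall>n. (\<forall>s\<in>{1..d}. 1 \<le> n s \<and> m \<le> n s) \<longrightarrow>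
            \<bar>(\<integral>\<omega>. F (Y n \<omega>) \<partial>P) - (\<integral>\<omega>. F (Z \<omega>) \<partial>N)\<bar> < e)) \<and>
     (\<exists>C. \<forall>n. (\<forall>s\<in>{1..d}. 1 \<le> n s) \<longrightarrow> (\<forall>p. 2 \<le> p \<and> ereal p < a \<longrightarrow>
        integrable P (\<lambda>\<omega>. \<bar>SUP v\<in>V. Y n \<omega> v\<bar> powr p) \<and>
        lpn P (\<lambda>\<omega>. SUP v\<in>V. Y n \<omega> v) p \<le> C * tau P \<xi> g d p))"
proof -
  note d1 = assms(1) and V = assms(2) and P = assms(3) and mu = assms(4) and ind = assms(5) and dis = assms(6)
    and ort = assms(7) and N = assms(8) and indN = assms(9) and nor = assms(10) and sig = assms(11)
    and cpt = assms(12) and a = assms(13) and G = assms(14) and J = assms(15)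
  define rho where "rho = rho_lam d Mc lam"
  define K where "K = Kset d Mc"
  define T where "T = {p. 2 \<le> p \<and> ereal p < a}"
  interpret P: prob_space P by fact
  interpret N: prob_space N by fact
  interpret os: orthonormal_samples P \<mu> \<xi> d g
  proof (intro orthonormal_samples.intro iid_samples.intro iid_samples_axioms.intro orthonormal_samples_axioms.intro P)
    show "prob_space (\<mu> s)" if "s \<in> {1..d}" for s using mu that by (rule bspec)
    show "P.indep_vars (\<lambda>(i, s). \<mu> s) (\<lambda>(i, s). \<xi> i s) ({1..} \<times> {1..d})" by (rule ind)
    show "distr P (\<mu> s) (\<xi> i s) = \<mu> s" if "1 \<le> i" "s \<in> {1..d}" for i s using dis that by blast
    show "1 \<le> d" by (rule d1)
    show "orthonormal_sys \<mu> g d" by (rule ort)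
  qed
  interpret gs: gaussian_array N \<beta> d
  proof (intro gaussian_array.intro gaussian_array_axioms.intro N)
    show "N.indep_vars (\<lambda>_. borel) (\<lambda>(s, j). \<beta> s j) ({1..d} \<times> {1..})" by (rule indN)
    show "distributed N lborel (\<beta> s j) std_normal_density" if "s \<in> {1..d}" "1 \<le> j" for s j using nor that by blast
  qed
  have GT: "G_finite P \<xi> g d p" "2 \<le> p" if "p \<in> T" for p using G that by (auto simp: T_def)
  have T2: "2 \<in> T" using a by (simp add: T_def)
  have t1: "1 \<le> tau P \<xi> g d p" if "2 \<le> p" "ereal p < a" for p
    using G that by (intro os.tau_ge_1) auto
  have "\<exists>sg S E. entropy_net V (Kset d Mc) lam (rho_lam d Mc lam) sg {p. 2 \<le> p \<and> ereal p < a} (tau P \<xi> g d) S E"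
    by (rule ex_entropy_net[OF V sig cpt a _ J]) (rule t1)
  then obtain sg S E where net: "entropy_net V K lam rho sg T (tau P \<xi> g d) S E"
    unfolding rho_def K_def T_def by (elim exE)
  interpret net: entropy_net V K lam rho sg T "tau P \<xi> g d" S E by (rule net)
  obtain A where A: "net.exhaustion A" using net.ex_exhaustion by blast
  have bdd: "bdd_above ((\<lambda>v. \<bar>h v\<bar>) ` V)" if "h \<in> CV V rho" for h
    by (rule CV_bounded[OF cpt that[unfolded rho_def]])
  have K1: "1 \<le> k s" if "k \<in> K" "s \<in> {1..d}" for k s using that by (auto simp: K_def Kset_def)
  have Rmom: "mom_le P q (os.Rs n k) (tau P \<xi> g d q)" if "k \<in> K" "q \<in> T" for n k q
    using os.Rs_mom[OF GT[OF that(2)] that(1)[unfolded K_def]] .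
  have normal_mom: "mom_le std_normal_distribution q (\<lambda>x. x) (KR q * os.Gs q s)" if "q \<in> T" "s \<in> {1..d}" for q s
    using os.std_normal_moment_le[OF that(2) GT(2)[OF that(1)] os.g_mom(1)[OF GT[OF that(1)] that(2) order_refl]]
      os.g_facts(3-5)[OF that(2) order_refl] by blast
  define RZ where "RZ k \<omega> = (\<Prod>s\<in>{1..d}. \<beta> s (k s) \<omega>)" for k \<omega>
  have RZmom: "mom_le N q (RZ k) (tau P \<xi> g d q)" if "k \<in> K" "q \<in> T" for k q
    unfolding RZ_def[abs_def] os.tau_eq
    by (rule gs.beta_prod_mom) (use K1[OF that(1)] normal_mom[OF that(2)] in auto)
  \<comment> \<open>The same exhaustion \<open>A\<close> is used for every \<open>n\<close> and for
    the Gaussian field, so that truncations of both can be compared level by level.\<close>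
  have "\<exists>Y. net.field_version P A (os.Rs n) Y" for n
    by (rule net.ex_field_version[OF P A Rmom])
  then obtain Y where "\<And>n. net.field_version P A (os.Rs n) (Y n)" by metis
  note Y = net.field_versionD[OF this]
  have "\<exists>Z. net.field_version N A RZ Z"
    by (rule net.ex_field_version[OF N A RZmom])
  then obtain Z where "net.field_version N A RZ Z" by (elim exE)
  note Z = net.field_versionD(1,4,5)[OF this]
  have YQ: "cont_version P V rho (Y n) (QL \<xi> d Mc lam g n)" for n
    unfolding cont_version_def
  proof (intro conjI ballI)
    fix v assume v: "v \<in> V"
    have "AE \<omega> in P. Y n \<omega> v = infsum (\<lambda>k. lam v k * os.Rs n k \<omega>) K"
      using Y(1)[of n] v by (simp add: cont_version_def)
    then show "AE \<omega> in P. Y n \<omega> v = QL \<xi> d Mc lam g n v \<omega>"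
      using os.Rs_QL[OF v net[unfolded K_def], of n, folded K_def] by eventually_elim simp
  qed (use Y(1)[of n] in \<open>auto simp: cont_version_def\<close>)
  have ZQ: "cont_version N V rho Z (Qinf \<beta> d Mc lam)"
    using Z(1) by (simp add: Qinf_def[abs_def] RZ_def K_def)
  have YC: "Y n \<omega> \<in> CV V rho" if "\<omega> \<in> space P" for n \<omega> using YQ[of n] that by (simp add: cont_version_def)
  have ZC: "Z \<omega> \<in> CV V rho" if "\<omega> \<in> space N" for \<omega> using ZQ that by (simp add: cont_version_def)
  \<comment> \<open>The filter of boxes whose shortest side tends to infinity.\<close>
  define Fl where "Fl = filtercomap (\<lambda>n::nat \<Rightarrow> nat. Min (n ` {1..d})) at_top"
  have Min_ge: "Min (n ` {1..d}) \<ge> m \<longleftrightarrow> (\<forall>s\<in>{1..d}. m \<le> n s)" for n :: "nat \<Rightarrow> nat" and m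
    using d1 by (subst Min_ge_iff) auto
  have Fl: "filterlim (\<lambda>n. n s) at_top Fl" if "s \<in> {1..d}" for s
  proof (rule filterlim_at_top_mono)
    show "filterlim (\<lambda>n. Min (n ` {1..d})) at_top Fl" unfolding Fl_def by (rule filterlim_filtercomap)
    show "\<forall>\<^sub>F n in Fl. Min (n ` {1..d}) \<le> n s" using that by (intro always_eventually allI Min_le) auto
  qed
  have trunc: "((\<lambda>n. \<integral>\<omega>. F (net.lin (A m) (\<lambda>k. os.Rs n k \<omega>)) \<partial>P) \<longlongrightarrow> (\<integral>\<omega>. F (net.lin (A m) (\<lambda>k. RZ k \<omega>)) \<partial>N)) Fl"
    if F: "bounded_cont_fun V rho F" for F m
  proof -
    have fin: "finite (A m)" "A m \<subseteq> K" using net.exhaustionD(1,2)[OF A] by auto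
    \<comment> \<open>The basis indices occurring in the multi-indices of \<open>A m\<close>. There
      are finitely many, so the truncated field is a continuous function of finitely many normalized
      sums.\<close>
    define Jm where "Jm = (\<Union>k\<in>A m. k ` {1..d})"
    have Jm: "finite Jm" "Jm \<subseteq> {1..}" using fin K1 by (auto simp: Jm_def)
    define I where "I = {1..d} \<times> Jm"
    define \<phi> where "\<phi> x = F (net.lin (A m) (\<lambda>k. \<Prod>s\<in>{1..d}. x (s, k s)))" for x :: "nat \<times> nat \<Rightarrow> real"
    obtain B where B: "\<And>h. h \<in> CV V rho \<Longrightarrow> \<bar>F h\<bar> \<le> B" using F unfolding bounded_cont_fun_def by blast
    have \<phi>: "continuous_on UNIV \<phi>" "\<bar>\<phi> x\<bar> \<le> B" for x
      unfolding \<phi>_def[abs_def]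
      by (intro net.continuous_comp_lin[OF F fin] continuous_on_prod continuous_on_product_coordinates)
         (intro B net.lin_CV fin)
    have lin_eq: "\<phi> (restrict0 I (\<lambda>i. (case i of (s, j) \<Rightarrow> U s j) \<omega>)) = F (net.lin (A m) (\<lambda>k. \<Prod>s\<in>{1..d}. U s (k s) \<omega>))"
      for U :: "nat \<Rightarrow> nat \<Rightarrow> 'q \<Rightarrow> real" and \<omega>
    proof -
      have "net.lin (A m) (\<lambda>k. \<Prod>s\<in>{1..d}. restrict0 I (\<lambda>i. (case i of (s, j) \<Rightarrow> U s j) \<omega>) (s, k s)) = net.lin (A m) (\<lambda>k. \<Prod>s\<in>{1..d}. U s (k s) \<omega>)"
      proof
        fix v
        have "(\<Prod>s\<in>{1..d}. restrict0 I (\<lambda>i. (case i of (s, j) \<Rightarrow> U s j) \<omega>) (s, k s)) = (\<Prod>s\<in>{1..d}. U s (k s) \<omega>)" if "k \<in> A m" for k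
          using that by (intro prod.cong) (auto simp: restrict0_def I_def Jm_def)
        then show "net.lin (A m) (\<lambda>k. \<Prod>s\<in>{1..d}. restrict0 I (\<lambda>i. (case i of (s, j) \<Rightarrow> U s j) \<omega>) (s, k s)) v = net.lin (A m) (\<lambda>k. \<Prod>s\<in>{1..d}. U s (k s) \<omega>) v"
          by (simp add: net.lin_def)
      qed
      then show ?thesis by (simp add: \<phi>_def)
    qed
    have "((\<lambda>n. \<integral>\<omega>. \<phi> (restrict0 I (\<lambda>i. (case i of (s, j) \<Rightarrow> nsum \<xi> (g s j) (n s) s) \<omega>)) \<partial>P) \<longlongrightarrow>
        (\<integral>\<omega>. \<phi> (restrict0 I (\<lambda>i. (case i of (s, j) \<Rightarrow> \<beta> s j) \<omega>)) \<partial>N)) Fl"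
    \<comment> \<open>The constant is \<open>KR 2\<close> times the unit L2 norm of the
      \<open>g s j\<close>; it also bounds the Gaussian second moments, through the limit
      theorem.\<close>
    proof (rule expectation_tendsto_of_cos[OF P N, where c = "KR 2"])
      show "finite I" using Jm by (simp add: I_def)
      fix i assume "i \<in> I"
      then obtain s j where i: "i = (s, j)" "s \<in> {1..d}" "1 \<le> j" using Jm by (auto simp: I_def)
      note gf = os.g_facts[OF i(2,3)] and gm = os.g_mom2[OF i(2,3)]
      show "mom_le P 2 (case i of (s, j) \<Rightarrow> nsum \<xi> (g s j) (n s) s) (KR 2)" for n
        using os.mom_le_nsum[OF i(2) _ gm gf(4), of "n s"] by (simp add: i(1))
      show "mom_le N 2 (case i of (s, j) \<Rightarrow> \<beta> s j) (KR 2)"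
        using gs.beta_mom[OF i(2,3) os.std_normal_moment_le[OF i(2) _ gm gf(4,3,5)]] by (simp add: i(1))
    next
      show "((\<lambda>n. \<integral>\<omega>. cos ((\<Sum>i\<in>I. t i * (case i of (s, j) \<Rightarrow> nsum \<xi> (g s j) (n s) s) \<omega>) + \<theta>) \<partial>P) \<longlongrightarrow>
        (\<integral>\<omega>. cos ((\<Sum>i\<in>I. t i * (case i of (s, j) \<Rightarrow> \<beta> s j) \<omega>) + \<theta>) \<partial>N)) Fl" for t \<theta>
        unfolding I_def by (rule os.cos_tendsto[OF gs.gaussian_array_axioms Jm Fl])
    qed (rule \<phi>)+
    then show ?thesis unfolding lin_eq RZ_def os.Rs_def .
  qed
  have tau4: "(\<lambda>m. tau P \<xi> g d 2 * (1/4) ^ m) \<longlonglongrightarrow> 0"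
    by (auto intro!: tendsto_eq_intros LIMSEQ_power_zero)
  have main: "((\<lambda>n. \<integral>\<omega>. F (Y n \<omega>) \<partial>P) \<longlongrightarrow> (\<integral>\<omega>. F (Z \<omega>) \<partial>N)) Fl" if F: "bounded_cont_fun V rho F" for F
  proof (rule net.bounded_cont_expectation_tendsto[where Y = Y and Z = Z, OF P N bdd YC ZC Y(5) Z(3) _ F])
    fix F L
    assume F: "bounded_cont_fun V rho F" and L: "0 \<le> L"
      "\<And>h h'. h \<in> CV V rho \<Longrightarrow> h' \<in> CV V rho \<Longrightarrow> \<bar>F h - F h'\<bar> \<le> L * net.supn (\<lambda>v. h v - h' v)"
    obtain B where B: "\<And>h. h \<in> CV V rho \<Longrightarrow> \<bar>F h\<bar> \<le> B" using F unfolding bounded_cont_fun_def by blast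
    have fin: "finite (A m)" "A m \<subseteq> K" for m using net.exhaustionD(1,2)[OF A] by auto
    have meas: "os.Rs n k \<in> borel_measurable P" "RZ k \<in> borel_measurable N" if "k \<in> K" for n k
      using mom_leD(1)[OF Rmom[OF that T2]] mom_leD(1)[OF RZmom[OF that T2]] by auto
    show "((\<lambda>n. \<integral>\<omega>. F (Y n \<omega>) \<partial>P) \<longlongrightarrow> (\<integral>\<omega>. F (Z \<omega>) \<partial>N)) Fl"
    proof (rule net.Lipschitz_expectation_tendsto[where Y = Y and Z = Z and F = F and YA = "\<lambda>n m \<omega>. net.lin (A m) (\<lambda>k. os.Rs n k \<omega>)"
        and ZA = "\<lambda>m \<omega>. net.lin (A m) (\<lambda>k. RZ k \<omega>)", OF P N YC ZC _ _ _ _ tau4 Y(5)[OF F] Z(3)[OF F] _ _ trunc[OF F] B L(2,1)])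
      \<comment> \<open>The L2 bound on the truncation error is lowered to L1, the form that pairs
        with a Lipschitz functional; it does not depend on \<open>n\<close>.\<close>
      show "mom_le P 1 (\<lambda>\<omega>. net.supn (\<lambda>v. Y n \<omega> v - net.lin (A m) (\<lambda>k. os.Rs n k \<omega>) v)) (tau P \<xi> g d 2 * (1/4) ^ m)" for n m
        by (rule P.mom_le_Lyapunov[OF Y(4)]) auto
      show "mom_le N 1 (\<lambda>\<omega>. net.supn (\<lambda>v. Z \<omega> v - net.lin (A m) (\<lambda>k. RZ k \<omega>) v)) (tau P \<xi> g d 2 * (1/4) ^ m)" for m
        by (rule N.mom_le_Lyapunov[OF Z(2)]) auto
      show "(\<lambda>\<omega>. F (net.lin (A m) (\<lambda>k. os.Rs n k \<omega>))) \<in> borel_measurable P" for n m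
        by (intro net.measurable_comp_lin[OF F fin] meas(1) subsetD[OF fin(2)])
      show "(\<lambda>\<omega>. F (net.lin (A m) (\<lambda>k. RZ k \<omega>))) \<in> borel_measurable N" for m
        by (intro net.measurable_comp_lin[OF F fin] meas(2) subsetD[OF fin(2)])
    qed (assumption | rule net.lin_CV[OF fin])+
  qed
  have conv: "\<exists>m. \<forall>n. (\<forall>s\<in>{1..d}. 1 \<le> n s \<and> m \<le> n s) \<longrightarrow> \<bar>(\<integral>\<omega>. F (Y n \<omega>) \<partial>P) - (\<integral>\<omega>. F (Z \<omega>) \<partial>N)\<bar> < e"
    if F: "bounded_cont_fun V rho F" and e: "0 < e" for F e
  proof -
    have "\<forall>\<^sub>F n in Fl. dist (\<integral>\<omega>. F (Y n \<omega>) \<partial>P) (\<integral>\<omega>. F (Z \<omega>) \<partial>N) < e" by (rule tendstoD[OF main[OF F] e])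
    then obtain m where "\<And>n. m \<le> Min (n ` {1..d}) \<Longrightarrow> dist (\<integral>\<omega>. F (Y n \<omega>) \<partial>P) (\<integral>\<omega>. F (Z \<omega>) \<partial>N) < e"
      unfolding Fl_def eventually_filtercomap_at_top_linorder by blast
    then show ?thesis unfolding Min_ge dist_real_def by (intro exI[of _ m]) auto
  qed
  \<comment> \<open>Chaining bounds the sup norm, which dominates the absolute value of the
    one-sided supremum in the claim.\<close>
  have sup_mom: "mom_le P p (\<lambda>\<omega>. SUP v\<in>V. Y n \<omega> v) (tau P \<xi> g d p * net.Phi sg)" if "p \<in> T" for p n
  proof (rule mom_le_mono[OF Y(3)[OF that] _ _ order_refl])
    show "(\<lambda>\<omega>. SUP v\<in>V. Y n \<omega> v) \<in> borel_measurable P" by (rule net.measurable_SUP[OF bdd Y(5)])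
    show "\<bar>SUP v\<in>V. Y n \<omega> v\<bar> \<le> \<bar>net.supn (Y n \<omega>)\<bar>" for \<omega>
      using net.abs_SUP_le_supn[OF Y(2), of n \<omega>] by linarith
  qed (use GT(2)[OF that] in simp)
  have bound: "integrable P (\<lambda>\<omega>. \<bar>SUP v\<in>V. Y n \<omega> v\<bar> powr p) \<and> lpn P (\<lambda>\<omega>. SUP v\<in>V. Y n \<omega> v) p \<le> net.Phi sg * tau P \<xi> g d p"
    if "2 \<le> p" "ereal p < a" for n p
    using mom_le_integrable[OF sup_mom[of p n]] mom_le_lpn[OF sup_mom[of p n]] that by (simp add: T_def mult.commute)
  show ?thesis
    unfolding rho_def[symmetric]
    using YQ ZQ Y(5) Z(3) conv bound by (intro exI[of _ Y] exI[of _ Z] conjI exI[of _ "net.Phi sg"]) blast+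
qed

end
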